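(* Let $n\ge 2$ and let $w,u\in W_{\mathrm{af}}$ be such that $i=\ell(w)-\ell(u)$ is a positive integer. Then the structure constant $p^w_{\rho_i,u}$ (which is an integer, since $\ell(w)=\ell(\rho_i)+\ell(u)$) equals the number of strong strips from $w$ to $u$.
   Context: Fix an integer $n\ge 2$. $W_{\mathrm{af}}$ is the affine symmetric group (the affine Weyl group of type $\widetilde A_{n-1}$), with simple generators $s_0,s_1,\dots,s_{n-1}$ (indices modulo $n$), length function $\ell$ and Bruhat (strong) order; $v\lessdot u$ means $v<u$ and $\ell(v)=\ell(u)-1$. It is realized as the group of bijections $w:\mathbb Z\to\mathbb Z$ with $w(x+n)=w(x)+n$ for all $x$ and $\sum_{x=1}^n w(x)=n(n+1)/2$, with product given by composition; $s_i$ exchanges $i+kn$ and $i+1+kn$ for all $k\in\mathbb Z$. For $i<j$ with $i\not\equiv j \pmod n$, $t_{ij}\in W_{\mathrm{af}}$ is the reflection exchanging $i+kn$ and $j+kn$ for all $k\in\mathbb Z$. Pieri elements: for $i>0$, $\rho_i=s_{i-1}s_{i-2}\cdots s_1s_0\in W_{\mathrm{af}}$, indices modulo $n$; $\ell(\rho_i)=i$. Strong strips: a marked strong cover $u\overset{a}{\longrightarrow}v$ consists of $u,v\in W_{\mathrm{af}}$ and an integer $a$ such that $u=vt_{ij}$, $v\lessdot u$ and $a=u(j)=v(i)$ for some integers $i\le 0<j$. A strong strip of length (size) $m$ from $u$ to $v$ is a path of marked strong covers $u\overset{a_1}{\longrightarrow}u_1\overset{a_2}{\longrightarrow}\cdots\overset{a_m}{\longrightarrow}u_m=v$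 with $a_1>a_2>\cdots>a_m$. The markings are part of the data, so strips with different markings are counted as different. Structure constants: let $P=\mathbb Z^n/\mathbb Z(1,\dots,1)$ be the weight lattice of $SL(n)$, with $e_i$ the images of the standard basis vectors, simple roots $\alpha_i=e_i-e_{i+1}$ for $1\le i\le n-1$, highest root $\theta=\alpha_1+\cdots+\alpha_{n-1}=e_1-e_n$, and $\alpha_0:=-\theta$ in $P$. $W_{\mathrm{af}}$ acts on $P$ by the level zero action: $s_i$ ($1\le i\le n-1$) is the reflection in $\alpha_i$ and $s_0$ acts as the reflection in $\theta$. Let $S=\mathrm{Sym}(P)$, $F=\mathrm{Frac}(S)$, and let $F_{W_{\mathrm{af}}}=\bigoplus_{w\in W_{\mathrm{af}}}Fw$ with product $(pv)(qw)=(p\,(v\cdot q))(vw)$ for $p,q\in F$, $v,w\in W_{\mathrm{af}}$. Put $A_i=\alpha_i^{-1}(1-s_i)$ for $i\in\mathbb Z/n\mathbb Z$, and $A_w=A_{i_1}\cdots A_{i_l}$ for any reduced word $w=s_{i_1}\cdots s_{i_l}$ (well defined; the $A_w$ form a left $F$-basis of $F_{W_{\mathrm{af}}}$). Let $\Delta:F_{W_{\mathrm{af}}}\to F_{W_{\mathrm{af}}}\otimes_F F_{W_{\mathrm{af}}}$ (tensor product of left $F$-vector spaces) be the left $F$-linear map with $\Delta(w)=w\otimes w$ for $w\in W_{\mathrm{af}}$. The equivariant Schubert structure constants $p^w_{u_1,u_2}\in S$ are defined by $\Delta(A_w)=\sum_{u_1,u_2}p^w_{u_1,u_2}A_{u_1}\otimes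 A_{u_2}$; $p^w_{u_1,u_2}$ is homogeneous of degree $\ell(u_1)+\ell(u_2)-\ell(w)$. *)

theory Defs
  imports "HOL-Library.Poly_Mapping" "HOL-Computational_Algebra.Fraction_Field"
begin

section \<open>The affine symmetric group\<close>

type_synonym perm = "int \<Rightarrow> int"

definition aff_sym :: "nat \<Rightarrow> perm set" where
  "aff_sym n = {w. bij w \<and> (\<forall>x. w (x + int n) = w x + int n)
                 \<and> (\<Sum>x = 1..int n. w x) = int n * (int n + 1) div 2}"

definition aff_refl :: "nat \<Rightarrow> int \<Rightarrow> int \<Rightarrow> perm" where
  "aff_refl n i j x =
     (if int n dvd x - i then x + (j - i)
      else if int n dvd x - j then x - (j - i)
      else x)"

definition simple_refl :: "nat \<Rightarrow> int \<Rightarrow> perm" where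
  "simple_refl n i = aff_refl n i (i + 1)"

definition word_perm :: "nat \<Rightarrow> int list \<Rightarrow> perm" where
  "word_perm n xs = foldr (\<lambda>i. (\<circ>) (simple_refl n i)) xs id"

definition is_word :: "nat \<Rightarrow> perm \<Rightarrow> int list \<Rightarrow> bool" where
  "is_word n w xs \<longleftrightarrow> set xs \<subseteq> {0..<int n} \<and> word_perm n xs = w"

definition aff_len :: "nat \<Rightarrow> perm \<Rightarrow> nat" where
  "aff_len n w = (LEAST k. \<exists>xs. is_word n w xs \<and> length xs = k)"

definition reduced_word :: "nat \<Rightarrow> perm \<Rightarrow> int list \<Rightarrow> bool" where
  "reduced_word n w xs \<longleftrightarrow> is_word n w xs \<and> length xs = aff_len n w"

definition bruhat_step :: "nat \<Rightarrow> perm \<Rightarrow> perm \<Rightarrow> bool" where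
  "bruhat_step n v u \<longleftrightarrow> v \<in> aff_sym n \<and> u \<in> aff_sym n \<and> aff_len n v < aff_len n u
     \<and> (\<exists>i j. i < j \<and> \<not> int n dvd j - i \<and> u = v \<circ> aff_refl n i j)"

definition bruhat_less :: "nat \<Rightarrow> perm \<Rightarrow> perm \<Rightarrow> bool" where
  "bruhat_less n = (bruhat_step n)\<^sup>+\<^sup>+"

definition bruhat_cover :: "nat \<Rightarrow> perm \<Rightarrow> perm \<Rightarrow> bool" where
  "bruhat_cover n v u \<longleftrightarrow> bruhat_less n v u \<and> aff_len n u = aff_len n v + 1"

text \<open>The element \<open>s\<^sub>i\<^sub>-\<^sub>1 \<dots> s\<^sub>1 s\<^sub>0\<close>, indices modulo \<open>n\<close>.\<close>

definition pieri :: "nat \<Rightarrow> nat \<Rightarrow> perm" where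
  "pieri n i = word_perm n (map (\<lambda>k. int k mod int n) (rev [0..<i]))"


section \<open>Strong strips\<close>

text \<open>\<open>marked_cover n u a v\<close> is the marked strong cover from \<open>u\<close> down to \<open>v\<close> with marking \<open>a\<close>.\<close>

definition marked_cover :: "nat \<Rightarrow> perm \<Rightarrow> int \<Rightarrow> perm \<Rightarrow> bool" where
  "marked_cover n u a v \<longleftrightarrow> bruhat_cover n v u
     \<and> (\<exists>i j. i \<le> 0 \<and> 0 < j \<and> \<not> int n dvd j - i \<and> u = v \<circ> aff_refl n i j
            \<and> a = u j \<and> a = v i)"

text \<open>A path \<open>u \<rightarrow> u\<^sub>1 \<rightarrow> \<dots> \<rightarrow> u\<^sub>m = v\<close> with markings \<open>a\<^sub>1, \<dots>, a\<^sub>m\<close> is encoded by the list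
  \<open>[(a\<^sub>1, u\<^sub>1), \<dots>, (a\<^sub>m, u\<^sub>m)]\<close>.\<close>

fun strong_path :: "nat \<Rightarrow> perm \<Rightarrow> (int \<times> perm) list \<Rightarrow> perm \<Rightarrow> bool" where
  "strong_path n u [] v \<longleftrightarrow> u = v"
| "strong_path n u ((a, u') # ps) v \<longleftrightarrow> marked_cover n u a u' \<and> strong_path n u' ps v"

definition strong_strips :: "nat \<Rightarrow> perm \<Rightarrow> perm \<Rightarrow> (int \<times> perm) list set" where
  "strong_strips n u v = {ps. strong_path n u ps v \<and> sorted_wrt (>) (map fst ps)}"


section \<open>The weight lattice and its symmetric algebra\<close>

text \<open>The lattice \<open>P = \<int>\<^sup>n / \<int>(1,\<dots>,1)\<close> is free on \<open>e\<^sub>1, \<dots>, e\<^sub>n\<^sub>-\<^sub>1\<close>, and \<open>e\<^sub>n = -(e\<^sub>1 + \<dots> + e\<^sub>n\<^sub>-\<^sub>1)\<close>.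
  So \<open>Sym(P)\<close> is the ring of integer polynomials in the variables with index in \<open>{1..<n}\<close>,
  a subring of the type \<open>mpoly_int\<close>; its fraction field is a subfield of \<open>mfrac\<close>.\<close>

type_synonym mpoly_int = "(nat \<Rightarrow>\<^sub>0 nat) \<Rightarrow>\<^sub>0 int"
type_synonym mfrac = "mpoly_int fract"

definition S_carrier :: "nat \<Rightarrow> mpoly_int set" where
  "S_carrier n = {p. \<forall>m \<in> Poly_Mapping.keys p. Poly_Mapping.keys m \<subseteq> {1..<n}}"

definition F_carrier :: "nat \<Rightarrow> mfrac set" where
  "F_carrier n = {Fract a b | a b. a \<in> S_carrier n \<and> b \<in> S_carrier n \<and> b \<noteq> 0}"

definition var :: "nat \<Rightarrow> mpoly_int" where
  "var k = Poly_Mapping.single (Poly_Mapping.single k 1) 1"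

text \<open>The weights \<open>e\<^sub>j\<close>, with the index \<open>j\<close> read modulo \<open>n\<close>.\<close>

definition wt :: "nat \<Rightarrow> int \<Rightarrow> mpoly_int" where
  "wt n j = (if int n dvd j then - (\<Sum>k = 1..<n. var k) else var (nat (j mod int n)))"

definition highest_root :: "nat \<Rightarrow> mpoly_int" where
  "highest_root n = wt n 1 - wt n (int n)"

definition simple_root :: "nat \<Rightarrow> int \<Rightarrow> mpoly_int" where
  "simple_root n i = (if int n dvd i then - highest_root n else wt n i - wt n (i + 1))"

text \<open>The level zero action on \<open>P\<close> is \<open>w e\<^sub>j = e\<^bsub>w(j)\<^esub>\<close>, extended to \<open>Sym(P)\<close> by substitution
  and then to fractions of elements of \<open>Sym(P)\<close> (\<open>act_F_Fract\<close> shows that this is well defined).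
  By \<open>act_S_wt\<close> and \<open>simple_refl_wt\<close>, \<open>s\<^sub>i\<close> acts on \<open>P\<close> as the reflection in \<open>\<alpha>\<^sub>i\<close>
  (in \<open>\<theta>\<close> if \<open>i = 0\<close>).\<close>

definition act_S :: "nat \<Rightarrow> perm \<Rightarrow> mpoly_int \<Rightarrow> mpoly_int" where
  "act_S n w p = (\<Sum>m \<in> Poly_Mapping.keys p. of_int (Poly_Mapping.lookup p m) *
     (\<Prod>k \<in> Poly_Mapping.keys m. wt n (w (int k)) ^ Poly_Mapping.lookup m k))"

definition act_F :: "nat \<Rightarrow> perm \<Rightarrow> mfrac \<Rightarrow> mfrac" where
  "act_F n w q = (THE r. \<exists>a \<in> S_carrier n. \<exists>b \<in> S_carrier n.
     b \<noteq> 0 \<and> q = Fract a b \<and> r = Fract (act_S n w a) (act_S n w b))"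

lemma wt_cong: "int n dvd i - j \<Longrightarrow> wt n i = wt n j"
  using mod_eq_dvd_iff[of i "int n" j] by (auto simp: wt_def dvd_eq_mod_eq_0)

lemma sum_wt:
  assumes "n \<ge> 1"
  shows "(\<Sum>j = 1..int n. wt n j) = 0"
proof -
  have *: "{1..int n} = insert (int n) (int ` {1..<n})"
    using assms by (auto simp: image_int_atLeastLessThan)
  have "(\<Sum>j \<in> int ` {1..<n}. wt n j) = (\<Sum>k = 1..<n. wt n (int k))"
    by (simp add: sum.reindex)
  also have "\<dots> = (\<Sum>k = 1..<n. var k)"
    by (intro sum.cong) (auto simp: wt_def dest: nat_dvd_not_less)
  finally show ?thesis unfolding * by (subst sum.insert) (auto simp: wt_def)
qed

lemma act_S_var: "act_S n w (var k) = wt n (w (int k))"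
  by (simp add: act_S_def var_def)

lemma act_S_superset:
  assumes "finite K" "Poly_Mapping.keys p \<subseteq> K"
  shows "act_S n w p = (\<Sum>m \<in> K. of_int (Poly_Mapping.lookup p m) *
     (\<Prod>k \<in> Poly_Mapping.keys m. wt n (w (int k)) ^ Poly_Mapping.lookup m k))"
  unfolding act_S_def using assms by (intro sum.mono_neutral_left) (auto simp: in_keys_iff)

lemma act_S_0 [simp]: "act_S n w 0 = 0"
  and act_S_1 [simp]: "act_S n w 1 = 1"
  by (simp_all add: act_S_def)

lemma act_S_add: "act_S n w (p + q) = act_S n w p + act_S n w q"
proof -
  let ?K = "Poly_Mapping.keys p \<union> Poly_Mapping.keys q"
  have "Poly_Mapping.keys (p + q) \<subseteq> ?K" by (rule Poly_Mapping.keys_add)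
  then show ?thesis
    by (simp add: act_S_superset[where K = ?K] lookup_add distrib_right sum.distrib)
qed

lemma act_S_uminus: "act_S n w (- p) = - act_S n w p"
  using act_S_add[of n w p "- p"] by (simp add: eq_neg_iff_add_eq_0 add.commute)

lemma act_S_sum: "act_S n w (sum f A) = (\<Sum>a\<in>A. act_S n w (f a))"
  by (induction A rule: infinite_finite_induct) (simp_all add: act_S_add)

lemma act_S_single: "act_S n w (Poly_Mapping.single m c) = of_int c *
    (\<Prod>k \<in> Poly_Mapping.keys m. wt n (w (int k)) ^ Poly_Mapping.lookup m k)"
  by (cases "c = 0") (simp_all add: act_S_def)

lemma monom_eval_add:
  fixes x :: "nat \<Rightarrow> 'a :: comm_monoid_mult" and l m :: "nat \<Rightarrow>\<^sub>0 nat"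
  shows "(\<Prod>k \<in> Poly_Mapping.keys (l + m). x k ^ Poly_Mapping.lookup (l + m) k)
    = (\<Prod>k \<in> Poly_Mapping.keys l. x k ^ Poly_Mapping.lookup l k)
    * (\<Prod>k \<in> Poly_Mapping.keys m. x k ^ Poly_Mapping.lookup m k)"
proof -
  let ?K = "Poly_Mapping.keys l \<union> Poly_Mapping.keys m"
  have "(\<Prod>k \<in> Poly_Mapping.keys j. x k ^ Poly_Mapping.lookup j k)
      = (\<Prod>k \<in> ?K. x k ^ Poly_Mapping.lookup j k)" if "Poly_Mapping.keys j \<subseteq> ?K" for j
    using that by (intro prod.mono_neutral_left) (auto simp: in_keys_iff)
  from this[of "l + m"] this[of l] this[of m] show ?thesis
    by (simp add: Poly_Mapping.keys_add lookup_add power_add prod.distrib)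
qed

lemma mpoly_sum_single:
  "p = (\<Sum>m \<in> Poly_Mapping.keys p. Poly_Mapping.single m (Poly_Mapping.lookup p m))"
  by (rule poly_mapping_eqI) (auto simp: lookup_sum lookup_single when_def in_keys_iff)

lemma act_S_mult: "act_S n w (p * q) = act_S n w p * act_S n w q"
proof -
  let ?s = "\<lambda>p m. Poly_Mapping.single m (Poly_Mapping.lookup p m)"
  let ?P = "\<Sum>l \<in> Poly_Mapping.keys p. ?s p l" and ?Q = "\<Sum>m \<in> Poly_Mapping.keys q. ?s q m"
  have "act_S n w (?s p l * ?s q m) = act_S n w (?s p l) * act_S n w (?s q m)" for l m
    by (simp add: mult_single act_S_single monom_eval_add mult_ac)
  then have "act_S n w (?P * ?Q) = act_S n w ?P * act_S n w ?Q"
    by (simp only: act_S_sum sum_product)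
  then show ?thesis by (simp only: mpoly_sum_single[symmetric])
qed

lemma act_S_power: "act_S n w (p ^ k) = act_S n w p ^ k"
  by (induction k) (simp_all add: act_S_mult)

lemma act_S_prod: "act_S n w (prod f A) = (\<Prod>a\<in>A. act_S n w (f a))"
  by (induction A rule: infinite_finite_induct) (simp_all add: act_S_mult)

lemma act_S_of_int: "act_S n w (of_int c) = of_int c"
proof -
  have nat: "act_S n w (of_nat k) = of_nat k" for k
    by (induction k) (simp_all add: act_S_add)
  show ?thesis
    by (cases c) (simp_all add: nat act_S_uminus flip: of_nat_Suc)
qed

lemma periodic_iter:
  assumes "\<forall>x. w (x + int n) = w x + int n"
  shows "w (x + int n * z) = w x + int n * z"
proof (induction z rule: int_induct[of _ 0])
  case (step1 i)
  then show ?case using assms[rule_format, of "x + int n * i"] by (simp add: algebra_simps)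
next
  case (step2 i)
  then show ?case using assms[rule_format, of "x + int n * (i - 1)"] by (simp add: algebra_simps)
qed simp

lemma sum_wt_perm:
  assumes "n \<ge> 1" "inj w" and per: "\<forall>x. w (x + int n) = w x + int n"
  shows "(\<Sum>j = 1..int n. wt n (w j)) = 0"
proof -
  define r where "r x = (x - 1) mod int n + 1" for x
  have r_in: "r x \<in> {1..int n}" for x
    using assms(1) pos_mod_bound[of "int n" "x - 1"] pos_mod_sign[of "int n" "x - 1"]
    unfolding r_def atLeastAtMost_iff by linarith
  have r_dvd: "int n dvd x - r x" for x
  proof -
    have "x - r x = int n * ((x - 1) div int n)"
      using mult_div_mod_eq[of "int n" "x - 1"] unfolding r_def by linarith
    then show ?thesis by simp
  qed
  have inj: "inj_on (\<lambda>j. r (w j)) {1..int n}"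
  proof (rule inj_onI)
    fix i j assume ij: "i \<in> {1..int n}" "j \<in> {1..int n}" and eq: "r (w i) = r (w j)"
    have "int n dvd w i - w j"
      using dvd_diff[OF r_dvd[of "w i"] r_dvd[of "w j"]] eq by simp
    then obtain z where "w i = w j + int n * z" by (metis dvdE add.commute diff_add_cancel)
    then have "w i = w (j + int n * z)" by (simp add: periodic_iter[OF per])
    then have *: "i = j + int n * z" using \<open>inj w\<close> by (simp add: inj_eq)
    with ij have "\<bar>int n * z\<bar> < int n" by auto
    then have "int n * \<bar>z\<bar> < int n * 1" by (simp add: abs_mult)
    then have "\<bar>z\<bar> < 1" by (rule mult_left_less_imp_less) simp
    then have "z = 0" by simp
    with * show "i = j" by simp
  qed
  have bij: "bij_betw (\<lambda>j. r (w j)) {1..int n} {1..int n}"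
    unfolding bij_betw_def using inj r_in endo_inj_surj[OF _ _ inj] by (simp add: image_subset_iff)
  have "(\<Sum>j = 1..int n. wt n (w j)) = (\<Sum>j = 1..int n. wt n (r (w j)))"
    using r_dvd by (intro sum.cong wt_cong) auto
  also have "\<dots> = (\<Sum>j = 1..int n. wt n j)"
    using sum.reindex_bij_betw[OF bij, of "wt n"] .
  finally show ?thesis using sum_wt[OF assms(1)] by simp
qed

lemma act_S_wt:
  assumes n: "n \<ge> 1" and w: "inj w" "\<forall>x. w (x + int n) = w x + int n"
  shows "act_S n w (wt n j) = wt n (w j)"
proof (cases "int n dvd j")
  case True
  have *: "{1..int n} = insert (int n) (int ` {1..<n})"
    using n by (auto simp: image_int_atLeastLessThan)
  have "wt n (w (int n)) + (\<Sum>k = 1..<n. wt n (w (int k))) = 0"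
    using sum_wt_perm[OF n w] unfolding * by (subst (asm) sum.insert) (auto simp: sum.reindex)
  moreover have "wt n (w j) = wt n (w (int n))"
  proof -
    obtain z' where "j = int n * z'" using True by (rule dvdE)
    then have "j = int n + int n * (z' - 1)" by (simp add: algebra_simps)
    then have "w j = w (int n) + int n * (z' - 1)" using periodic_iter[OF w(2)] by metis
    then show ?thesis by (auto intro!: wt_cong)
  qed
  ultimately show ?thesis using True
    by (simp add: wt_def[of n j] act_S_uminus act_S_sum act_S_var minus_unique add.commute)
next
  case False
  have "j = j mod int n + int n * (j div int n)" by simp
  then have "w j = w (j mod int n) + int n * (j div int n)" using periodic_iter[OF w(2)] by metis
  then have "wt n (w j) = wt n (w (j mod int n))" by (auto intro!: wt_cong)
  with False n show ?thesis by (simp add: wt_def[of n j] act_S_var)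
qed

lemma act_S_inverse:
  assumes n: "n \<ge> 1" and w: "bij w" "\<forall>x. w (x + int n) = w x + int n"
    and p: "p \<in> S_carrier n"
  shows "act_S n (inv w) (act_S n w p) = p"
proof -
  have inv: "inj (inv w)" "\<forall>x. inv w (x + int n) = inv w x + int n"
    using w by (simp_all add: bij_imp_bij_inv bij_is_inj inv_f_eq surj_f_inv_f bij_is_surj)
  have eq: "act_S n (inv w) (act_S n w (Poly_Mapping.single m c)) = Poly_Mapping.single m c"
    if "Poly_Mapping.keys m \<subseteq> {1..<n}" for m c
  proof -
    have v: "act_S n (inv w) (wt n (w (int k))) = wt n (id (int k))" for k
      using act_S_wt[OF n inv] w by (simp add: bij_is_inj)
    have "act_S n (inv w) (act_S n w (Poly_Mapping.single m c)) = of_int c *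
        (\<Prod>k \<in> Poly_Mapping.keys m. wt n (int k) ^ Poly_Mapping.lookup m k)"
      by (simp add: act_S_single act_S_mult act_S_of_int act_S_prod act_S_power v)
    also have "\<dots> = of_int c * (\<Prod>k \<in> Poly_Mapping.keys m. var k ^ Poly_Mapping.lookup m k)"
    proof -
      have "wt n (int k) = var k" if k: "k \<in> Poly_Mapping.keys m" for k
      proof -
        have "0 < k" "k < n" using k \<open>Poly_Mapping.keys m \<subseteq> {1..<n}\<close> by auto
        then show ?thesis by (auto simp: wt_def dest: nat_dvd_not_less)
      qed
      then show ?thesis by simp
    qed
    also have "\<dots> = Poly_Mapping.single m c"
    proof -
      have pw: "var k ^ j = Poly_Mapping.single (Poly_Mapping.single k j) 1" for k j
        by (induction j) (simp_all add: var_def mult_single flip: single_add)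
      have "(\<Prod>k \<in> K. var k ^ f k) = Poly_Mapping.single (\<Sum>k \<in> K. Poly_Mapping.single k (f k)) 1"
        for K and f :: "nat \<Rightarrow> nat"
        by (induction K rule: infinite_finite_induct) (simp_all add: pw mult_single)
      moreover have "(\<Sum>k \<in> Poly_Mapping.keys m. Poly_Mapping.single k (Poly_Mapping.lookup m k)) = m"
        by (rule poly_mapping_eqI) (auto simp: lookup_sum lookup_single when_def in_keys_iff)
      moreover have "of_int c = (Poly_Mapping.single 0 c :: mpoly_int)"
        by (subst single_of_int[symmetric]) (simp del: single_of_int)
      ultimately show ?thesis by (simp add: mult_single)
    qed
    finally show ?thesis .
  qed
  have "act_S n (inv w) (act_S n w (\<Sum>m \<in> Poly_Mapping.keys p.
      Poly_Mapping.single m (Poly_Mapping.lookup p m)))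
    = (\<Sum>m \<in> Poly_Mapping.keys p. Poly_Mapping.single m (Poly_Mapping.lookup p m))"
    unfolding act_S_sum using p by (intro sum.cong refl eq) (auto simp: S_carrier_def)
  then show ?thesis by (simp flip: mpoly_sum_single)
qed

lemma act_F_Fract:
  assumes "n \<ge> 1" "w \<in> aff_sym n" "a \<in> S_carrier n" "b \<in> S_carrier n" "b \<noteq> 0"
  shows "act_F n w (Fract a b) = Fract (act_S n w a) (act_S n w b)"
  unfolding act_F_def
proof (rule the_equality)
  have w: "bij w" "\<forall>x. w (x + int n) = w x + int n" using assms(2) by (auto simp: aff_sym_def)
  have nz: "act_S n w c \<noteq> 0" if "c \<in> S_carrier n" "c \<noteq> 0" for c
    using act_S_inverse[OF assms(1) w that(1)] that(2) by auto
  fix r assume "\<exists>a'\<in>S_carrier n. \<exists>b'\<in>S_carrier n. b' \<noteq> 0 \<and> Fract a b = Fract a' b'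
    \<and> r = Fract (act_S n w a') (act_S n w b')"
  then obtain a' b' where *: "b' \<in> S_carrier n" "b' \<noteq> 0" "Fract a b = Fract a' b'"
    "r = Fract (act_S n w a') (act_S n w b')" by blast
  then have "act_S n w (a * b') = act_S n w (a' * b)" using assms(5) by (simp add: eq_fract)
  then show "r = Fract (act_S n w a) (act_S n w b)"
    using * nz assms by (simp add: eq_fract act_S_mult)
qed (use assms in blast)

lemma simple_refl_wt:
  assumes "n \<ge> 2"
  shows "wt n (simple_refl n i j) = wt n j
    - (if int n dvd j - i then 1 else if int n dvd j - (i + 1) then -1 else 0) * simple_root n i"
proof -
  have root: "simple_root n i = wt n i - wt n (i + 1)"
  proof (cases "int n dvd i")
    case True
    then have "wt n i = wt n (int n)" "wt n (i + 1) = wt n 1"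
      by (auto intro!: wt_cong)
    with True show ?thesis by (simp add: simple_root_def highest_root_def)
  qed (simp add: simple_root_def)
  consider "int n dvd j - i" | "\<not> int n dvd j - i" "int n dvd j - (i + 1)"
    | "\<not> int n dvd j - i" "\<not> int n dvd j - (i + 1)" by blast
  then show ?thesis
  proof cases
    case 1
    then have "wt n j = wt n i" "wt n (j + 1) = wt n (i + 1)" by (auto intro!: wt_cong)
    with 1 root show ?thesis by (simp add: simple_refl_def aff_refl_def)
  next
    case 2
    then have "wt n j = wt n (i + 1)" "wt n (j - 1) = wt n i"
      by (auto intro!: wt_cong simp: algebra_simps)
    with 2 root show ?thesis by (simp add: simple_refl_def aff_refl_def)
  next
    case 3
    then show ?thesis by (simp add: simple_refl_def aff_refl_def)
  qed
qed


section \<open>The twisted group algebra and the structure constants\<close>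

text \<open>\<open>F\<^bsub>W\<^esub>\<close> is the space of finitely supported functions \<open>W \<rightarrow> F\<close>.  The tensor square over \<open>F\<close>
  has the \<open>F\<close>-basis \<open>v \<otimes> w\<close>, so it is the space of finitely supported functions
  \<open>W \<times> W \<rightarrow> F\<close>.\<close>

type_synonym twisted = "perm \<Rightarrow>\<^sub>0 mfrac"
type_synonym twisted2 = "(perm \<times> perm) \<Rightarrow>\<^sub>0 mfrac"

definition tw_mult :: "nat \<Rightarrow> twisted \<Rightarrow> twisted \<Rightarrow> twisted" where
  "tw_mult n f g = (\<Sum>v \<in> Poly_Mapping.keys f. \<Sum>w \<in> Poly_Mapping.keys g.
     Poly_Mapping.single (v \<circ> w) (Poly_Mapping.lookup f v * act_F n v (Poly_Mapping.lookup g w)))"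

definition scale :: "mfrac \<Rightarrow> ('a \<Rightarrow>\<^sub>0 mfrac) \<Rightarrow> ('a \<Rightarrow>\<^sub>0 mfrac)" where
  "scale c f = Poly_Mapping.map ((*) c) f"

definition tensor :: "twisted \<Rightarrow> twisted \<Rightarrow> twisted2" where
  "tensor f g = (\<Sum>v \<in> Poly_Mapping.keys f. \<Sum>w \<in> Poly_Mapping.keys g.
     Poly_Mapping.single (v, w) (Poly_Mapping.lookup f v * Poly_Mapping.lookup g w))"

definition coprod :: "twisted \<Rightarrow> twisted2" where
  "coprod f = (\<Sum>v \<in> Poly_Mapping.keys f. Poly_Mapping.single (v, v) (Poly_Mapping.lookup f v))"

definition A_gen :: "nat \<Rightarrow> int \<Rightarrow> twisted" where
  "A_gen n i = scale (inverse (Fract (simple_root n i) 1))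
     (Poly_Mapping.single id 1 - Poly_Mapping.single (simple_refl n i) 1)"

definition A_word :: "nat \<Rightarrow> int list \<Rightarrow> twisted" where
  "A_word n xs = foldr (\<lambda>i. tw_mult n (A_gen n i)) xs (Poly_Mapping.single id 1)"

text \<open>The choice of the reduced word does not matter, by the braid relations for the \<open>A\<^sub>i\<close>.\<close>

definition A_elt :: "nat \<Rightarrow> perm \<Rightarrow> twisted" where
  "A_elt n w = A_word n (SOME xs. reduced_word n w xs)"

definition is_coprod_expansion :: "nat \<Rightarrow> perm \<Rightarrow> twisted2 \<Rightarrow> bool" where
  "is_coprod_expansion n w p \<longleftrightarrow>
     Poly_Mapping.keys p \<subseteq> aff_sym n \<times> aff_sym n \<and>
     range (Poly_Mapping.lookup p) \<subseteq> F_carrier n \<and>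
     coprod (A_elt n w) = (\<Sum>(u1, u2) \<in> Poly_Mapping.keys p.
       scale (Poly_Mapping.lookup p (u1, u2)) (tensor (A_elt n u1) (A_elt n u2)))"

text \<open>\<open>struct_const n w u1 u2\<close> is \<open>p\<^sup>w\<close> with lower indices \<open>u1, u2\<close>, as an element of \<open>Frac(Sym(P))\<close>.\<close>

definition struct_const :: "nat \<Rightarrow> perm \<Rightarrow> perm \<Rightarrow> perm \<Rightarrow> mfrac" where
  "struct_const n w u1 u2 = Poly_Mapping.lookup (THE p. is_coprod_expansion n w p) (u1, u2)"

end

theory Submission
  imports "HOL-Computational_Algebra.Polynomial" Defs
begin

text \<open>
  Fix a parameter \<open>z\<close> invariant under \<open>W\<close> and a bound \<open>lo\<close>, and let \<open>Q(x)\<close> be the product of the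
  \<open>z - e\<^sub>y\<close> over all \<open>y > lo\<close> with \<open>x\<^sup>-\<^sup>1(y) \<le> 0\<close>. If \<open>lo\<close> is not congruent to \<open>k\<close>, the \<open>F\<close>-linear map
  \<open>x \<mapsto> Q(x)\<^sup>-\<^sup>1 x\<close> commutes with left multiplication by \<open>A\<^sub>k\<close>; otherwise one lowers \<open>lo\<close> by one. The
  image of \<open>A\<^sub>w\<close> is a sum over the strong strips from \<open>w\<close> to \<open>u\<close> of \<open>A\<^sub>u\<close> with a product of factors
  \<open>1 / (z - e\<^sub>a)\<close> as coefficient: run through the possible markings \<open>a\<close> in decreasing order. Each step
  with \<open>a\<close> not congruent to \<open>k, k + 1\<close> commutes with \<open>A\<^sub>k\<close>, and so do two consecutive steps with
  markings \<open>k + 1, k\<close> modulo \<open>n\<close> taken together.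

  The sum of the coefficients of the image of \<open>A\<^sub>v\<close> is computed in the same way by divided differences:
  it vanishes unless \<open>v = \<rho>\<^sub>h\<close>, where it is the product of the \<open>1 / (z - e\<^sub>y)\<close> with \<open>lo < y \<le> h\<close>. Hence
  applying the map and this sum to the first factor of \<open>\<Delta>(A\<^sub>w)\<close> expresses the coefficient of \<open>A\<^sub>u\<close> in
  the image of \<open>A\<^sub>w\<close> through the structure constants of \<open>\<rho>\<^sub>h, u\<close>. Comparing leading terms for
  \<open>z \<rightarrow> \<infinity>\<close> gives the result. Integers \<open>z = N\<close> suffice, since two rational functions that agree at all
  integers are equal.
\<close>

text \<open>The product over all values at nonpositive positions would be infinite. The cut at
  \<open>lo\<close> makes it finite but spoils the symmetry under s_k when s_k moves values across
  the cut; this is why cuts congruent to k are excluded.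

  The equality of the image of A_w with a sum over strips is not obtained by expanding anything:
  both families obey the recursion "A_k sends the member at v to the member at s_k v, or to 0" and
  agree at the identity. The factor 1 / (z - e_(k+1)) alone is not invariant under s_k, but its
  product with 1 / (z - e_k) is, and the divided difference of either single factor is this product
  up to sign. That extra term accounts for the new cover from s_k v to v.

  For the leading terms, take the cut at -l. The product attached to \<rho>_h then has l + h
  factors, while a strip with i steps carries l + i factors: each cover contributes one factor, and
  the number of smaller values at nonpositive positions does not change. So the constants with h < i
  vanish, and the one with h = i counts strips.\<close>

lemma coeff_mult_bounds:
  fixes p q :: "'a::comm_semiring_0 poly"
  assumes "degree p \<le> k" "degree q \<le> m"
  shows "coeff (p * q) (k + m) = coeff p k * coeff q m"
proof -
  have "coeff p i * coeff q (k + m - i) = 0" if "i \<noteq> k" for i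
    using that assms by (cases "i < k") (simp_all add: coeff_eq_0)
  then have "(\<Sum>i\<le>k + m. coeff p i * coeff q (k + m - i)) = (\<Sum>i\<in>{k}. coeff p i * coeff q (k + m - i))"
    by (intro sum.mono_neutral_right) auto
  then show ?thesis by (simp add: coeff_mult)
qed

section \<open>The affine symmetric group\<close>

locale affine_symmetric =
  fixes n :: nat
  assumes n2: "n \<ge> 2"
begin

abbreviation W :: "perm set" where "W \<equiv> aff_sym n"
abbreviation s :: "int \<Rightarrow> perm" where "s \<equiv> simple_refl n"
abbreviation t :: "int \<Rightarrow> int \<Rightarrow> perm" where "t \<equiv> aff_refl n"
abbreviation len :: "perm \<Rightarrow> nat" where "len \<equiv> aff_len n"

definition periodic :: "(int \<Rightarrow> 'a) \<Rightarrow> bool" where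
  "periodic g \<longleftrightarrow> (\<forall>x. g (x + int n) = g x)"

lemma periodic_mult:
  assumes "periodic g"
  shows "g (x + int n * m) = g x"
proof (induction m rule: int_induct[of _ 0])
  case (step1 i)
  then show ?case using assms[unfolded periodic_def, rule_format, of "x + int n * i"]
    by (simp add: algebra_simps)
next
  case (step2 i)
  then show ?case using assms[unfolded periodic_def, rule_format, of "x + int n * (i - 1)"]
    by (simp add: algebra_simps)
qed simp

lemma periodic_dvd:
  assumes "periodic g" "int n dvd x - y"
  shows "g x = g y"
proof -
  obtain m where "x - y = int n * m" using assms(2) by (rule dvdE)
  then have "x = y + int n * m" by simp
  then show ?thesis using periodic_mult[OF assms(1)] by simp
qed

definition res :: "int \<Rightarrow> int" where "res x = (x - 1) mod int n + 1"

lemma res_in: "res x \<in> {1..int n}"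
  using n2 pos_mod_bound[of "int n" "x - 1"] pos_mod_sign[of "int n" "x - 1"]
  unfolding res_def atLeastAtMost_iff by linarith

lemma res_dvd: "int n dvd x - res x"
proof -
  have "x - res x = int n * ((x - 1) div int n)"
    using mult_div_mod_eq[of "int n" "x - 1"] unfolding res_def by linarith
  then show ?thesis by simp
qed

lemma dvd_small_eq:
  assumes "int n dvd x - y" "x \<in> {1..int n}" "y \<in> {1..int n}"
  shows "x = y"
proof (rule ccontr)
  assume "x \<noteq> y"
  then have "int n \<le> \<bar>x - y\<bar>" using assms(1) dvd_imp_le_int[of "x - y" "int n"] by simp
  with assms(2,3) show False by auto
qed

text \<open>An injective map commuting with the shift by n permutes the residue classes modulo n.
  This is what makes total displacement additive under composition.\<close>

lemma periodic_sum_reindex: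
  fixes g :: "int \<Rightarrow> 'a::comm_monoid_add"
  assumes "periodic g" "inj v" "\<And>x. v (x + int n) = v x + int n"
  shows "(\<Sum>x = 1..int n. g (v x)) = (\<Sum>x = 1..int n. g x)"
proof -
  have inj: "inj_on (\<lambda>j. res (v j)) {1..int n}"
  proof (rule inj_onI)
    fix i j assume ij: "i \<in> {1..int n}" "j \<in> {1..int n}" and eq: "res (v i) = res (v j)"
    have "int n dvd v i - v j"
      using dvd_diff[OF res_dvd[of "v i"] res_dvd[of "v j"]] eq by simp
    then obtain z where "v i - v j = int n * z" by (rule dvdE)
    then have "v i = v (j + int n * z)"
      using periodic_iter[of v n j z] assms(3) by simp
    then have "i = j + int n * z" using assms(2) by (simp add: inj_eq)
    then show "i = j" using dvd_small_eq[OF _ ij] by simp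
  qed
  have bij: "bij_betw (\<lambda>j. res (v j)) {1..int n} {1..int n}"
    unfolding bij_betw_def using inj res_in endo_inj_surj[OF _ _ inj] by (simp add: image_subset_iff)
  have "(\<Sum>x = 1..int n. g (v x)) = (\<Sum>x = 1..int n. g (res (v x)))"
    using res_dvd by (intro sum.cong periodic_dvd[OF assms(1)]) auto
  also have "\<dots> = (\<Sum>x = 1..int n. g x)"
    using sum.reindex_bij_betw[OF bij, of g] .
  finally show ?thesis .
qed

text \<open>The displacement \<open>w x - x\<close> is n-periodic, unlike \<open>w x\<close> itself,
  so its sum over a period can be reindexed by any other element of W.\<close>

lemma W_iff:
  "w \<in> W \<longleftrightarrow> bij w \<and> (\<forall>x. w (x + int n) = w x + int n) \<and> (\<Sum>x = 1..int n. w x - x) = 0"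
proof -
  have "(\<Sum>x = 1..int m. x) = int m * (int m + 1) div 2" for m
  proof (induction m)
    case (Suc m)
    have "{1..int (Suc m)} = insert (int m + 1) {1..int m}" by auto
    then have "(\<Sum>x = 1..int (Suc m). x) = int m + 1 + int m * (int m + 1) div 2"
      using Suc.IH by simp
    also have "\<dots> = ((int m + 1) * 2 + int m * (int m + 1)) div 2" by simp
    also have "\<dots> = int (Suc m) * (int (Suc m) + 1) div 2" by (simp add: algebra_simps)
    finally show ?case .
  qed simp
  then show ?thesis by (auto simp: aff_sym_def sum_subtractf)
qed

lemma W_bij: "w \<in> W \<Longrightarrow> bij w" by (simp add: W_iff)
lemma W_inj: "w \<in> W \<Longrightarrow> inj w" by (simp add: W_iff bij_is_inj)
lemma W_eq_iff: "w \<in> W \<Longrightarrow> w x = w y \<longleftrightarrow> x = y" using W_inj by (auto simp: inj_eq)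
lemma W_shift: "w \<in> W \<Longrightarrow> w (x + int n * m) = w x + int n * m"
  by (rule periodic_iter) (simp add: W_iff)
lemma W_inv_f [simp]: "w \<in> W \<Longrightarrow> inv w (w x) = x" by (simp add: W_inj)
lemma W_f_inv: "w \<in> W \<Longrightarrow> w (inv w x) = x" by (simp add: W_bij bij_is_surj surj_f_inv_f)
lemma W_inv_eq: "w \<in> W \<Longrightarrow> inv w y = x \<longleftrightarrow> y = w x" using W_f_inv[of w y] by auto

lemma W_disp_periodic: "w \<in> W \<Longrightarrow> periodic (\<lambda>x. w x - x)"
  by (simp add: W_iff periodic_def)

lemma W_dvd_iff:
  assumes "w \<in> W"
  shows "int n dvd w x - w y \<longleftrightarrow> int n dvd x - y"
proof
  assume "int n dvd x - y"
  then obtain m where "x - y = int n * m" by (rule dvdE)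
  then have "x = y + int n * m" by simp
  then show "int n dvd w x - w y" using W_shift[OF assms] by simp
next
  assume "int n dvd w x - w y"
  then obtain m where "w x - w y = int n * m" by (rule dvdE)
  then have "w x = w (y + int n * m)" using W_shift[OF assms] by simp
  then have "x = y + int n * m" by (simp add: W_eq_iff[OF assms])
  then show "int n dvd x - y" by simp
qed

lemma id_W [simp]: "id \<in> W" by (simp add: W_iff)

lemma W_comp:
  assumes "v \<in> W" "w \<in> W"
  shows "v \<circ> w \<in> W"
proof -
  have "(\<Sum>x = 1..int n. v (w x) - w x) = (\<Sum>x = 1..int n. v x - x)"
    using periodic_sum_reindex[OF W_disp_periodic[OF assms(1)] W_inj[OF assms(2)]] assms(2)
    by (simp add: W_iff)
  then have "(\<Sum>x = 1..int n. v (w x) - w x) + (\<Sum>x = 1..int n. w x - x) = 0"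
    using assms by (simp add: W_iff)
  then have "(\<Sum>x = 1..int n. v (w x) - x) = 0" by (simp flip: sum.distrib)
  then show ?thesis using assms by (simp add: W_iff bij_comp)
qed

lemma W_inv:
  assumes "w \<in> W"
  shows "inv w \<in> W"
proof -
  have b: "bij (inv w)" using assms by (simp add: W_bij bij_imp_bij_inv)
  have sh: "inv w (x + int n) = inv w x + int n" for x
    using W_shift[OF assms, of "inv w x" 1] assms by (simp add: W_inv_eq W_f_inv[of w])
  have "(\<Sum>x = 1..int n. w (inv w x) - inv w x) = (\<Sum>x = 1..int n. w x - x)"
    using periodic_sum_reindex[OF W_disp_periodic[OF assms], of "inv w"] b sh by (simp add: bij_is_inj)
  then have "(\<Sum>x = 1..int n. x - inv w x) = 0" using assms by (simp add: W_iff W_f_inv[OF assms])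
  then have "(\<Sum>x = 1..int n. inv w x - x) = 0" by (simp add: sum_subtractf)
  then show ?thesis using b sh by (simp add: W_iff)
qed

lemma t_shift: "t i j (x + int n * m) = t i j x + int n * m"
proof -
  have "int n dvd x + int n * m - y \<longleftrightarrow> int n dvd x - y" for y
    by (metis add_diff_eq dvd_add_right_iff dvd_triv_left add.commute)
  then show ?thesis by (simp add: aff_refl_def)
qed

lemma t_left: "t i j i = j" and t_right: "\<not> int n dvd j - i \<Longrightarrow> t i j j = i"
  by (simp_all add: aff_refl_def)

lemma t_left': "t i j (i + int n * m) = j + int n * m"
  by (simp add: t_shift t_left)

lemma t_right': "\<not> int n dvd j - i \<Longrightarrow> t i j (j + int n * m) = i + int n * m"
  by (simp add: t_shift t_right)

lemma t_other: "\<not> int n dvd x - i \<Longrightarrow> \<not> int n dvd x - j \<Longrightarrow> t i j x = x"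
  by (simp add: aff_refl_def)

lemma t_cases:
  assumes "\<not> int n dvd j - i"
  obtains m where "x = i + int n * m" "t i j x = j + int n * m"
    | m where "x = j + int n * m" "t i j x = i + int n * m"
    | "\<not> int n dvd x - i" "\<not> int n dvd x - j" "t i j x = x"
proof -
  consider "int n dvd x - i" | "int n dvd x - j" | "\<not> int n dvd x - i" "\<not> int n dvd x - j" by blast
  then show thesis
  proof cases
    case 1
    then obtain m where "x - i = int n * m" by (rule dvdE)
    then have "x = i + int n * m" by simp
    then show thesis using that(1) t_left' by blast
  next
    case 2
    then obtain m where "x - j = int n * m" by (rule dvdE)
    then have "x = j + int n * m" by simp
    then show thesis using that(2) t_right'[OF assms] by blast
  next
    case 3
    then show thesis using that(3) t_other by blast
  qed
qed

lemma t_invol: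
  assumes "\<not> int n dvd j - i"
  shows "t i j (t i j x) = x"
  by (rule t_cases[OF assms, of x]) (simp_all add: t_left' t_right' assms)

lemma t_invol_comp: "\<not> int n dvd j - i \<Longrightarrow> t i j \<circ> t i j = id"
  using t_invol by auto

lemma t_W:
  assumes "\<not> int n dvd j - i"
  shows "t i j \<in> W"
proof -
  have b: "bij (t i j)" using t_invol[OF assms] by (metis o_bij comp_def id_apply ext)
  have sh: "t i j (x + int n) = t i j x + int n" for x using t_shift[of i j x 1] by simp
  have "periodic (\<lambda>x. t i j x - x)" using sh by (simp add: periodic_def)
  from periodic_sum_reindex[OF this bij_is_inj[OF b] sh]
  have "(\<Sum>x = 1..int n. t i j x - x) = 0"
    by (simp add: t_invol[OF assms] sum_subtractf)
  then show ?thesis using b sh by (simp add: W_iff)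
qed

lemma inv_t: "\<not> int n dvd j - i \<Longrightarrow> inv (t i j) = t i j"
  using t_invol_comp by (simp add: inv_unique_comp)

lemma t_conj:
  assumes "w \<in> W" "\<not> int n dvd j - i"
  shows "w \<circ> t i j = t (w i) (w j) \<circ> w"
proof
  fix x
  have nd: "\<not> int n dvd w j - w i" using W_dvd_iff[OF assms(1)] assms(2) by simp
  show "(w \<circ> t i j) x = (t (w i) (w j) \<circ> w) x"
    by (rule t_cases[OF assms(2), of x])
      (simp_all add: W_shift[OF assms(1)] t_left' t_right'[OF nd] t_other W_dvd_iff[OF assms(1)])
qed

lemma t_commute: "\<not> int n dvd j - i \<Longrightarrow> t i j = t j i"
proof
  fix x assume a: "\<not> int n dvd j - i"
  then have b: "\<not> int n dvd i - j" by (simp add: dvd_diff_commute)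
  show "t i j x = t j i x"
    by (rule t_cases[OF a, of x]) (simp_all add: t_left' t_right'[OF b] t_other)
qed

lemma t_translate: "t (i + int n * m) (j + int n * m) = t i j"
proof
  fix x
  have "int n dvd x - (y + int n * m) \<longleftrightarrow> int n dvd x - y" for y
    by (metis diff_diff_add dvd_add_left_iff dvd_triv_left diff_add_cancel)
  then show "t (i + int n * m) (j + int n * m) x = t i j x" by (simp add: aff_refl_def)
qed

lemma n_ne_1 [simp]: "n \<noteq> Suc 0" "n \<noteq> 0" using n2 by auto

lemma nd1: "\<not> int n dvd 1" by simp

lemma nd_succ: "\<not> int n dvd (k + 1) - k" "\<not> int n dvd k - (k + 1)"
  by (simp_all)

lemma s_eq_t: "s k = t k (k + 1)" by (simp add: simple_refl_def)
lemma s_W [simp]: "s k \<in> W" unfolding s_eq_t by (rule t_W) simp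
lemma s_invol [simp]: "s k (s k x) = x" unfolding s_eq_t by (rule t_invol) simp
lemma s_s_comp [simp]: "s k \<circ> (s k \<circ> f) = f" by (auto simp: fun_eq_iff)
lemma s_cong: "int n dvd k - l \<Longrightarrow> s k = s l"
proof -
  assume "int n dvd k - l"
  then obtain m where "k - l = int n * m" by (rule dvdE)
  then have "k = l + int n * m" "k + 1 = (l + 1) + int n * m" by simp_all
  then show ?thesis unfolding s_eq_t using t_translate by metis
qed
lemma s_left [simp]: "s k k = k + 1"
  by (simp add: s_eq_t t_left)
lemma s_right [simp]: "s k (k + 1) = k"
  unfolding s_eq_t by (rule t_right) simp
lemma s_W_comp [simp]: "w \<in> W \<Longrightarrow> s k \<circ> w \<in> W" by (rule W_comp) simp_all
lemma inv_s [simp]: "inv (s k) = s k"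
  unfolding s_eq_t by (rule inv_t) simp
lemma inv_s_comp: "w \<in> W \<Longrightarrow> inv (s k \<circ> w) = inv w \<circ> s k"
  using o_inv_distrib[OF W_bij[OF s_W] W_bij, of w k] by simp
lemma s_shift: "s k (x + int n * m) = s k x + int n * m" by (simp add: s_eq_t t_shift)

lemma s_cases:
  obtains m where "x = k + int n * m" "s k x = k + 1 + int n * m"
    | m where "x = k + 1 + int n * m" "s k x = k + int n * m"
    | "\<not> int n dvd x - k" "\<not> int n dvd x - (k + 1)" "s k x = x"
  using that by (rule t_cases[OF nd_succ(1), of x k, folded s_eq_t])

lemma s_bound: "\<bar>s k x - x\<bar> \<le> 1"
  by (rule s_cases[of x k]) auto

lemma s_reverses:
  assumes "x < y" "s k x > s k y"
  obtains m where "x = k + int n * m" "y = k + 1 + int n * m"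
proof -
  have "y = x + 1" using assms s_bound[of k x] s_bound[of k y]
  proof -
    have "y \<noteq> x + 2"
    proof
      assume "y = x + 2"
      then have "s k x = x + 1" "s k y = y - 1" using assms(2) s_bound[of k x] s_bound[of k y] by linarith+
      then show False using assms(2) \<open>y = x + 2\<close> by simp
    qed
    then show ?thesis using assms s_bound[of k x] s_bound[of k y] by linarith
  qed
  show thesis
  proof (rule s_cases[of x k])
    fix m assume "x = k + int n * m" then show thesis using that[of m] \<open>y = x + 1\<close> by simp
  next
    fix m assume "x = k + 1 + int n * m" "s k x = k + int n * m"
    then show thesis using assms(2) \<open>y = x + 1\<close> s_bound[of k y] by linarith
  next
    assume x: "s k x = x"
    then have "s k y < x" using assms by simp
    then show thesis using s_bound[of k y] \<open>y = x + 1\<close> by linarith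
  qed
qed

section \<open>Words in the simple reflections and the length function\<close>

lemma word_perm_Nil [simp]: "word_perm n [] = id"
  and word_perm_Cons [simp]: "word_perm n (k # xs) = s k \<circ> word_perm n xs"
  by (simp_all add: word_perm_def)

lemma word_perm_append: "word_perm n (xs @ ys) = word_perm n xs \<circ> word_perm n ys"
  by (induction xs) (simp_all add: comp_assoc)

lemma word_perm_W [simp]: "word_perm n xs \<in> W"
proof (induction xs)
  case (Cons k xs)
  then show ?case by (simp only: word_perm_Cons s_W_comp)
qed (simp only: word_perm_Nil id_W)

lemma periodic_sum_two:
  fixes f :: "int \<Rightarrow> 'a::comm_monoid_add"
  assumes "periodic f" "\<not> int n dvd k - l"
    and "\<And>x. \<not> int n dvd x - k \<Longrightarrow> \<not> int n dvd x - l \<Longrightarrow> f x = 0"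
  shows "(\<Sum>x = 1..int n. f x) = f k + f l"
proof -
  have ne: "res k \<noteq> res l"
    using assms(2) res_dvd[of k] res_dvd[of l]
    by (metis dvd_diff_commute dvd_diff_right_iff diff_diff_eq2 diff_add_cancel dvd_diff)
  have z: "f x = 0" if "x \<in> {1..int n} - {res k, res l}" for x
  proof (rule assms(3))
    have "int n dvd x - res y" if "int n dvd x - y" for y
      using dvd_add[OF that res_dvd[of y]] by simp
    then show "\<not> int n dvd x - k" "\<not> int n dvd x - l"
      using that dvd_small_eq[OF _ _ res_in, of x] by blast+
  qed
  have "(\<Sum>x = 1..int n. f x) = (\<Sum>x \<in> {res k, res l}. f x)"
    using res_in z by (intro sum.mono_neutral_right) auto
  then show ?thesis using ne periodic_dvd[OF assms(1) res_dvd] by simp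
qed

text \<open>A termination measure for sorting by adjacent exchanges, available before anything is
  known about the length. Removing a descent at k lowers it by \<open>2 * (w k - w (k + 1))\<close>,
  since only the classes of k and k + 1 contribute.\<close>

definition energy :: "perm \<Rightarrow> int" where
  "energy w = (\<Sum>x = 1..int n. (w x - x)\<^sup>2)"

lemma energy_descent:
  assumes w: "w \<in> W" and d: "w k > w (k + 1)"
  shows "energy (w \<circ> s k) < energy w"
proof -
  have sh: "w (x + int n) = w x + int n" "s k (x + int n) = s k x + int n" for x
    using W_shift[OF w, of x 1] s_shift[of k x 1] by simp_all
  have "periodic (\<lambda>x. (w (s k x) - x)\<^sup>2)" by (simp add: periodic_def sh)
  then have "(\<Sum>x = 1..int n. (w (s k (s k x)) - s k x)\<^sup>2) = (\<Sum>x = 1..int n. (w (s k x) - x)\<^sup>2)"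
    by (rule periodic_sum_reindex[where v = "s k" and g = "\<lambda>x. (w (s k x) - x)\<^sup>2", OF _ W_inj[OF s_W] sh(2)])
  then have e: "energy (w \<circ> s k) = (\<Sum>x = 1..int n. (w x - s k x)\<^sup>2)"
    unfolding energy_def comp_def s_invol by (rule sym)
  define f where "f x = (w x - x)\<^sup>2 - (w x - s k x)\<^sup>2" for x
  have "energy w - energy (w \<circ> s k) = (\<Sum>x = 1..int n. f x)"
    unfolding e unfolding energy_def f_def by (rule sum_subtractf[symmetric])
  also have "\<dots> = f k + f (k + 1)"
  proof (rule periodic_sum_two)
    show "periodic f" by (simp add: f_def periodic_def sh)
    show "f x = 0" if "\<not> int n dvd x - k" "\<not> int n dvd x - (k + 1)" for x
      using t_other[OF that] by (simp add: f_def s_eq_t)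
  qed simp
  also have "\<dots> = 2 * (w k - w (k + 1))"
    unfolding f_def s_left s_right by (simp add: power2_eq_square algebra_simps)
  finally show ?thesis using d by simp
qed

text \<open>An increasing bijection of the integers is a translation, and the sum condition leaves
  only the trivial one.\<close>

lemma W_increasing_id:
  assumes w: "w \<in> W" and inc: "\<And>k. w k < w (k + 1)"
  shows "w = id"
proof -
  have "strict_mono w"
  proof (rule strict_monoI)
    fix x y :: int assume "x < y"
    then show "w x < w y"
      by (induction y rule: int_gr_induct) (use inc in \<open>auto intro: less_trans\<close>)
  qed
  then have sm: "w x < w y \<longleftrightarrow> x < y" for x y by (simp add: strict_mono_less)
  have step: "w (x + 1) = w x + 1" for x
  proof (rule ccontr)
    assume ne: "w (x + 1) \<noteq> w x + 1"
    obtain y where y: "w y = w x + 1" using W_f_inv[OF w] by metis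
    have "x < y" using sm[of x y] y by simp
    moreover have "y < x + 1" using sm[of y "x + 1"] y ne inc[of x] by simp
    ultimately show False by simp
  qed
  have lin: "w x = x + w 0" for x
  proof (induction x rule: int_induct[of _ 0])
    case (step2 i)
    then show ?case using step[of "i - 1"] by simp
  qed (simp_all add: step)
  then have "(\<Sum>x = 1..int n. w x - x) = (\<Sum>x = 1..int n. w 0)" by (intro sum.cong) (metis add_diff_cancel_left')+
  then have "int n * w 0 = 0" using w by (simp add: W_iff)
  then have "w 0 = 0" using n2 by simp
  then have "w x = x" for x using lin[of x] by simp
  then show ?thesis by auto
qed

lemma word_exists: "w \<in> W \<Longrightarrow> \<exists>xs. is_word n w xs"
proof (induction "nat (energy w)" arbitrary: w rule: less_induct)
  case less
  show ?case
  proof (cases "\<exists>k. w k > w (k + 1)")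
    case True
    then obtain k where k: "w k > w (k + 1)" by blast
    have "0 \<le> energy (w \<circ> s k)" unfolding energy_def by (intro sum_nonneg) simp
    then obtain xs where xs: "is_word n (w \<circ> s k) xs"
      using less.hyps[OF _ W_comp[OF less.prems s_W]] energy_descent[OF less.prems k] by fastforce
    let ?k = "k mod int n"
    have "s ?k = s k" by (rule s_cong) (simp add: mod_eq_dvd_iff[symmetric])
    then have "word_perm n (xs @ [?k]) = w"
      using xs by (auto simp: word_perm_append is_word_def fun_eq_iff)
    moreover have "?k \<in> {0..<int n}" using n2 by simp
    ultimately have "is_word n w (xs @ [?k])" using xs unfolding is_word_def by auto
    then show ?thesis by blast
  next
    case False
    have "w k < w (k + 1)" for k
      using False W_eq_iff[OF less.prems, of k "k + 1"] by (metis linorder_cases add_cancel_right_right zero_neq_one)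
    then have "w = id" using W_increasing_id[OF less.prems] by blast
    then have "is_word n w []" by (simp add: is_word_def)
    then show ?thesis by blast
  qed
qed

lemma len_le: "is_word n w xs \<Longrightarrow> len w \<le> length xs"
  unfolding aff_len_def by (rule Least_le) blast

lemma reduced_exists: "w \<in> W \<Longrightarrow> \<exists>xs. reduced_word n w xs"
  using LeastI_ex[of "\<lambda>k. \<exists>xs. is_word n w xs \<and> length xs = k"] word_exists
  unfolding reduced_word_def aff_len_def by blast

lemma len_id [simp]: "len id = 0"
  using len_le[of id "[]"] by (simp add: is_word_def)

lemma len_eq_0: "w \<in> W \<Longrightarrow> len w = 0 \<longleftrightarrow> w = id"
  using reduced_exists[of w] by (auto simp: reduced_word_def is_word_def)

lemma word_bound: "\<bar>word_perm n xs x - x\<bar> \<le> int (length xs)"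
proof (induction xs)
  case (Cons k xs)
  then show ?case using s_bound[of k "word_perm n xs x"] by simp
qed simp

text \<open>Each letter moves a point by at most one. This bound is the source of all finiteness
  below: only values of absolute value about \<open>len w\<close> can change sides of the
  origin.\<close>

lemma len_bound: "w \<in> W \<Longrightarrow> \<bar>w x - x\<bar> \<le> int (len w)"
  using reduced_exists[of w] word_bound[of _ x] unfolding reduced_word_def is_word_def by metis

lemma finite_len_le: "finite {w \<in> W. len w \<le> l}"
proof -
  let ?X = "{xs. set xs \<subseteq> {0..<int n} \<and> length xs \<le> l}"
  have "{w \<in> W. len w \<le> l} \<subseteq> word_perm n ` ?X"
    using reduced_exists by (fastforce simp: reduced_word_def is_word_def)
  moreover have "finite ?X" by (rule finite_lists_length_le) simp
  ultimately show ?thesis by (meson finite_surj)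
qed

lemma len_s_le: "w \<in> W \<Longrightarrow> len (s k \<circ> w) \<le> len w + 1"
proof -
  assume "w \<in> W"
  then obtain xs where xs: "reduced_word n w xs" using reduced_exists by blast
  let ?k = "k mod int n"
  have "s ?k = s k" by (rule s_cong) (simp add: mod_eq_dvd_iff[symmetric])
  moreover have "?k \<in> {0..<int n}" using n2 by simp
  ultimately have "is_word n (s k \<circ> w) (?k # xs)" using xs by (simp add: reduced_word_def is_word_def)
  then show ?thesis using len_le xs by (fastforce simp: reduced_word_def)
qed

text \<open>The strong exchange property. Applying the letters from the right, some letter reverses
  the order of the images of i and j; a simple reflection can only reverse neighbours, so this
  letter is the reflection in the two current images, and deleting it amounts to multiplying by
  \<open>t i j\<close> on the right.\<close>

lemma word_delete:
  assumes "i < j" "\<not> int n dvd j - i" "word_perm n xs i > word_perm n xs j"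
  shows "\<exists>ys. length ys < length xs \<and> set ys \<subseteq> set xs \<and> word_perm n ys = word_perm n xs \<circ> t i j"
  using assms(3)
proof (induction xs)
  case Nil
  then show ?case using assms(1) by simp
next
  case (Cons k xs)
  let ?w = "word_perm n xs"
  show ?case
  proof (cases "?w i > ?w j")
    case True
    then obtain ys where ys: "length ys < length xs" "set ys \<subseteq> set xs" "word_perm n ys = ?w \<circ> t i j"
      using Cons.IH by blast
    then have "word_perm n (k # ys) = word_perm n (k # xs) \<circ> t i j" by (simp add: comp_assoc)
    then show ?thesis using ys(1,2) by (intro exI[of _ "k # ys"]) auto
  next
    case False
    moreover have "?w i \<noteq> ?w j" using assms(1) W_eq_iff[OF word_perm_W, of xs i j] by simp
    ultimately have "?w i < ?w j" by simp
    then obtain m where "?w i = k + int n * m" "?w j = k + 1 + int n * m"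
      using Cons.prems s_reverses[of "?w i" "?w j" k] by auto
    then have "s k = t (?w i) (?w j)" unfolding s_eq_t by (simp add: t_translate)
    then have "word_perm n (k # xs) \<circ> t i j = ?w \<circ> t i j \<circ> t i j"
      using t_conj[OF word_perm_W assms(2)] by simp
    also have "\<dots> = ?w" using t_invol_comp[OF assms(2)] by (simp add: comp_assoc)
    finally have "word_perm n (k # xs) \<circ> t i j = ?w" .
    then show ?thesis by (metis length_Cons lessI set_subset_Cons)
  qed
qed

lemma len_t_less:
  assumes "w \<in> W" "i < j" "\<not> int n dvd j - i" "w i > w j"
  shows "len (w \<circ> t i j) < len w"
proof -
  obtain xs where xs: "reduced_word n w xs" using reduced_exists assms(1) by blast
  then obtain ys where "length ys < length xs" "set ys \<subseteq> set xs" "word_perm n ys = w \<circ> t i j"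
    using word_delete[OF assms(2,3), of xs] assms(4) by (auto simp: reduced_word_def is_word_def)
  moreover from this have "is_word n (w \<circ> t i j) ys" using xs by (auto simp: is_word_def reduced_word_def)
  ultimately show ?thesis using len_le xs by (fastforce simp: reduced_word_def)
qed

lemma len_t_less_iff:
  assumes "w \<in> W" "i < j" "\<not> int n dvd j - i"
  shows "len (w \<circ> t i j) < len w \<longleftrightarrow> w i > w j"
proof
  assume l: "len (w \<circ> t i j) < len w"
  show "w i > w j"
  proof (rule ccontr)
    assume "\<not> w i > w j"
    then have "(w \<circ> t i j) i > (w \<circ> t i j) j"
      using W_eq_iff[OF assms(1), of i j] assms(2,3) by (simp add: t_left t_right)
    then have "len (w \<circ> t i j \<circ> t i j) < len (w \<circ> t i j)"
      using len_t_less[OF W_comp[OF assms(1) t_W[OF assms(3)]] assms(2,3)] by simp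
    then show False using l t_invol_comp[OF assms(3)] by (simp add: comp_assoc)
  qed
qed (rule len_t_less[OF assms])

text \<open>A left ascent. Multiplication by s_k on the left exchanges values, so the condition
  compares the positions of k and k + 1; \<open>up_iff_len\<close> is the description by
  length.\<close>

definition up :: "int \<Rightarrow> perm \<Rightarrow> bool" where
  "up k w \<longleftrightarrow> inv w k < inv w (k + 1)"

lemma s_comp_eq_t:
  assumes "w \<in> W"
  shows "s k \<circ> w = w \<circ> t (inv w k) (inv w (k + 1))"
    and "\<not> int n dvd inv w (k + 1) - inv w k"
proof -
  show nd: "\<not> int n dvd inv w (k + 1) - inv w k"
    using W_dvd_iff[OF W_inv[OF assms], of "k + 1" k] nd1 by simp
  show "s k \<circ> w = w \<circ> t (inv w k) (inv w (k + 1))"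
    using t_conj[OF assms nd] assms by (simp add: s_eq_t W_f_inv[OF assms])
qed

text \<open>Left multiplication by s_k is right multiplication by the reflection in the positions of
  k and k + 1. Hence the length cannot stay the same, and one extra letter raises it by at most
  one.\<close>

lemma up_len: 
  assumes "w \<in> W" "up k w"
  shows "len (s k \<circ> w) = len w + 1"
proof -
  note st = s_comp_eq_t[OF assms(1), of k]
  have "\<not> len (s k \<circ> w) < len w"
    using len_t_less_iff[OF assms(1) _ st(2)] assms st(1) by (simp add: up_def W_f_inv)
  moreover have "len (s k \<circ> w) \<noteq> len w"
  proof
    assume e: "len (s k \<circ> w) = len w"
    have "(s k \<circ> w) (inv w k) > (s k \<circ> w) (inv w (k + 1))"
      unfolding comp_apply W_f_inv[OF assms(1)] s_left s_right by simp
    then have "len (s k \<circ> w \<circ> t (inv w k) (inv w (k + 1))) < len (s k \<circ> w)"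
      using len_t_less[OF s_W_comp[OF assms(1)] _ st(2)] assms(2) by (simp add: up_def)
    then show False using e st t_invol_comp[OF st(2)] by (simp add: comp_assoc)
  qed
  ultimately show ?thesis using len_s_le[OF assms(1), of k] by simp
qed

lemma up_s: "w \<in> W \<Longrightarrow> up k (s k \<circ> w) \<longleftrightarrow> \<not> up k w"
  using W_eq_iff[OF W_inv, of w k "k + 1"] by (auto simp: up_def inv_s_comp)

lemma down_len:
  assumes "w \<in> W" "\<not> up k w"
  shows "len w = len (s k \<circ> w) + 1"
  using up_len[of "s k \<circ> w" k] assms by (simp add: up_s)

lemma up_iff_len: "w \<in> W \<Longrightarrow> up k w \<longleftrightarrow> len w < len (s k \<circ> w)"
  using up_len[of w k] down_len[of w k] by force

lemma up_cong: "w \<in> W \<Longrightarrow> int n dvd k - l \<Longrightarrow> up k w \<longleftrightarrow> up l w"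
  using s_cong by (simp add: up_iff_len)

lemma descent_exists:
  assumes "w \<in> W" "w \<noteq> id"
  obtains k where "\<not> up k w"
proof -
  obtain xs where xs: "reduced_word n w xs" using reduced_exists assms(1) by blast
  then obtain k ys where "xs = k # ys" using assms(2)
    by (cases xs) (auto simp: reduced_word_def is_word_def)
  then have "w = s k \<circ> word_perm n ys" "set ys \<subseteq> {0..<int n}" "length ys < len w"
    using xs by (auto simp: reduced_word_def is_word_def)
  then have "is_word n (s k \<circ> w) ys" "length ys < len w" by (simp_all add: is_word_def)
  then have "len (s k \<circ> w) < len w" using len_le by fastforce
  then show thesis using that up_iff_len[OF assms(1)] by (metis order.asym)
qed

section \<open>Marked strong covers\<close>

text \<open>A set of targets records everything: the positions exchanged are recovered as
  \<open>j = inv v a\<close> and \<open>i = inv y a\<close>. The marking is the smaller of the two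
  exchanged values; it moves from a positive to a nonpositive position.\<close>

definition marked_covers :: "int \<Rightarrow> perm \<Rightarrow> perm set" where
  "marked_covers a v = {y. marked_cover n v a y}"

lemma marked_coversE:
  assumes "y \<in> marked_covers a v"
  obtains i j where "i \<le> 0" "0 < j" "\<not> int n dvd j - i" "y = v \<circ> t i j" "v j = a" "a < v i"
    "len v = len y + 1" "v \<in> W" "y \<in> W"
proof -
  obtain i j where c: "bruhat_cover n y v" and ij: "i \<le> 0" "0 < j" "\<not> int n dvd j - i"
    and v: "v = y \<circ> t i j" and a: "a = v j" "a = y i"
    using assms by (auto simp: marked_covers_def marked_cover_def)
  have y: "y \<in> W"
    using c by (auto simp: bruhat_cover_def bruhat_less_def bruhat_step_def dest: tranclpD)
  have vW: "v \<in> W" using v W_comp[OF y t_W[OF ij(3)]] by simp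
  have y_eq: "y = v \<circ> t i j" using v t_invol_comp[OF ij(3)] by (simp add: comp_assoc)
  have len: "len v = len y + 1" using c by (simp add: bruhat_cover_def)
  then have "v i > v j" using len_t_less_iff[OF vW _ ij(3)] ij(1,2) y_eq by auto
  then have "a < v i" using a(1) by simp
  then show thesis by (rule that[OF ij y_eq a(1)[symmetric] _ len vW y])
qed

lemma marked_coversI:
  assumes "v \<in> W" "i \<le> 0" "0 < j" "\<not> int n dvd j - i" "len v = len (v \<circ> t i j) + 1"
  shows "v \<circ> t i j \<in> marked_covers (v j) v"
proof -
  let ?y = "v \<circ> t i j"
  have y: "?y \<in> W" using W_comp[OF assms(1) t_W[OF assms(4)]] .
  have v: "v = ?y \<circ> t i j" using t_invol_comp[OF assms(4)] by (simp add: comp_assoc)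
  have lt: "i < j" using assms(2,3) by simp
  have "bruhat_step n ?y v"
    unfolding bruhat_step_def using assms y v lt by (metis less_add_one)
  then have "bruhat_cover n ?y v" using assms(5) by (auto simp: bruhat_cover_def bruhat_less_def)
  then show ?thesis unfolding marked_covers_def marked_cover_def mem_Collect_eq
    using assms v by (metis comp_apply t_left)
qed

section \<open>Reflections that cannot give covers\<close>

lemma inv_comp_t:
  assumes "v \<in> W" "\<not> int n dvd j - i"
  shows "inv (v \<circ> t i j) x = t i j (inv v x)"
  using o_inv_distrib[OF W_bij[OF assms(1)] W_bij[OF t_W[OF assms(2)]]] inv_t[OF assms(2)] by simp

text \<open>With such a k the reflection factors as
  \<open>t i k \<circ> t k j \<circ> t i k\<close>, and each of the three factors lowers the length,
  so the total drop is at least 3.\<close>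

lemma no_value_between:
  assumes v: "v \<in> W" and ij: "i < j" "\<not> int n dvd j - i" and len: "len v = len (v \<circ> t i j) + 1"
    and k: "i < k" "k < j" and val: "v j < v k" "v k < v i"
  shows False
proof -
  have ki: "\<not> int n dvd k - i"
  proof
    assume "int n dvd k - i"
    then obtain m where m: "k - i = int n * m" by (rule dvdE)
    then have "k = i + int n * m" by simp
    then have "v k = v i + int n * m" using W_shift[OF v, of i m] by simp
    then show False using val k m by linarith
  qed
  have jk: "\<not> int n dvd j - k"
  proof
    assume "int n dvd j - k"
    then obtain m where m: "j - k = int n * m" by (rule dvdE)
    then have "j = k + int n * m" by simp
    then have "v j = v k + int n * m" using W_shift[OF v, of k m] by simp
    then show False using val k m by linarith
  qed
  have jki: "t i k j = j" using jk ij(2) by (simp add: t_other)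
  have "\<not> int n dvd i - k" "\<not> int n dvd i - j" using ki ij(2) by (simp_all add: dvd_diff_commute)
  then have kji: "t k j i = i" by (simp add: t_other)
  define v1 v2 where "v1 = v \<circ> t i k" and "v2 = v1 \<circ> t k j"
  have W: "v1 \<in> W" "v2 \<in> W" unfolding v1_def v2_def by (intro W_comp v t_W ki jk)+
  have "len v1 < len v" unfolding v1_def using len_t_less[OF v k(1) ki val(2)] .
  moreover have "len v2 < len v1" unfolding v2_def
    by (rule len_t_less[OF W(1) k(2) jk]) (use val in \<open>simp add: v1_def t_right[OF ki] jki\<close>)
  moreover have "len (v2 \<circ> t i k) < len v2"
    by (rule len_t_less[OF W(2) k(1) ki])
      (use val in \<open>simp add: v1_def v2_def kji t_left t_right[OF ki] jki\<close>)
  moreover have "v2 \<circ> t i k = v \<circ> t i j"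
  proof -
    have "t i k \<circ> t k j = t i j \<circ> t i k"
      using t_conj[OF t_W[OF ki] jk] by (simp add: t_right[OF ki] jki)
    then have "v2 = v \<circ> t i j \<circ> t i k" unfolding v1_def v2_def by (simp add: comp_assoc)
    then show ?thesis using t_invol_comp[OF ki] by (simp add: comp_assoc)
  qed
  ultimately show False using len by simp
qed

text \<open>The role of an intermediate point is played by translates of the ends themselves: with
  \<open>q = j - int n * k\<close> and \<open>r = i + int n * k\<close> the reflection factors as
  \<open>t i q \<circ> t q r \<circ> t i q\<close>, and every factor lowers the length.\<close>

lemma chain_positions:
  assumes v: "v \<in> W" and ij: "\<not> int n dvd j - i" and k: "i < j - int n * k"
    "j - int n * k < i + int n * k" "v i - v j > int n * k" "0 \<le> int n * k"
  shows "len (v \<circ> t i j) + 3 \<le> len v"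
proof -
  define q r where "q = j - int n * k" and "r = i + int n * k"
  have qi: "\<not> int n dvd q - i"
    using ij unfolding q_def by (metis diff_diff_eq2 diff_add_eq dvd_add_times_triv_right_iff
      add_diff_cancel_right' diff_right_commute dvd_diff dvd_triv_left diff_add_cancel dvd_add)
  have rq: "\<not> int n dvd r - q"
  proof
    assume "int n dvd r - q"
    then have "int n dvd (r - q) - int n * (2 * k)" by (simp add: dvd_diff)
    moreover have "(r - q) - int n * (2 * k) = i - j" by (simp add: q_def r_def)
    ultimately show False using ij by (simp add: dvd_diff_commute)
  qed
  have vq: "v q = v j - int n * k" using W_shift[OF v, of j "- k"] by (simp add: q_def)
  have tr: "t i q r = j" using t_left'[of i q k] by (simp add: r_def q_def)
  have ti: "t q r i = j - int n * (2 * k)"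
    using t_right'[OF rq, of "- k"] by (simp add: r_def q_def algebra_simps)
  have vjj: "v (t i q (j - int n * (2 * k))) = v i - int n * k"
  proof -
    have e: "j - int n * (2 * k) = q + int n * (- k)" by (simp add: q_def)
    show ?thesis unfolding e t_right'[OF qi] W_shift[OF v] by simp
  qed
  define v1 v2 where "v1 = v \<circ> t i q" and "v2 = v1 \<circ> t q r"
  have W: "v1 \<in> W" "v2 \<in> W" unfolding v1_def v2_def by (intro W_comp v t_W qi rq)+
  have "len v1 < len v" unfolding v1_def
    by (rule len_t_less[OF v _ qi]) (use k vq in \<open>simp_all add: q_def\<close>)
  moreover have "len v2 < len v1" unfolding v2_def
    by (rule len_t_less[OF W(1) _ rq]) (use k in \<open>simp_all add: v1_def t_right[OF qi] tr\<close>,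
       simp add: q_def r_def)
  moreover have "len (v2 \<circ> t i q) < len v2"
    by (rule len_t_less[OF W(2) _ qi])
      (use k in \<open>simp_all add: v1_def v2_def ti vjj t_left tr\<close>, simp add: q_def)
  moreover have "v2 \<circ> t i q = v \<circ> t i j"
  proof -
    have "t i q \<circ> t q r = t i j \<circ> t i q"
      using t_conj[OF t_W[OF qi] rq] by (simp add: t_right[OF qi] tr)
    then have "v2 = v \<circ> t i j \<circ> t i q" unfolding v1_def v2_def by (simp add: comp_assoc)
    then show ?thesis using t_invol_comp[OF qi] by (simp add: comp_assoc)
  qed
  ultimately show ?thesis by simp
qed

text \<open>The counterpart of \<open>chain_positions\<close> for a value gap between one and two
  times \<open>int n * k\<close>. Here the factorization is
  \<open>t p j \<circ> t i j \<circ> t i q\<close>, with \<open>p\<close> and \<open>q\<close> the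
  translates of \<open>i\<close> and \<open>j\<close> by \<open>- int n * k\<close>.\<close>

lemma chain_values:
  assumes v: "v \<in> W" and ij: "\<not> int n dvd j - i" and k: "i < j - int n * k"
    "int n * k < v i - v j" "v i - v j < 2 * (int n * k)" "0 \<le> int n * k"
  shows "len (v \<circ> t i j) + 3 \<le> len v"
proof -
  define p q where "p = i - int n * k" and "q = j - int n * k"
  have qi: "\<not> int n dvd q - i"
  proof
    assume "int n dvd q - i"
    then have "int n dvd (q - i) + int n * k" by simp
    then show False using ij by (simp add: q_def)
  qed
  have jp: "\<not> int n dvd j - p"
  proof
    assume "int n dvd j - p"
    then have "int n dvd (j - p) - int n * k" by (simp add: dvd_diff)
    then show False using ij by (simp add: p_def)
  qed
  have vp: "v p = v i - int n * k" using W_shift[OF v, of i "- k"] by (simp add: p_def)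
  have ti: "t p j i = j + int n * k" using t_left'[of p j k] by (simp add: p_def)
  have tq: "t i j q = p" using t_right'[OF ij, of "- k"] by (simp add: p_def q_def)
  have vj: "v (j + int n * k) = v j + int n * k" using W_shift[OF v] .
  have tp: "t p j p = j" by (rule t_left)
  define v1 v2 where "v1 = v \<circ> t p j" and "v2 = v1 \<circ> t i j"
  have W: "v1 \<in> W" "v2 \<in> W" unfolding v1_def v2_def by (intro W_comp v t_W ij jp)+
  have "len v1 < len v" unfolding v1_def
    by (rule len_t_less[OF v _ jp]) (use k vp in \<open>simp_all add: p_def\<close>)
  moreover have "len v2 < len v1" unfolding v2_def
  proof (rule len_t_less[OF W(1) _ ij])
    have "v1 i = v j + int n * k" "v1 j = v i - int n * k"
      by (simp_all add: v1_def t_right[OF jp] ti vj vp)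
    then show "v1 j < v1 i" using k by linarith
    show "i < j" using k by linarith
  qed
  moreover have "len (v2 \<circ> t i q) < len v2"
    by (rule len_t_less[OF W(2) _ qi])
      (use k in \<open>simp_all add: v1_def v2_def t_left tq tp t_right[OF jp] vp\<close>, simp add: q_def)
  moreover have "v2 \<circ> t i q = v \<circ> t i j"
  proof -
    have "t i j \<circ> t i q = t j p \<circ> t i j"
      using t_conj[OF t_W[OF ij] qi] by (simp add: t_left tq)
    then have "v2 \<circ> t i q = v \<circ> (t p j \<circ> t p j) \<circ> t i j"
      unfolding v1_def v2_def by (simp add: comp_assoc t_commute[OF jp])
    then show ?thesis using t_invol_comp[OF jp] by simp
  qed
  ultimately show ?thesis by simp
qed

text \<open>A cover exchanges positions or values less than n apart. Otherwise divide both gaps by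
  n: the smaller quotient gives a translation that fits into both gaps and is more than half of the
  gap it comes from, which is what the two factorizations require.\<close>

lemma cover_small:
  assumes v: "v \<in> W" and ij: "\<not> int n dvd j - i" and len: "len v = len (v \<circ> t i j) + 1"
    and big: "j - i > int n" "v i - v j > int n"
  shows False
proof -
  have np: "int n > 0" using n2 by simp
  have quot: "int n * (d div int n) < d" "d < int n * (d div int n) + int n" "1 \<le> d div int n"
    if "d > int n" "\<not> int n dvd d" for d
  proof -
    have e: "int n * (d div int n) + d mod int n = d" by simp
    have "0 \<le> d mod int n" "d mod int n < int n" "d mod int n \<noteq> 0"
      using that np by (simp_all add: dvd_eq_mod_eq_0)
    then show "int n * (d div int n) < d" "d < int n * (d div int n) + int n" using e by linarith+
    show "1 \<le> d div int n" using that(1) np by (simp add: pos_imp_zdiv_pos_iff zdiv_mono1 int_one_le_iff_zero_less)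
  qed
  have vd: "\<not> int n dvd v i - v j" using ij W_dvd_iff[OF v] by (simp add: dvd_diff_commute)
  define k l where "k = (j - i) div int n" and "l = (v i - v j) div int n"
  note K = quot[OF big(1) ij, folded k_def] and L = quot[OF big(2) vd, folded l_def]
  have nk: "int n \<le> int n * k" and nl: "int n \<le> int n * l" using K(3) L(3) np by simp_all
  show False
  proof (cases "l \<le> k")
    case True
    then have "int n * l \<le> int n * k" by (simp add: mult_left_mono)
    then have "len (v \<circ> t i j) + 3 \<le> len v"
      using chain_values[OF v ij, of l] K L nl by linarith
    then show False using len by simp
  next
    case False
    then have "int n * (k + 1) \<le> int n * l" by (intro mult_left_mono) simp_all
    then have "int n * k < v i - v j" using L by (simp add: algebra_simps)
    then have "len (v \<circ> t i j) + 3 \<le> len v"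
      using chain_positions[OF v ij, of k] K nk by linarith
    then show False using len by simp
  qed
qed

text \<open>The diamond property of the Bruhat order, with markings carried along by s_k. If the
  exchanged values are in increasing order in v, then s_k reversed them and the cover leads back to
  v. Otherwise the same reflection lowers v to some y, and comparing lengths forces k to be an
  ascent of y.\<close>

lemma marked_covers_s:
  assumes v: "v \<in> W" and up: "up k v"
  shows "marked_covers c (s k \<circ> v) =
    (if int n dvd c - k \<and> inv v c \<le> 0 \<and> 0 < inv v (c + 1) then {v} else {}) \<union>
    (\<lambda>y. s k \<circ> y) ` {y \<in> marked_covers (s k c) v. up k y}" (is "?L = ?A \<union> ?B")
proof (intro subset_antisym subsetI)
  fix x assume "x \<in> ?L"
  then obtain i j where ij: "i \<le> 0" "0 < j" "\<not> int n dvd j - i" "x = s k \<circ> v \<circ> t i j"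
    "s k (v j) = c" "c < s k (v i)" "len (s k \<circ> v) = len x + 1" "x \<in> W"
    by (elim marked_coversE) simp
  define y where "y = v \<circ> t i j"
  have x: "x = s k \<circ> y" using ij(4) by (simp add: y_def comp_assoc)
  have yW: "y \<in> W" unfolding y_def by (intro W_comp v t_W ij(3))
  have lx: "len x = len v" using ij(7) up_len[OF v up] by simp
  show "x \<in> ?A \<union> ?B"
  proof (cases "v i < v j")
    case True
    then obtain m where m: "v i = k + int n * m" "v j = k + 1 + int n * m"
      using s_reverses[of "v i" "v j" k] ij(5,6) by auto
    have c: "c = k + int n * m" using ij(5) m(2) s_shift[of k "k + 1" m] by simp
    have "inv v c = i" "inv v (c + 1) = j" using m c v by (simp_all add: W_inv_eq add.commute add.left_commute)
    moreover have "x = v"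
    proof -
      have "t (v i) (v j) = s k" unfolding m s_eq_t by (rule t_translate)
      then have "y = s k \<circ> v" unfolding y_def using t_conj[OF v ij(3)] by simp
      then show ?thesis using x by simp
    qed
    ultimately show ?thesis using c ij by simp
  next
    case False
    then have gt: "v i > v j" using ij(1,2) W_eq_iff[OF v, of i j] by simp
    then have ly: "len y < len v" unfolding y_def using len_t_less[OF v _ ij(3)] ij(1,2) by simp
    have upy: "up k y" using up_iff_len[OF yW] x lx ly by simp
    have "len v = len y + 1" using up_len[OF yW upy] x lx by simp
    then have "y \<in> marked_covers (v j) v" unfolding y_def using marked_coversI[OF v ij(1-3)] by simp
    moreover have "v j = s k c" using ij(5) by auto
    ultimately show ?thesis using upy x by auto
  qed
next
  fix x assume "x \<in> ?A \<union> ?B"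
  then consider "x = v" "int n dvd c - k" "inv v c \<le> 0" "0 < inv v (c + 1)"
    | y where "x = s k \<circ> y" "y \<in> marked_covers (s k c) v" "up k y"
    by (auto split: if_splits)
  then show "x \<in> ?L"
  proof cases
    case 1
    let ?p = "inv v c" and ?q = "inv v (c + 1)"
    have sc: "s k = s c" using s_cong[OF 1(2)] by simp
    note st = s_comp_eq_t[OF v, of c]
    have vx: "s c \<circ> v \<circ> t ?p ?q = v" using st t_invol_comp[OF st(2)] by (simp add: comp_assoc)
    have "len (s c \<circ> v) = len v + 1" using up_len[OF v up] sc by simp
    then have "s c \<circ> v \<circ> t ?p ?q \<in> marked_covers ((s c \<circ> v) ?q) (s c \<circ> v)"
      using marked_coversI[OF s_W_comp[OF v] 1(3,4) st(2), of c] vx by simp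
    moreover have "(s c \<circ> v) ?q = c" by (simp add: W_f_inv[OF v])
    ultimately show ?thesis using 1(1) sc vx by simp
  next
    case (2 y)
    then obtain i j where ij: "i \<le> 0" "0 < j" "\<not> int n dvd j - i" "y = v \<circ> t i j"
      "v j = s k c" "s k c < v i" "len v = len y + 1" "y \<in> W"
      by (elim marked_coversE) simp
    have x: "x = s k \<circ> v \<circ> t i j" using 2 ij(4) by (simp add: comp_assoc)
    have "len (s k \<circ> v) = len (s k \<circ> v \<circ> t i j) + 1"
      using up_len[OF v up] up_len[OF ij(8) 2(3)] ij(7) x 2(1) by simp
    then have "x \<in> marked_covers ((s k \<circ> v) j) (s k \<circ> v)"
      using marked_coversI[OF s_W_comp[OF v] ij(1-3)] x by simp
    then show ?thesis using ij(5) by simp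
  qed
qed

lemma marked_covers_W: "y \<in> marked_covers a v \<Longrightarrow> y \<in> W"
  and marked_covers_len: "y \<in> marked_covers a v \<Longrightarrow> len v = len y + 1"
  by (metis marked_coversE)+

lemma marked_covers_pos: "y \<in> marked_covers a v \<Longrightarrow> 0 < inv v a"
  and marked_covers_nonpos: "y \<in> marked_covers a v \<Longrightarrow> inv y a \<le> 0"
proof -
  assume "y \<in> marked_covers a v"
  then obtain i j where ij: "i \<le> 0" "0 < j" "\<not> int n dvd j - i" "y = v \<circ> t i j" "v j = a" "v \<in> W"
    by (elim marked_coversE)
  have j: "inv v a = j" using ij(5,6) by (simp add: W_inv_eq)
  then show "0 < inv v a" using ij(2) by simp
  show "inv y a \<le> 0" unfolding ij(4) inv_comp_t[OF ij(6,3)] j using ij(1) by (simp add: t_right[OF ij(3)])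
qed

lemma marked_covers_empty: "inv v a \<le> 0 \<Longrightarrow> marked_covers a v = {}"
  using marked_covers_pos by fastforce

lemma finite_marked_covers [simp]: "finite (marked_covers a v)"
proof (rule finite_subset)
  show "marked_covers a v \<subseteq> (\<lambda>i. v \<circ> t i (inv v a)) ` {a - int (len v)..0}"
  proof
    fix y assume "y \<in> marked_covers a v"
    then obtain i j where ij: "i \<le> 0" "y = v \<circ> t i j" "v j = a" "a < v i" "v \<in> W"
      by (elim marked_coversE)
    then have "a - int (len v) \<le> i" using len_bound[OF ij(5), of i] by linarith
    moreover have "inv v a = j" using ij by (simp add: W_inv_eq)
    ultimately show "y \<in> (\<lambda>i. v \<circ> t i (inv v a)) ` {a - int (len v)..0}" using ij by auto
  qed
qed simp

text \<open>A value at a positive position, other than a translate of the marking, either stays or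
  is a translate of the larger exchanged value and moves to the right by
  \<open>j - i\<close>.\<close>

lemma marked_covers_keep_pos:
  assumes "y \<in> marked_covers b v" "0 < inv v x" "\<not> int n dvd x - b"
  shows "inv v x \<le> inv y x"
proof -
  obtain i j where ij: "i \<le> 0" "0 < j" "\<not> int n dvd j - i" "y = v \<circ> t i j" "v j = b" "v \<in> W"
    using assms(1) by (elim marked_coversE)
  have "inv v b = j" using ij by (simp add: W_inv_eq)
  then have nd: "\<not> int n dvd inv v x - j" using W_dvd_iff[OF W_inv[OF ij(6)], of x b] assms(3) by simp
  have "inv y x = t i j (inv v x)" using ij inv_comp_t by simp
  then show ?thesis using nd ij(1,2) by (auto simp: aff_refl_def)
qed

text \<open>The markings come in the order opposite to that of a strip. An ascent would put the
  position k of a + 1 strictly between the positions i and p exchanged by the first cover, with a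
  value between those exchanged, against \<open>no_value_between\<close>. If k is congruent to i or
  p, both gaps of the first cover exceed n, against \<open>cover_small\<close>.\<close>

lemma two_covers_not_up:
  assumes v: "0 < inv v a" "inv v a < inv v (a + 1)"
    and y: "y \<in> marked_covers a v" and y2: "y2 \<in> marked_covers (a + 1) y"
  shows "\<not> up a y2"
proof
  assume up: "up a y2"
  let ?b = "a + 1"
  obtain i p where ip: "i \<le> 0" "0 < p" "\<not> int n dvd p - i" "y = v \<circ> t i p" "v p = a" "a < v i"
    "len v = len y + 1" "v \<in> W" "y \<in> W"
    using y by (elim marked_coversE)
  obtain k q where kq: "k \<le> 0" "0 < q" "\<not> int n dvd q - k" "y2 = y \<circ> t k q" "y q = ?b" "?b < y k"
    "len y = len y2 + 1" "y2 \<in> W"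
    using y2 by (elim marked_coversE)
  have p: "inv v a = p" using ip by (simp add: W_inv_eq)
  have q: "inv y ?b = q" using kq ip by (simp add: W_inv_eq)
  have "inv v ?b \<le> inv y ?b" using marked_covers_keep_pos[OF y] v by simp
  then have pq: "p < q" using p q v by simp
  have yi: "y i = a" using ip by (simp add: t_left)
  have yp: "y p = v i" using ip by (simp add: t_right)
  have c1: "v i > ?b"
  proof -
    have "y p \<noteq> y q" using pq W_eq_iff[OF ip(9)] by simp
    then show ?thesis using yp kq(5) ip(6) by simp
  qed
  \<comment> \<open>Otherwise position p lies between k and q with a value between those exchanged
    by the second cover.\<close>
  have nb: "v i \<ge> y k"
    using no_value_between[OF ip(9) _ kq(3), of p] kq(1,2,4-7) pq ip(2) c1 yp by force
  moreover have "v i \<noteq> y k" using W_eq_iff[OF ip(9), of p k] yp kq(1) ip(2) by auto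
  ultimately have gt: "v i > y k" by simp
  have iq: "\<not> int n dvd i - q" using W_dvd_iff[OF ip(9), of i q] yi kq(5) by simp
  have inv_b: "inv y2 ?b = k" using inv_comp_t[OF ip(9) kq(3)] kq(4) q by (simp add: t_right[OF kq(3)])
  have inv_a: "inv y2 a = t k q i"
    using inv_comp_t[OF ip(9) kq(3), of a] kq(4) W_inv_eq[OF ip(9), of a i] yi by simp
  have big: False if "p - i > int n" "v i - a > int n"
    using cover_small[OF ip(8,3), folded ip(4), OF ip(7)] that ip(5) by simp
  show False
  proof (cases "int n dvd i - k")
    case True
    then obtain m where m: "i - k = int n * m" by (rule dvdE)
    then have ik: "i = k + int n * m" by simp
    then have "y k = a - int n * m" using W_shift[OF ip(9), of k m] yi by simp
    then have "int n * m < 0" using kq(6) by linarith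
    then have "m < 0" by (simp add: mult_less_0_iff)
    then have "int n * m \<le> - int n" using mult_left_mono[of m "-1" "int n"] by simp
    then show False using big m gt \<open>y k = a - int n * m\<close> kq(1) ip(2) by linarith
  next
    case False
    then have "t k q i = i" using iq by (simp add: t_other)
    then have lt: "i < k" using up inv_a inv_b by (simp add: up_def)
    have kp: "k < p" using kq(1) ip(2) by simp
    show False
    proof (cases "int n dvd k - p")
      case True
      then obtain m where m: "k - p = int n * m" by (rule dvdE)
      then have "k = p + int n * m" by simp
      then have yk: "y k = v i + int n * m" using W_shift[OF ip(9), of p m] yp by simp
      have "int n * m < 0" using m kp by simp
      then have "m < 0" by (simp add: mult_less_0_iff)
      then have "int n * m \<le> - int n" using mult_left_mono[of m "-1" "int n"] by simp
      then show False using big m lt yk kq(6) by linarith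
    next
      case nkp: False
      have "\<not> int n dvd k - i" using False by (simp add: dvd_diff_commute)
      then have "y k = v k" using ip(4) nkp by (simp add: t_other)
      then show False
        using no_value_between[OF ip(8) _ ip(3) _ lt kp] ip(1,2,4,5,7) kq(6) gt by simp
    qed
  qed
qed

text \<open>Passing to the cover moves the translates of \<open>a\<close> and of the larger value \<open>c\<close> exchanged with it
  across the origin. Below \<open>a\<close> these moves cancel.\<close>

lemma marked_covers_card:
  assumes y: "y \<in> marked_covers a w" and lo: "\<And>c. c \<le> lo \<Longrightarrow> inv w c \<le> 0"
  shows "card {c \<in> {lo<..<a}. inv y c \<le> 0} = card {c \<in> {lo<..<a}. inv w c \<le> 0}"
proof -
  obtain i j where ij: "i \<le> 0" "0 < j" "\<not> int n dvd j - i" "y = w \<circ> t i j" "w j = a" "a < w i"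
    "len w = len y + 1" "w \<in> W" "y \<in> W"
    using y by (elim marked_coversE)
  define c where "c = w i"
  have nd: "\<not> int n dvd c - a" using W_dvd_iff[OF ij(8), of i j] ij(3,5) by (simp add: c_def dvd_diff_commute)
  define u where "u = t a c"
  have u_invol: "u (u x) = x" for x unfolding u_def using t_invol[OF nd] .
  have inv_y: "inv y x = inv w (u x)" for x
  proof -
    have "u = t (w i) (w j)" unfolding u_def t_commute[OF nd] by (simp add: c_def ij(5))
    then have "y = u \<circ> w" unfolding ij(4) using t_conj[OF ij(8,3)] by simp
    then have "y (inv w (u x)) = x" using u_invol by (simp add: W_f_inv[OF ij(8)])
    then show ?thesis by (metis W_inv_f ij(9))
  qed
  have inv_a: "inv w (a + int n * m) = j + int n * m" for m
    using W_shift[OF ij(8), of j m] ij by (simp add: W_inv_eq)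
  have inv_c: "inv w (c + int n * m) = i + int n * m" for m
    using W_shift[OF ij(8), of i m] ij by (simp add: W_inv_eq c_def)
  have ca: "a < c" using ij(6) by (simp add: c_def)
  let ?B = "{x \<in> {lo<..<a}. inv w x \<le> 0}" and ?B' = "{x \<in> {lo<..<a}. inv y x \<le> 0}"
  have 1: "u x \<in> ?B - ?B'" if "x \<in> ?B' - ?B" for x
  proof -
    have x: "lo < x" "x < a" "inv w (u x) \<le> 0" "0 < inv w x" using that inv_y by auto
    show ?thesis
    proof (rule t_cases[OF nd, of x, folded u_def])
      fix m assume m: "x = a + int n * m" "u x = c + int n * m"
      have "int n * m < 0" using x m by simp
      then have "m < 0" by (simp add: mult_less_0_iff)
      then have le: "int n * m \<le> - int n" using mult_left_mono[of m "-1" "int n"] by simp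
      have "0 < j + int n * m" using x m inv_a by simp
      \<comment> \<open>The translate of a lies below a but still at a positive position, so the
        position gap exceeds n. Then the value gap is below n by \<open>cover_small\<close>, and the
        partner of x stays below a as well.\<close>
      then have "j - i > int n" using le ij(1) by linarith
      then have "\<not> c - a > int n" using cover_small[OF ij(8,3), folded ij(4), OF ij(7)] ij(5) c_def by auto
      moreover have "c - a \<noteq> int n" using nd by auto
      ultimately have "u x < a" using m le by linarith
      moreover have "lo < u x" using m ca x by linarith
      ultimately show ?thesis using x u_invol inv_y by auto
    next
      fix m assume m: "x = c + int n * m"
      then have "int n * m < 0" using x ca by linarith
      then have "inv w x \<le> 0" using m inv_c ij(1) by simp
      then show ?thesis using x by simp
    next
      assume "u x = x" then show ?thesis using x by simp
    qed
  qed
  have 2: "u x \<in> ?B' - ?B" if "x \<in> ?B - ?B'" for x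
  proof -
    have x: "lo < x" "x < a" "0 < inv w (u x)" "inv w x \<le> 0" using that inv_y by auto
    show ?thesis
    proof (rule t_cases[OF nd, of x, folded u_def])
      fix m assume m: "x = a + int n * m" "u x = c + int n * m"
      have "int n * m < 0" using x m by simp
      then have "inv w (u x) \<le> 0" using m inv_c ij(1) by simp
      then show ?thesis using x by simp
    next
      fix m assume m: "x = c + int n * m" "u x = a + int n * m"
      then have "u x < a" using x ca by linarith
      moreover have "lo < u x" using lo[of "u x"] x by linarith
      ultimately show ?thesis using x u_invol inv_y by auto
    next
      assume "u x = x" then show ?thesis using x by simp
    qed
  qed
  have "bij_betw u (?B' - ?B) (?B - ?B')"
    by (rule bij_betw_byWitness[where f' = u]) (use 1 2 u_invol in blast)+
  then have "card (?B' - ?B) = card (?B - ?B')" by (rule bij_betw_same_card)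
  moreover have "finite ?B" "finite ?B'" by (rule finite_subset[of _ "{lo<..<a}"]; auto)+
  ultimately show ?thesis
    using card_Int_Diff[of ?B ?B'] card_Int_Diff[of ?B' ?B] by (simp add: Int_commute)
qed

lemma marked_covers_low:
  assumes y: "y \<in> marked_covers a w" and lo: "\<And>c. c \<le> lo \<Longrightarrow> inv w c \<le> 0" and c: "c \<le> lo"
  shows "inv y c \<le> 0"
proof (rule ccontr)
  assume neg: "\<not> inv y c \<le> 0"
  obtain i j where ij: "i \<le> 0" "0 < j" "\<not> int n dvd j - i" "y = w \<circ> t i j" "w j = a" "a < w i"
    "w \<in> W" "y \<in> W"
    using y by (elim marked_coversE)
  define x where "x = inv y c"
  have yx: "y x = c" by (simp add: x_def W_f_inv[OF ij(8)])
  have w_low: "z \<le> 0" if "w z \<le> lo" for z using lo[OF that] ij(7) by simp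
  show False
  proof (rule t_cases[OF ij(3), of x])
    fix m assume m: "x = i + int n * m" "t i j x = j + int n * m"
    then have "j + int n * m \<le> 0" using w_low[of "t i j x"] yx ij(4) c by simp
    then show False using m neg ij(1,2) x_def by linarith
  next
    fix m assume m: "x = j + int n * m" "t i j x = i + int n * m"
    then have "w x \<le> lo"
      using yx ij(4,5,6) c W_shift[OF ij(7), of i m] W_shift[OF ij(7), of j m] by simp
    then show False using w_low neg x_def by blast
  next
    assume "t i j x = x"
    then show False using w_low[of x] yx ij(4) c neg x_def by simp
  qed
qed

section \<open>The action on the fraction field\<close>

lemma S_carrier_iff:
  "p \<in> S_carrier n \<longleftrightarrow> (\<forall>m \<in> Poly_Mapping.keys p. Poly_Mapping.keys m \<subseteq> {1..<n})"
  by (simp add: S_carrier_def)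

lemma S_add:
  assumes "p \<in> S_carrier n" "q \<in> S_carrier n"
  shows "p + q \<in> S_carrier n"
  unfolding S_carrier_iff
proof
  fix m assume "m \<in> Poly_Mapping.keys (p + q)"
  then have "m \<in> Poly_Mapping.keys p \<or> m \<in> Poly_Mapping.keys q"
    using Poly_Mapping.keys_add[of p q] by auto
  then show "Poly_Mapping.keys m \<subseteq> {1..<n}"
    using assms by (auto simp: S_carrier_iff)
qed

lemma S_mult:
  assumes "p \<in> S_carrier n" "q \<in> S_carrier n"
  shows "p * q \<in> S_carrier n"
  unfolding S_carrier_iff
proof
  fix m assume "m \<in> Poly_Mapping.keys (p * q)"
  then obtain a b where m: "m = a + b" "a \<in> Poly_Mapping.keys p" "b \<in> Poly_Mapping.keys q"
    using keys_mult[of p q] by blast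
  then have "Poly_Mapping.keys a \<subseteq> {1..<n}" "Poly_Mapping.keys b \<subseteq> {1..<n}"
    using assms by (simp_all add: S_carrier_iff)
  then show "Poly_Mapping.keys m \<subseteq> {1..<n}"
    using Poly_Mapping.keys_add[of a b] m(1) by auto
qed

lemma S_of_int: "of_int c \<in> S_carrier n"
  by (auto simp: S_carrier_iff in_keys_iff lookup_of_int when_def split: if_splits)

lemma S_uminus: "p \<in> S_carrier n \<Longrightarrow> - p \<in> S_carrier n"
  using S_mult[OF S_of_int[of "-1"], of p] by simp

lemma S_0: "0 \<in> S_carrier n" and S_1: "1 \<in> S_carrier n"
  using S_of_int[of 0] S_of_int[of 1] by simp_all

lemma S_sum: "(\<And>a. a \<in> A \<Longrightarrow> f a \<in> S_carrier n) \<Longrightarrow> sum f A \<in> S_carrier n"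
  by (induction A rule: infinite_finite_induct) (simp_all add: S_0 S_add)

lemma S_prod: "(\<And>a. a \<in> A \<Longrightarrow> f a \<in> S_carrier n) \<Longrightarrow> prod f A \<in> S_carrier n"
  by (induction A rule: infinite_finite_induct) (simp_all add: S_1 S_mult)

lemma S_power: "p \<in> S_carrier n \<Longrightarrow> p ^ k \<in> S_carrier n"
  by (induction k) (simp_all add: S_1 S_mult)

lemma residue_exists:
  assumes "\<not> int n dvd j"
  obtains r where "r \<in> {1..<n}" "r = nat (j mod int n)" "int n dvd j - int r"
proof -
  have p: "0 < j mod int n" "j mod int n < int n"
    using assms n2 pos_mod_sign[of "int n" j] pos_mod_bound[of "int n" j] by (simp_all add: dvd_eq_mod_eq_0 order_less_le)
  have "int n dvd j - int (nat (j mod int n))" using p by (simp add: mod_eq_dvd_iff[symmetric])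
  moreover have "nat (j mod int n) \<in> {1..<n}"
    using p by (simp add: nat_less_iff Suc_le_eq)
  ultimately show thesis using that by blast
qed

lemma S_wt: "wt n j \<in> S_carrier n"
proof -
  have v: "var k \<in> S_carrier n" if "k \<in> {1..<n}" for k
    using that by (auto simp: S_carrier_iff var_def)
  show ?thesis
  proof (cases "int n dvd j")
    case True
    then show ?thesis by (auto simp: wt_def intro!: S_uminus S_sum v)
  next
    case False
    then obtain r where "r \<in> {1..<n}" "r = nat (j mod int n)" by (rule residue_exists)
    then show ?thesis using False v[of r] by (simp add: wt_def)
  qed
qed

lemma S_act: "act_S n w p \<in> S_carrier n"
  unfolding act_S_def by (intro S_sum S_mult S_of_int S_prod S_power S_wt)

lemma act_S_comp:
  assumes "v \<in> W"
  shows "act_S n v (act_S n w p) = act_S n (v \<circ> w) p"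
proof -
  have v: "act_S n v (wt n j) = wt n (v j)" for j
    using act_S_wt[of n v j] n2 assms by (simp add: W_iff bij_is_inj)
  show ?thesis
    unfolding act_S_def[of n w p] act_S_def[of n "v \<circ> w" p]
    by (simp add: act_S_sum act_S_mult act_S_of_int act_S_prod act_S_power v)
qed

lemma act_S_id:
  assumes "p \<in> S_carrier n"
  shows "act_S n id p = p"
  using act_S_inverse[of n id p] act_S_comp[of id id p] assms n2 by simp

lemma act_S_nonzero:
  assumes "w \<in> W" "p \<in> S_carrier n" "p \<noteq> 0"
  shows "act_S n w p \<noteq> 0"
proof
  assume "act_S n w p = 0"
  then have "act_S n (inv w) (act_S n w p) = 0" by simp
  then show False using act_S_inverse[of n w p] assms n2 by (simp add: W_iff)
qed

abbreviation F :: "mfrac set" where "F \<equiv> F_carrier n"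
abbreviation act :: "perm \<Rightarrow> mfrac \<Rightarrow> mfrac" where "act \<equiv> act_F n"

lemma F_cases:
  assumes "q \<in> F"
  obtains a b where "a \<in> S_carrier n" "b \<in> S_carrier n" "b \<noteq> 0" "q = Fract a b"
  using assms by (auto simp: F_carrier_def)

lemma FractI: "a \<in> S_carrier n \<Longrightarrow> b \<in> S_carrier n \<Longrightarrow> b \<noteq> 0 \<Longrightarrow> Fract a b \<in> F"
  by (auto simp: F_carrier_def)

lemma act_Fract:
  assumes "w \<in> W" "a \<in> S_carrier n" "b \<in> S_carrier n" "b \<noteq> 0"
  shows "act w (Fract a b) = Fract (act_S n w a) (act_S n w b)"
  using act_F_Fract assms n2 by simp

lemma of_int_Fract: "(of_int c :: mfrac) = Fract (of_int c) 1"
proof (cases c)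
  case (nonneg k)
  then show ?thesis by (simp add: of_nat_fract)
next
  case (neg k)
  then show ?thesis by (simp only: of_int_minus of_int_of_nat_eq of_nat_fract minus_fract)
qed

lemma F_of_int: "of_int c \<in> F"
  unfolding of_int_Fract using FractI[OF S_of_int S_1] by simp

lemma F_0 [simp]: "0 \<in> F" and F_1 [simp]: "1 \<in> F"
  using F_of_int[of 0] F_of_int[of 1] by simp_all

lemma F_add: "p \<in> F \<Longrightarrow> q \<in> F \<Longrightarrow> p + q \<in> F"
  by (elim F_cases) (simp add: FractI S_add S_mult)

lemma F_mult: "p \<in> F \<Longrightarrow> q \<in> F \<Longrightarrow> p * q \<in> F"
  by (elim F_cases) (simp add: FractI S_mult)

lemma F_uminus: "p \<in> F \<Longrightarrow> - p \<in> F"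
  by (elim F_cases) (simp add: FractI S_uminus)

lemma F_diff: "p \<in> F \<Longrightarrow> q \<in> F \<Longrightarrow> p - q \<in> F"
  using F_add[of p "- q"] F_uminus by simp

lemma F_inverse: "p \<in> F \<Longrightarrow> inverse p \<in> F"
proof -
  assume "p \<in> F"
  then obtain a b where ab: "a \<in> S_carrier n" "b \<in> S_carrier n" "b \<noteq> 0" "p = Fract a b" by (rule F_cases)
  show ?thesis
  proof (cases "a = 0")
    case True
    then have "p = 0" using ab by (simp add: Zero_fract_def eq_fract)
    then show ?thesis by simp
  next
    case False
    then show ?thesis using ab by (simp add: FractI)
  qed
qed

lemma F_divide: "p \<in> F \<Longrightarrow> q \<in> F \<Longrightarrow> p / q \<in> F"
  by (simp add: divide_inverse F_mult F_inverse)

lemma F_sum: "(\<And>a. a \<in> A \<Longrightarrow> f a \<in> F) \<Longrightarrow> sum f A \<in> F"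
  by (induction A rule: infinite_finite_induct) (simp_all add: F_add)

lemma F_prod: "(\<And>a. a \<in> A \<Longrightarrow> f a \<in> F) \<Longrightarrow> prod f A \<in> F"
  by (induction A rule: infinite_finite_induct) (simp_all add: F_mult)

lemma act_closed: "w \<in> W \<Longrightarrow> q \<in> F \<Longrightarrow> act w q \<in> F"
  by (elim F_cases) (simp add: act_Fract FractI S_act act_S_nonzero)

lemma act_add: "w \<in> W \<Longrightarrow> p \<in> F \<Longrightarrow> q \<in> F \<Longrightarrow> act w (p + q) = act w p + act w q"
  by (elim F_cases) (simp add: act_Fract S_add S_mult act_S_nonzero act_S_add act_S_mult)

lemma act_mult: "w \<in> W \<Longrightarrow> p \<in> F \<Longrightarrow> q \<in> F \<Longrightarrow> act w (p * q) = act w p * act w q"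
  by (elim F_cases) (simp add: act_Fract S_mult act_S_mult)

lemma act_of_int: "w \<in> W \<Longrightarrow> act w (of_int c) = of_int c"
proof -
  assume w: "w \<in> W"
  have one: "act w 1 = 1"
    using act_Fract[OF w S_1 S_1] by (simp add: One_fract_def)
  have zero: "act w 0 = 0"
    using act_Fract[OF w S_0 S_1] by (simp add: Zero_fract_def)
  have nat: "act w (of_nat k) = of_nat k" for k
  proof (induction k)
    case (Suc k)
    have "of_nat k \<in> F" using F_of_int[of "int k"] by simp
    then show ?case using Suc act_add[OF w F_1, of "of_nat k"] one by simp
  qed (simp add: zero)
  have "act w (of_nat k + - of_nat k) = act w (of_nat k) + act w (- of_nat k)" for k
    using F_of_int[of "int k"] F_uminus by (intro act_add[OF w]) auto
  then have neg: "act w (- of_nat k) = - of_nat k" for k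
    using nat[of k] zero by (simp add: add_eq_0_iff)
  show ?thesis
  proof (cases c)
    case (nonneg k)
    then show ?thesis using nat by simp
  next
    case (neg k)
    then show ?thesis using \<open>\<And>k. act w (- of_nat k) = - of_nat k\<close>[of "Suc k"]
      by (simp only: neg of_int_minus of_int_of_nat_eq)
  qed
qed

lemma act_0 [simp]: "w \<in> W \<Longrightarrow> act w 0 = 0" and act_1 [simp]: "w \<in> W \<Longrightarrow> act w 1 = 1"
  using act_of_int[of w 0] act_of_int[of w 1] by simp_all

lemma act_uminus: "w \<in> W \<Longrightarrow> q \<in> F \<Longrightarrow> act w (- q) = - act w q"
  using act_mult[OF _ F_of_int[of "-1"], of w q] act_of_int[of w "-1"] by simp

lemma act_diff: "w \<in> W \<Longrightarrow> p \<in> F \<Longrightarrow> q \<in> F \<Longrightarrow> act w (p - q) = act w p - act w q"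
  using act_add[of w p "- q"] act_uminus[of w q] F_uminus[of q] by simp

lemma act_sum:
  assumes "w \<in> W" "\<And>a. a \<in> A \<Longrightarrow> f a \<in> F"
  shows "act w (sum f A) = (\<Sum>a\<in>A. act w (f a))"
  using assms(2)
proof (induction A rule: infinite_finite_induct)
  case (insert x A)
  then show ?case using act_add[OF assms(1), of "f x" "sum f A"] F_sum[of A f] by simp
qed (use assms(1) in simp_all)

lemma act_comp:
  assumes "v \<in> W" "w \<in> W" "q \<in> F"
  shows "act v (act w q) = act (v \<circ> w) q"
proof -
  obtain a b where "a \<in> S_carrier n" "b \<in> S_carrier n" "b \<noteq> 0" "q = Fract a b"
    using assms(3) by (rule F_cases)
  then show ?thesis using assms W_comp by (simp add: act_Fract S_act act_S_nonzero act_S_comp)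
qed

lemma act_id: "q \<in> F \<Longrightarrow> act id q = q"
  by (elim F_cases) (simp add: act_Fract act_S_id)

lemma act_inverse:
  assumes "w \<in> W" "q \<in> F"
  shows "act w (inverse q) = inverse (act w q)"
proof (cases "q = 0")
  case False
  have "act w q * act w (inverse q) = 1"
    using act_mult[OF assms F_inverse[OF assms(2)]] False assms(1) by simp
  then show ?thesis by (metis inverse_unique)
qed (use assms(1) in simp)

lemma act_divide: "w \<in> W \<Longrightarrow> p \<in> F \<Longrightarrow> q \<in> F \<Longrightarrow> act w (p / q) = act w p / act w q"
  by (simp add: divide_inverse act_mult F_inverse act_inverse)

section \<open>Weights and simple roots as fractions\<close>

definition e :: "int \<Rightarrow> mfrac" where "e j = Fract (wt n j) 1"
definition root :: "int \<Rightarrow> mfrac" where "root k = e k - e (k + 1)"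

lemma e_F [simp]: "e j \<in> F" by (simp add: e_def FractI S_wt S_1)
lemma root_F [simp]: "root k \<in> F" by (simp add: root_def F_diff)

lemma e_cong: "int n dvd i - j \<Longrightarrow> e i = e j" by (simp add: e_def wt_cong)

lemma act_e: "w \<in> W \<Longrightarrow> act w (e j) = e (w j)"
  using act_S_wt[of n w j] n2 by (simp add: e_def act_Fract S_wt S_1 W_iff bij_is_inj)

lemma root_eq: "Fract (simple_root n k) 1 = root k"
proof -
  have "simple_root n k = wt n k - wt n (k + 1)"
  proof (cases "int n dvd k")
    case True
    then have "wt n k = wt n (int n)" "wt n (k + 1) = wt n 1" by (auto intro!: wt_cong)
    with True show ?thesis by (simp add: simple_root_def highest_root_def)
  qed (simp add: simple_root_def)
  then show ?thesis by (simp add: root_def e_def)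
qed

lemma root_cong: "int n dvd k - l \<Longrightarrow> root k = root l"
  unfolding root_def by (intro arg_cong2[where f = minus] e_cong) simp_all

lemma lookup_var: "Poly_Mapping.lookup (var k) (Poly_Mapping.single r (Suc 0)) = (if k = r then 1 else 0)"
  by (auto simp: var_def lookup_single when_def dest: arg_cong[where f = Poly_Mapping.keys])

lemma lookup_wt:
  assumes "r \<in> {1..<n}"
  shows "Poly_Mapping.lookup (wt n j) (Poly_Mapping.single r (Suc 0)) =
    (if int n dvd j then - 1 else if int n dvd j - int r then 1 else 0)"
proof (cases "int n dvd j")
  case True
  then show ?thesis using assms by (simp add: wt_def lookup_sum lookup_var)
next
  case False
  have "nat (j mod int n) = r \<longleftrightarrow> j mod int n = int r mod int n" using assms n2 by auto
  then show ?thesis using False by (simp add: wt_def lookup_var mod_eq_dvd_iff)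
qed

lemma e_inj:
  assumes "e i = e j"
  shows "int n dvd i - j"
proof -
  have eq: "wt n i = wt n j" using assms by (simp add: e_def eq_fract)
  have sub: "int n dvd i - j" if eq: "wt n i = wt n j" and i: "\<not> int n dvd i" for i j
  proof -
    obtain r where r: "r \<in> {1..<n}" "int n dvd i - int r" using i by (rule residue_exists)
    have "int n dvd j - int r"
      using lookup_wt[OF r(1), of i] lookup_wt[OF r(1), of j] eq i r(2) by (auto split: if_splits)
    from dvd_diff[OF r(2) this] show ?thesis by simp
  qed
  show ?thesis
  proof (cases "int n dvd i \<and> int n dvd j")
    case True then show ?thesis by (simp add: dvd_diff)
  next
    case False
    then show ?thesis using sub[of i j] sub[of j i] eq by (metis dvd_diff_commute)
  qed
qed

lemma root_nonzero [simp]: "root k \<noteq> 0"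
  using e_inj[of k "k + 1"] by (auto simp: root_def)

lemma of_int_mfrac_eq: "(of_int c :: mfrac) = of_int d \<longleftrightarrow> c = d"
  by (simp add: of_int_Fract eq_fract)

text \<open>Every weight has a nonzero linear coefficient, so the denominators
  \<open>of_int N - e a\<close> vanish for no integer N.\<close>

lemma of_int_ne_e: "(of_int c :: mfrac) \<noteq> e j"
proof
  assume "of_int c = e j"
  then have eq: "of_int c = wt n j" by (simp add: of_int_Fract e_def eq_fract)
  obtain r where r: "r \<in> {1..<n}" "int n dvd j \<or> int n dvd j - int r"
  proof (cases "int n dvd j")
    case True then show thesis using that[of 1] n2 by simp
  next
    case False then show thesis using residue_exists that by blast
  qed
  have "Poly_Mapping.lookup (wt n j) (Poly_Mapping.single r (Suc 0)) = 0"
  proof -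
    have "Poly_Mapping.single r (Suc 0) \<noteq> 0" by (metis lookup_single_eq lookup_zero nat.distinct(1))
    then show ?thesis unfolding eq[symmetric] by (simp add: lookup_of_int)
  qed
  then show False using lookup_wt[OF r(1), of j] r(2) by (auto split: if_splits)
qed

section \<open>The nilHecke ring\<close>

definition F_valued :: "(perm \<Rightarrow> mfrac) \<Rightarrow> bool" where
  "F_valued f \<longleftrightarrow> (\<forall>x. f x \<in> F)"

text \<open>An element of the twisted group algebra is given by its coefficient function; \<open>s_op k\<close> and
  \<open>A_op k\<close> are left multiplication by \<open>s\<^sub>k\<close> and \<open>A\<^sub>k\<close>.\<close>

definition s_op :: "int \<Rightarrow> (perm \<Rightarrow> mfrac) \<Rightarrow> perm \<Rightarrow> mfrac" where
  "s_op k f = (\<lambda>x. act (s k) (f (s k \<circ> x)))"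

definition A_op :: "int \<Rightarrow> (perm \<Rightarrow> mfrac) \<Rightarrow> perm \<Rightarrow> mfrac" where
  "A_op k f = (\<lambda>x. (f x - s_op k f x) / root k)"

lemma F_valuedD: "F_valued f \<Longrightarrow> f x \<in> F" by (simp add: F_valued_def)

lemma F_valued_s_op: "F_valued f \<Longrightarrow> F_valued (s_op k f)"
  by (simp add: F_valued_def s_op_def act_closed)

lemma F_valued_A_op: "F_valued f \<Longrightarrow> F_valued (A_op k f)"
  using F_valued_s_op[of f k] by (simp add: F_valued_def A_op_def F_divide F_diff)

lemma s_op_diff:
  "F_valued f \<Longrightarrow> F_valued g \<Longrightarrow> s_op k (\<lambda>x. f x - g x) = (\<lambda>x. s_op k f x - s_op k g x)"
  by (simp add: s_op_def act_diff F_valuedD)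

lemma s_op_divide:
  "F_valued f \<Longrightarrow> q \<in> F \<Longrightarrow> s_op k (\<lambda>x. f x / q) = (\<lambda>x. s_op k f x / act (s k) q)"
  by (simp add: s_op_def act_divide F_valuedD)

lemma s_op_s_op: "F_valued f \<Longrightarrow> s_op k (s_op l f) x = act (s k \<circ> s l) (f (s l \<circ> s k \<circ> x))"
  by (simp add: s_op_def act_comp F_valuedD comp_assoc)

lemma s_op_invol: "F_valued f \<Longrightarrow> s_op k (s_op k f) = f"
proof
  fix x assume f: "F_valued f"
  have "s k \<circ> s k = id" by auto
  then show "s_op k (s_op k f) x = f x" using f by (simp add: s_op_s_op act_id F_valuedD)
qed

lemma act_root: "w \<in> W \<Longrightarrow> act w (root k) = e (w k) - e (w (k + 1))"
  by (simp add: root_def act_diff act_e)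

lemma act_root_self: "act (s k) (root k) = - root k"
  unfolding act_root[OF s_W] s_left s_right by (simp add: root_def)

lemma s_op_A_op:
  assumes "F_valued f"
  shows "s_op k (A_op l f) = (\<lambda>x. (s_op k f x - s_op k (s_op l f) x) / act (s k) (root l))"
proof -
  have "F_valued (\<lambda>x. f x - s_op l f x)"
    using assms F_valued_s_op[OF assms] by (simp add: F_valued_def F_diff)
  then have "s_op k (A_op l f) = (\<lambda>x. s_op k (\<lambda>x. f x - s_op l f x) x / act (s k) (root l))"
    unfolding A_op_def by (rule s_op_divide) simp
  then show ?thesis using s_op_diff[OF assms F_valued_s_op[OF assms]] by simp
qed

lemma A_op_A_op:
  assumes "F_valued f"
  shows "A_op k (A_op k f) = (\<lambda>x. 0)"
proof
  fix x
  show "A_op k (A_op k f) x = 0"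
    unfolding A_op_def[of k "A_op k f"] s_op_A_op[OF assms] s_op_invol[OF assms]
    by (simp add: act_root_self A_op_def divide_simps)
qed

lemma A_op_add:
  assumes "F_valued f" "F_valued g"
  shows "A_op k (\<lambda>x. f x + g x) = (\<lambda>x. A_op k f x + A_op k g x)"
  using assms by (simp add: A_op_def s_op_def act_add F_valuedD add_divide_distrib diff_divide_distrib fun_eq_iff)

lemma F_valued_sum: "(\<And>y. y \<in> Y \<Longrightarrow> F_valued (f y)) \<Longrightarrow> F_valued (\<lambda>x. \<Sum>y\<in>Y. f y x)"
  by (simp add: F_valued_def F_sum)

lemma A_op_sum:
  assumes "\<And>y. y \<in> Y \<Longrightarrow> F_valued (f y)"
  shows "A_op k (\<lambda>x. \<Sum>y\<in>Y. f y x) = (\<lambda>x. \<Sum>y\<in>Y. A_op k (f y) x)"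
  using assms by (simp add: A_op_def s_op_def act_sum F_valuedD sum_subtractf flip: sum_divide_distrib)

lemma F_valued_scale: "q \<in> F \<Longrightarrow> F_valued f \<Longrightarrow> F_valued (\<lambda>x. q * f x)"
  by (simp add: F_valued_def F_mult)

text \<open>The Leibniz rule of the nilHecke ring; the coefficient of f x is the divided difference
  of q.\<close>

lemma A_op_scale:
  assumes "q \<in> F" "F_valued f"
  shows "A_op k (\<lambda>x. q * f x) =
    (\<lambda>x. (q - act (s k) q) / root k * f x + act (s k) q * A_op k f x)"
  using assms by (simp add: A_op_def s_op_def act_mult F_valuedD fun_eq_iff divide_simps)
    (simp add: algebra_simps)

lemma A_op_cong: "int n dvd k - l \<Longrightarrow> A_op k = A_op l"
  by (simp add: A_op_def s_op_def fun_eq_iff s_cong[of k l] root_cong[of k l])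

lemma s_commute:
  assumes "\<not> int n dvd k - l" "\<not> int n dvd k - l - 1" "\<not> int n dvd k - l + 1"
  shows "s k \<circ> s l = s l \<circ> s k" "s k l = l" "s k (l + 1) = l + 1"
proof -
  have "\<not> int n dvd l - k" "\<not> int n dvd l - (k + 1)" "\<not> int n dvd l + 1 - k" "\<not> int n dvd l + 1 - (k + 1)"
    using assms by (simp_all add: dvd_diff_commute algebra_simps)
  then show *: "s k l = l" "s k (l + 1) = l + 1" by (simp_all add: s_eq_t t_other)
  then show "s k \<circ> s l = s l \<circ> s k"
    using t_conj[OF s_W[of k] nd_succ(1)[of l]] by (simp add: s_eq_t[of l])
qed

lemma A_op_commute:
  assumes f: "F_valued f" and kl: "\<not> int n dvd k - l" "\<not> int n dvd k - l - 1" "\<not> int n dvd k - l + 1"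
  shows "A_op k (A_op l f) = A_op l (A_op k f)"
proof
  fix x
  have kl': "\<not> int n dvd l - k" "\<not> int n dvd l - k - 1" "\<not> int n dvd l - k + 1"
  proof -
    have "l - k = - (k - l)" "l - k - 1 = - (k - l + 1)" "l - k + 1 = - (k - l - 1)" by simp_all
    then show "\<not> int n dvd l - k" "\<not> int n dvd l - k - 1" "\<not> int n dvd l - k + 1"
      using kl by (simp_all only: dvd_minus_iff) simp_all
  qed
  have r: "act (s k) (root l) = root l" "act (s l) (root k) = root k"
    unfolding root_def by (simp_all only: act_diff act_e s_W e_F s_commute(2,3)[OF kl] s_commute(2,3)[OF kl'])
  have c: "s_op k (s_op l f) x = s_op l (s_op k f) x"
    using s_commute(1)[OF kl] f by (simp add: s_op_s_op)
  show "A_op k (A_op l f) x = A_op l (A_op k f) x"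
    unfolding A_op_def[of k "A_op l f"] A_op_def[of l "A_op k f"] s_op_A_op[OF f] r c
    by (simp add: A_op_def divide_simps)
qed

text \<open>Written in terms of the six translates of f under the dihedral group of s_k and s_l, the
  triple product becomes a rational expression in two roots. The braid relation is then an identity
  between two such expressions.\<close>

lemma A_op_triple:
  assumes f: "F_valued f"
    and r: "act (s k) (root l) = root k + root l" "act (s l) (root k) = root k + root l"
      "act (s k) (root k + root l) = root l"
  shows "A_op k (A_op l (A_op k f)) x =
    (((f x - s_op k f x) / root k - (s_op l f x - s_op l (s_op k f) x) / (root k + root l)) / root l
    - ((s_op k f x - f x) / (- root k) - (s_op k (s_op l f) x - s_op k (s_op l (s_op k f)) x) / root l)
      / (root k + root l)) / root k"
proof -
  have F: "F_valued (\<lambda>x. s_op l f x - s_op l (s_op k f) x)" "F_valued (s_op l f)"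
    "F_valued (s_op l (s_op k f))" "F_valued (A_op k f)"
    using F_valued_s_op F_valued_A_op f by (simp_all add: F_valued_def F_diff)
  have q: "root k + root l \<in> F" by (simp add: F_add)
  have 1: "s_op k (A_op k f) = (\<lambda>x. (s_op k f x - f x) / (- root k))"
    unfolding s_op_A_op[OF f] s_op_invol[OF f] act_root_self ..
  have 2: "s_op l (A_op k f) = (\<lambda>x. (s_op l f x - s_op l (s_op k f) x) / (root k + root l))"
    unfolding s_op_A_op[OF f] r ..
  have 3: "s_op k (s_op l (A_op k f)) = (\<lambda>x. (s_op k (s_op l f) x - s_op k (s_op l (s_op k f)) x) / root l)"
    unfolding 2 s_op_divide[OF F(1) q] s_op_diff[OF F(2,3)] r ..
  show ?thesis
    unfolding A_op_def[of k "A_op l (A_op k f)"] s_op_A_op[OF F(4)] 3 r 1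
    unfolding A_op_def[of l "A_op k f"] 2 unfolding A_op_def[of k f] ..
qed

lemma s_braid:
  assumes "n \<ge> 3"
  shows "s k k = k + 1" "s k (k + 1) = k" "s k (k + 2) = k + 2"
    "s (k + 1) k = k" "s (k + 1) (k + 1) = k + 2" "s (k + 1) (k + 2) = k + 1"
    "s k \<circ> (s (k + 1) \<circ> s k) = s (k + 1) \<circ> (s k \<circ> s (k + 1))"
proof -
  have "\<not> int n dvd 2" using assms by (auto dest: zdvd_imp_le)
  then have nd: "\<not> int n dvd k + 2 - k" "\<not> int n dvd k - (k + 2)" by simp_all
  have sl: "s (k + 1) = t (k + 1) (k + 2)" using s_eq_t[of "k + 1"] by (simp add: add.assoc)
  show 1: "s k k = k + 1" "s k (k + 1) = k" by simp_all
  show 2: "s k (k + 2) = k + 2" using nd by (simp add: s_eq_t t_other)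
  show 3: "s (k + 1) k = k" unfolding sl by (rule t_other) (use nd in simp_all)
  show 4: "s (k + 1) (k + 1) = k + 2" unfolding sl by (rule t_left)
  show 5: "s (k + 1) (k + 2) = k + 1" unfolding sl by (rule t_right) simp
  have "s k \<circ> s (k + 1) = t k (k + 2) \<circ> s k"
    using t_conj[OF s_W[of k], of "k + 2" "k + 1"] 1 2 by (simp add: sl)
  moreover have "s (k + 1) \<circ> s k = t k (k + 2) \<circ> s (k + 1)"
    using t_conj[OF s_W[of "k + 1"] nd_succ(1)[of k]] unfolding 3 4 s_eq_t[of k] .
  moreover have "s j \<circ> s j = id" for j by auto
  ultimately show "s k \<circ> (s (k + 1) \<circ> s k) = s (k + 1) \<circ> (s k \<circ> s (k + 1))"
    by (metis comp_assoc comp_id)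
qed

lemma A_op_braid:
  assumes f: "F_valued f" and n3: "n \<ge> 3"
  shows "A_op k (A_op (k + 1) (A_op k f)) = A_op (k + 1) (A_op k (A_op (k + 1) f))"
proof
  fix x
  let ?l = "k + 1"
  note b = s_braid[OF n3, of k]
  have r: "root k = e k - e (k + 1)" "root ?l = e (k + 1) - e (k + 2)" "root k + root ?l = e k - e (k + 2)"
    by (simp_all add: root_def add.assoc)
  have acts: "act (s k) (root ?l) = root k + root ?l" "act (s ?l) (root k) = root k + root ?l"
    "act (s k) (root k + root ?l) = root ?l" "act (s ?l) (root k + root ?l) = root k"
    unfolding r(3) unfolding r by (simp_all only: act_diff act_e s_W e_F b)
  have ne: "root k + root ?l \<noteq> 0"
  proof
    assume "root k + root ?l = 0"
    then have "int n dvd k - (k + 2)" using e_inj[of k "k + 2"] unfolding r(3) by simp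
    then show False using n3 by (auto dest: zdvd_imp_le)
  qed
  have br: "s_op k (s_op ?l (s_op k f)) x = s_op ?l (s_op k (s_op ?l f)) x"
  proof -
    have "s_op i (s_op j (s_op i f)) x = act (s i \<circ> (s j \<circ> s i)) (f (s i \<circ> (s j \<circ> s i) \<circ> x))" for i j
      using f by (simp add: s_op_def act_comp act_closed F_valuedD W_comp comp_assoc)
    then show ?thesis using b(7) by simp
  qed
  have alg: "(((f0 - f1) / a - (f2 - f21) / (a + b)) / b - ((f1 - f0) / (- a) - (f12 - g) / b) / (a + b)) / a
    = (((f0 - f2) / b - (f1 - f12) / (a + b)) / a - ((f2 - f0) / (- b) - (f21 - g) / a) / (a + b)) / b"
    if "a \<noteq> 0" "b \<noteq> 0" "a + b \<noteq> 0" for f0 f1 f2 f12 f21 g a b :: mfrac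
    using that by (simp add: divide_simps) (simp add: algebra_simps)
  have c: "root ?l + root k = root k + root ?l" by simp
  show "A_op k (A_op ?l (A_op k f)) x = A_op ?l (A_op k (A_op ?l f)) x"
    unfolding A_op_triple[OF f acts(1,2,3)] A_op_triple[OF f acts(2,1)[folded c] acts(4)[folded c]] br c
    by (rule alg) (use ne in simp_all)
qed

section \<open>Products along words and the basis of the A_w\<close>

definition unit_fn :: "perm \<Rightarrow> mfrac" where
  "unit_fn x = (if x = id then 1 else 0)"

definition word_fn :: "int list \<Rightarrow> perm \<Rightarrow> mfrac" where
  "word_fn xs = foldr A_op xs unit_fn"

lemma word_fn_simps [simp]: "word_fn [] = unit_fn" "word_fn (k # xs) = A_op k (word_fn xs)"
  by (simp_all add: word_fn_def)

lemma F_valued_word_fn: "F_valued (word_fn xs)"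
proof (induction xs)
  case (Cons k xs)
  then show ?case by (simp add: F_valued_A_op)
qed (simp add: F_valued_def unit_fn_def)

lemma s_comp_W_iff: "s k \<circ> x \<in> W \<longleftrightarrow> x \<in> W"
  using s_W_comp[of "s k \<circ> x" k] s_W_comp[of x k] by auto

lemma A_op_nonzero: "A_op k f x \<noteq> 0 \<Longrightarrow> f x \<noteq> 0 \<or> f (s k \<circ> x) \<noteq> 0"
  by (auto simp: A_op_def s_op_def)

lemma word_fn_support: "word_fn xs x \<noteq> 0 \<Longrightarrow> x \<in> W"
proof (induction xs arbitrary: x)
  case Nil
  then have "x = id" by (simp add: unit_fn_def split: if_splits)
  then show ?case by (simp only: id_W)
next
  case (Cons k xs)
  then show ?case using A_op_nonzero[of k "word_fn xs" x] s_comp_W_iff by auto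
qed

lemma id_ne_s: "id \<noteq> s k"
proof
  assume "id = s k"
  then have "id k = s k k" by simp
  then show False by simp
qed

lemma lookup_A_gen:
  "Poly_Mapping.lookup (A_gen n k) v =
    (if v = id then 1 / root k else if v = s k then - 1 / root k else 0)"
  using id_ne_s[of k] by (auto simp: A_gen_def scale_def root_eq Poly_Mapping.map.rep_eq lookup_minus lookup_single
    when_def divide_inverse)

lemma lookup_tw_mult_gen:
  assumes "Poly_Mapping.keys f \<subseteq> W" "F_valued (Poly_Mapping.lookup f)"
  shows "Poly_Mapping.lookup (tw_mult n (A_gen n k) f) = A_op k (Poly_Mapping.lookup f)"
proof
  fix x :: perm
  let ?f = "Poly_Mapping.lookup f"
  have keys: "Poly_Mapping.keys (A_gen n k) = {id, s k}"
    using id_ne_s[of k] by (auto simp: in_keys_iff lookup_A_gen)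
  have eq: "s k \<circ> w = x \<longleftrightarrow> w = s k \<circ> x" for w by auto
  have 1: "(\<Sum>w \<in> Poly_Mapping.keys f. c w when w = y) = (c y when y \<in> Poly_Mapping.keys f)"
    for c :: "perm \<Rightarrow> mfrac" and y
    by (simp add: when_def sum.delta' eq_commute)
  have "Poly_Mapping.lookup (tw_mult n (A_gen n k) f) x =
      (\<Sum>w \<in> Poly_Mapping.keys f. 1 / root k * act id (?f w) when w = x)
    + (\<Sum>w \<in> Poly_Mapping.keys f. - 1 / root k * act (s k) (?f w) when w = s k \<circ> x)"
    unfolding tw_mult_def keys
    using id_ne_s[of k] by (simp add: lookup_add lookup_sum lookup_single lookup_A_gen eq)
  also have "\<dots> = A_op k ?f x"
    unfolding 1 using assms(2)
    by (auto simp: when_def in_keys_iff A_op_def s_op_def act_id F_valuedD diff_divide_distrib)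
  finally show "Poly_Mapping.lookup (tw_mult n (A_gen n k) f) x = A_op k ?f x" .
qed

lemma lookup_A_word: "Poly_Mapping.lookup (A_word n xs) = word_fn xs"
proof (induction xs)
  case Nil
  then show ?case by (auto simp: A_word_def unit_fn_def lookup_single when_def fun_eq_iff)
next
  case (Cons k xs)
  have "Poly_Mapping.keys (A_word n xs) \<subseteq> W"
    using word_fn_support by (auto simp: in_keys_iff Cons)
  moreover have "A_word n (k # xs) = tw_mult n (A_gen n k) (A_word n xs)" by (simp add: A_word_def)
  ultimately show ?case using lookup_tw_mult_gen[of "A_word n xs" k] F_valued_word_fn Cons by simp
qed

definition A_fun :: "perm \<Rightarrow> perm \<Rightarrow> mfrac" where
  "A_fun w = Poly_Mapping.lookup (A_elt n w)"

lemma A_fun_eq: "A_fun w = word_fn (SOME xs. reduced_word n w xs)"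
  by (simp add: A_fun_def A_elt_def lookup_A_word)

lemma F_valued_A_fun: "F_valued (A_fun w)"
  by (simp add: A_fun_eq F_valued_word_fn)

lemma mod_letter: "k mod int n \<in> {0..<int n}" "int n dvd k mod int n - k"
  using n2 by (simp_all add: mod_eq_dvd_iff[symmetric])

lemma reduced_Cons:
  assumes "w \<in> W" "\<not> up k w" "reduced_word n (s k \<circ> w) xs"
  shows "reduced_word n w (k mod int n # xs)"
  using assms(3) down_len[OF assms(1,2)] mod_letter(1)[of k] s_cong[OF mod_letter(2)[of k]]
  unfolding reduced_word_def is_word_def by simp

lemma reduced_ConsD:
  assumes "w \<in> W" "reduced_word n w (k # xs)"
  shows "reduced_word n (s k \<circ> w) xs" "\<not> up k w"
proof -
  have "w = s k \<circ> word_perm n xs" "set xs \<subseteq> {0..<int n}" "length xs + 1 = len w"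
    using assms(2) by (auto simp: reduced_word_def is_word_def)
  then have w: "s k \<circ> w = word_perm n xs" "set xs \<subseteq> {0..<int n}" "length xs + 1 = len w" by simp_all
  then have "is_word n (s k \<circ> w) xs" by (simp add: is_word_def)
  then have "len (s k \<circ> w) \<le> length xs" by (rule len_le)
  then show "\<not> up k w" using up_len[OF assms(1), of k] w by linarith
  then show "reduced_word n (s k \<circ> w) xs"
    using down_len[OF assms(1)] w by (simp add: reduced_word_def is_word_def)
qed

text \<open>Matsumoto's theorem: two descents of \<open>w\<close> generate a dihedral parabolic subgroup whose longest
  element splits off \<open>w\<close> on the left.\<close>

lemma word_fn_reduced: "w \<in> W \<Longrightarrow> reduced_word n w xs \<Longrightarrow> word_fn xs = A_fun w"
proof (induction "len w" arbitrary: w xs rule: less_induct)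
  case less
  note w = less.prems(1)
  have step: "A_fun v = A_op k (A_fun (s k \<circ> v))" if v: "v \<in> W" "\<not> up k v" "len v < len w" for v k
  proof -
    have sv: "s k \<circ> v \<in> W" "len (s k \<circ> v) < len w" using v down_len[OF v(1,2)] by simp_all
    obtain zs where zs: "reduced_word n (s k \<circ> v) zs" using reduced_exists[OF sv(1)] by blast
    have "A_fun v = word_fn (k mod int n # zs)"
      using less.hyps[OF v(3,1) reduced_Cons[OF v(1,2) zs]] ..
    also have "\<dots> = A_op k (word_fn zs)" using A_op_cong[OF mod_letter(2)[of k]] by simp
    also have "word_fn zs = A_fun (s k \<circ> v)" using less.hyps[OF sv(2,1) zs] .
    finally show ?thesis .
  qed
  have W': "s k \<circ> v \<in> W" if "v \<in> W" for v k using that by simp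
  have eq: "A_op i (A_fun (s i \<circ> w)) = A_op j (A_fun (s j \<circ> w))"
    if d: "\<not> up i w" "\<not> up j w" and ij: "j = i + 1 \<or> \<not> int n dvd i - j \<and> \<not> int n dvd i - j - 1 \<and> \<not> int n dvd i - j + 1"
    for i j
    using ij
  proof
    assume j: "j = i + 1"
    have ge: "inv w i \<ge> inv w (i + 1)" "inv w (i + 1) \<ge> inv w (i + 2)"
      using d by (simp_all add: up_def j add.assoc)
    \<comment> \<open>For n = 2 the group is infinite dihedral and has no longest element: two
      adjacent descents would contradict \<open>inv w (i + 2) = inv w i + 2\<close>.\<close>
    have n3: "n \<ge> 3"
    proof (rule ccontr)
      assume "\<not> n \<ge> 3"
      then have "int n = 2" using n2 by simp
      then have "inv w (i + 2) = inv w i + 2" using W_shift[OF W_inv[OF w], of i 1] by simp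
      then show False using ge by simp
    qed
    note b = s_braid[OF n3, of i]
    let ?w1 = "s i \<circ> w" and ?v1 = "s j \<circ> w"
    let ?w2 = "s j \<circ> ?w1" and ?v2 = "s i \<circ> ?v1"
    have nup: "\<not> up j ?w1" "\<not> up i ?w2" "\<not> up i ?v1" "\<not> up j ?v2"
      using ge b unfolding up_def inv_s_comp[OF w] inv_s_comp[OF W'[OF w]] j
      by (simp_all add: add.assoc)
    have lens: "len ?w1 < len w" "len ?v1 < len w" "len ?w2 < len w" "len ?v2 < len w"
      using down_len[OF w d(1)] down_len[OF w d(2)] down_len[OF W'[OF w] nup(1)] down_len[OF W'[OF w] nup(3)]
      by simp_all
    have "s i \<circ> ?w2 = s j \<circ> ?v2" using b(7) j by (simp add: comp_assoc[symmetric])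
    then show ?thesis
      using step[OF W'[OF w] nup(1) lens(1)] step[OF W'[OF w] nup(3) lens(2)]
        step[OF W'[OF W'[OF w]] nup(2) lens(3)] step[OF W'[OF W'[OF w]] nup(4) lens(4)]
        A_op_braid[OF F_valued_A_fun n3, of i "s i \<circ> ?w2"] j by simp
  next
    assume c: "\<not> int n dvd i - j \<and> \<not> int n dvd i - j - 1 \<and> \<not> int n dvd i - j + 1"
    then have c': "\<not> int n dvd j - i" "\<not> int n dvd j - i - 1" "\<not> int n dvd j - i + 1"
    proof -
      have "j - i = - (i - j)" "j - i - 1 = - (i - j + 1)" "j - i + 1 = - (i - j - 1)" by simp_all
      then show "\<not> int n dvd j - i" "\<not> int n dvd j - i - 1" "\<not> int n dvd j - i + 1"
        using c by (simp_all only: dvd_minus_iff) simp_all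
    qed
    note sc = s_commute[of i j] s_commute[OF c']
    have nup: "\<not> up j (s i \<circ> w)" "\<not> up i (s j \<circ> w)"
      using d sc c unfolding up_def inv_s_comp[OF w] by simp_all
    have lens: "len (s i \<circ> w) < len w" "len (s j \<circ> w) < len w"
      using down_len[OF w d(1)] down_len[OF w d(2)] by simp_all
    have "s j \<circ> (s i \<circ> w) = s i \<circ> (s j \<circ> w)" using sc(4) by (simp add: comp_assoc[symmetric])
    then show ?thesis
      using step[OF W'[OF w] nup(1) lens(1)] step[OF W'[OF w] nup(2) lens(2)]
        A_op_commute[OF F_valued_A_fun, of i j] c by simp
  qed
  have main: "word_fn xs = word_fn ys" if xs: "reduced_word n w xs" and ys: "reduced_word n w ys" for xs ys
  proof (cases xs)
    case Nil
    then have "ys = []" using xs ys by (auto simp: reduced_word_def)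
    then show ?thesis using Nil by simp
  next
    case (Cons i xs')
    then obtain j ys' where ys': "ys = j # ys'" using xs ys by (cases ys) (auto simp: reduced_word_def)
    note dx = reduced_ConsD[OF w xs[unfolded Cons]] and dy = reduced_ConsD[OF w ys[unfolded ys']]
    have X: "word_fn xs = A_op i (A_fun (s i \<circ> w))"
      using less.hyps[OF _ _ dx(1)] down_len[OF w dx(2)] w Cons by simp
    have Y: "word_fn ys = A_op j (A_fun (s j \<circ> w))"
      using less.hyps[OF _ _ dy(1)] down_len[OF w dy(2)] w ys' by simp
    consider "int n dvd i - j" | "int n dvd i - j - 1" | "int n dvd i - j + 1"
      | "\<not> int n dvd i - j \<and> \<not> int n dvd i - j - 1 \<and> \<not> int n dvd i - j + 1" by blast
    then have "A_op i (A_fun (s i \<circ> w)) = A_op j (A_fun (s j \<circ> w))"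
    proof cases
      case 1
      then show ?thesis using A_op_cong[OF 1] s_cong[OF 1] by simp
    next
      case 2
      then have "int n dvd i - (j + 1)" by (simp add: algebra_simps)
      then show ?thesis using eq[of j "j + 1"] dx(2) dy(2) A_op_cong[of i "j + 1"] s_cong[of i "j + 1"]
        up_cong[OF w, of i "j + 1"] by simp
    next
      case 3
      then have "int n dvd (i + 1) - j" by (simp add: algebra_simps)
      then show ?thesis using eq[of i "i + 1"] dx(2) dy(2) A_op_cong[of "i + 1" j] s_cong[of "i + 1" j]
        up_cong[OF w, of "i + 1" j] by simp
    next
      case 4
      then show ?thesis using eq dx(2) dy(2) by blast
    qed
    then show ?thesis using X Y by simp
  qed
  have "reduced_word n w (SOME xs. reduced_word n w xs)"
    using reduced_exists[OF w] by (rule someI_ex)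
  then show ?case unfolding A_fun_eq using main[OF less.prems(2)] by blast
qed

lemma A_op_A_fun:
  assumes w: "w \<in> W"
  shows "A_op k (A_fun w) = (if up k w then A_fun (s k \<circ> w) else (\<lambda>x. 0))"
proof -
  have step: "A_fun v = A_op k (A_fun (s k \<circ> v))" if v: "v \<in> W" "\<not> up k v" for v
  proof -
    obtain zs where zs: "reduced_word n (s k \<circ> v) zs" using reduced_exists[OF s_W_comp[OF v(1)]] by blast
    show ?thesis
      using word_fn_reduced[OF v(1) reduced_Cons[OF v zs]] word_fn_reduced[OF s_W_comp[OF v(1)] zs]
        A_op_cong[OF mod_letter(2)[of k]] by simp
  qed
  show ?thesis
  proof (cases "up k w")
    case True
    then show ?thesis using step[of "s k \<circ> w"] w up_s[OF w] by simp
  next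
    case False
    then show ?thesis using step[OF w False] A_op_A_op[OF F_valued_A_fun] by simp
  qed
qed

lemma A_fun_id: "A_fun id = unit_fn"
  using word_fn_reduced[of id "[]"] by (simp add: reduced_word_def is_word_def)

text \<open>Length takes the place of the Bruhat order here: the matrix of the A_w is triangular
  with respect to length, with nonzero diagonal. This gives linear independence and, in
  \<open>delta_expansion\<close>, inversion.\<close>

lemma A_fun_triangular:
  "w \<in> W \<Longrightarrow> (A_fun w x \<noteq> 0 \<longrightarrow> x \<in> W \<and> (x = w \<or> len x < len w)) \<and> A_fun w w \<noteq> 0"
proof (induction "len w" arbitrary: w x rule: less_induct)
  case less
  note w = less.prems
  show ?case
  proof (cases "w = id")
    case True
    then show ?thesis by (simp add: A_fun_id unit_fn_def)
  next
    case False
    then obtain k where k: "\<not> up k w" using descent_exists[OF w] by blast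
    let ?v = "s k \<circ> w"
    have v: "?v \<in> W" "up k ?v" using w k up_s[OF w] by simp_all
    have lv: "len w = len ?v + 1" using down_len[OF w k] .
    have wA: "A_fun w = A_op k (A_fun ?v)" using A_op_A_fun[OF v(1), of k] v by simp
    note IH = less.hyps[OF _ v(1)]
    have sup: "y \<in> W \<and> (y = ?v \<or> len y < len ?v)" if "A_fun ?v y \<noteq> 0" for y
      using IH[of y] that lv by simp
    have nz: "A_fun ?v ?v \<noteq> 0" using IH lv by simp
    have "x \<in> W \<and> (x = w \<or> len x < len w)" if nzx: "A_fun w x \<noteq> 0"
    proof -
      consider "A_fun ?v x \<noteq> 0" | "A_fun ?v (s k \<circ> x) \<noteq> 0"
        using A_op_nonzero[of k "A_fun ?v" x] nzx wA by auto
      then show ?thesis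
      proof cases
        case 1
        then show ?thesis using sup lv by fastforce
      next
        case 2
        then have x: "x \<in> W" using sup s_comp_W_iff by blast
        have "s k \<circ> x = ?v \<Longrightarrow> x = w" by (metis s_s_comp)
        moreover have "len x \<le> len (s k \<circ> x) + 1" using len_s_le[OF s_W_comp[OF x], of k k] by simp
        ultimately show ?thesis using sup[OF 2] x lv by fastforce
      qed
    qed
    moreover have "A_fun w w \<noteq> 0"
    proof -
      have "A_fun ?v w = 0"
      proof (rule ccontr)
        assume "A_fun ?v w \<noteq> 0"
        then show False using sup[of w] lv by auto
      qed
      moreover have "act (s k) (A_fun ?v ?v) \<noteq> 0"
      proof
        assume z: "act (s k) (A_fun ?v ?v) = 0"
        have F: "A_fun ?v ?v \<in> F" by (rule F_valuedD[OF F_valued_A_fun])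
        have "s k \<circ> s k = id" by auto
        then have "act (s k) (act (s k) (A_fun ?v ?v)) = A_fun ?v ?v"
          using act_comp[OF s_W s_W F] act_id[OF F] by simp
        then show False using z nz by simp
      qed
      ultimately show ?thesis unfolding wA A_op_def s_op_def by simp
    qed
    ultimately show ?thesis by blast
  qed
qed

lemma A_fun_support:
  assumes "w \<in> W"
  shows "A_fun w x \<noteq> 0 \<Longrightarrow> x \<in> W \<and> (x = w \<or> len x < len w)" and "A_fun w w \<noteq> 0"
  using A_fun_triangular[OF assms] by blast+

lemma A_fun_independent:
  assumes B: "finite B" "B \<subseteq> W" and z: "\<And>x. x \<in> W \<Longrightarrow> (\<Sum>u\<in>B. q u * A_fun u x) = 0"
    and u: "u \<in> B"
  shows "q u = 0"
proof (rule ccontr)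
  assume "q u \<noteq> 0"
  then have ne: "{u \<in> B. q u \<noteq> 0} \<noteq> {}" using u by blast
  let ?C = "{u \<in> B. q u \<noteq> 0}"
  have fin: "finite ?C" using B by simp
  obtain v where v: "v \<in> ?C" "\<And>y. y \<in> ?C \<Longrightarrow> len y \<le> len v"
    using Max_in[of "len ` ?C"] Max_ge[of "len ` ?C"] fin ne by (smt (verit) finite_imageI imageE image_eqI image_is_empty)
  have vW: "v \<in> W" using v B by blast
  have "q y * A_fun y v = 0" if "y \<in> B" "y \<noteq> v" for y
  proof (cases "q y = 0")
    case False
    then have "len y \<le> len v" using v(2) that by simp
    then show ?thesis using A_fun_support(1)[of y v] that B by fastforce
  qed simp
  then have "(\<Sum>y\<in>B. q y * A_fun y v) = (\<Sum>y\<in>{v}. q y * A_fun y v)"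
    using B v by (intro sum.mono_neutral_right) auto
  then have "q v * A_fun v v = 0" using z[OF vW] by simp
  then show False using v A_fun_support(2)[OF vW] by simp
qed

section \<open>Weighted sums over strong strips\<close>

definition xf :: "int \<Rightarrow> int \<Rightarrow> mfrac" where "xf N a = 1 / (of_int N - e a)"

lemma of_int_e_nz: "of_int N - e a \<noteq> 0"
  using of_int_ne_e[of N a] by simp

lemma xf_nonzero [simp]: "xf N a \<noteq> 0"
  using of_int_e_nz by (simp add: xf_def)

lemma xf_F [simp]: "xf N a \<in> F"
  by (simp add: xf_def F_divide F_diff F_of_int)

lemma act_xf: "w \<in> W \<Longrightarrow> act w (xf N a) = xf N (w a)"
  by (simp add: xf_def act_divide act_diff F_diff F_of_int act_of_int act_e)

text \<open>The partial fraction identity that links the weights of strips with the A_k: the divided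
  difference of one factor is an invariant product of two.\<close>

lemma xf_divided_difference: "(xf N a - xf N (a + 1)) / root a = xf N a * xf N (a + 1)"
  using of_int_e_nz[of N a] of_int_e_nz[of N "a + 1"] root_nonzero[of a]
  unfolding xf_def root_def by (simp add: divide_simps)

lemma xf_divided_difference': "(xf N (a + 1) - xf N a) / root a = - (xf N a * xf N (a + 1))"
  using xf_divided_difference[of N a] by (metis minus_diff_eq minus_divide_left)

lemma A_op_xf_left:
  "F_valued f \<Longrightarrow> A_op a (\<lambda>x. xf N a * f x) = (\<lambda>x. xf N a * xf N (a + 1) * f x + xf N (a + 1) * A_op a f x)"
  by (simp add: A_op_scale act_xf xf_divided_difference)

lemma A_op_xf_right:
  "F_valued f \<Longrightarrow> A_op a (\<lambda>x. xf N (a + 1) * f x) = (\<lambda>x. - (xf N a * xf N (a + 1)) * f x + xf N a * A_op a f x)"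
  by (simp add: A_op_scale act_xf xf_divided_difference')

lemma A_op_xf_both:
  assumes "F_valued f"
  shows "A_op a (\<lambda>x. xf N a * xf N (a + 1) * f x) = (\<lambda>x. xf N a * xf N (a + 1) * A_op a f x)"
proof -
  have "act (s a) (xf N a * xf N (a + 1)) = xf N a * xf N (a + 1)"
    by (simp add: act_mult act_xf)
  then show ?thesis using assms by (subst A_op_scale) (simp_all add: F_mult)
qed

lemma A_op_xf_other:
  "F_valued f \<Longrightarrow> s k c = c \<Longrightarrow> A_op k (\<lambda>x. xf N c * f x) = (\<lambda>x. xf N c * A_op k f x)"
  by (simp add: A_op_scale act_xf)

text \<open>The list holds the values to be processed, the leftmost one first. For the decreasing list of
  all values in a long interval, \<open>strip_sum N as \<phi> v\<close> is the sum over the strong strips \<open>v \<rightarrow> u\<close> of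
  \<open>\<phi> u\<close> times the product of the \<open>xf N a\<close> for those \<open>a\<close> whose position is not positive after
  the step which processes \<open>a\<close>.\<close>

fun strip_sum :: "int \<Rightarrow> int list \<Rightarrow> (perm \<Rightarrow> mfrac) \<Rightarrow> perm \<Rightarrow> mfrac" where
  "strip_sum N [] \<phi> v = \<phi> v"
| "strip_sum N (a # as) \<phi> v = (if inv v a \<le> 0 then xf N a * strip_sum N as \<phi> v
     else strip_sum N as \<phi> v + xf N a * (\<Sum>y\<in>marked_covers a v. strip_sum N as \<phi> y))"

text \<open>The candidate for the image of A_v, as a coefficient function;
  \<open>A_fun_divide_Q\<close> confirms it for long intervals of values.\<close>

definition Psi :: "int \<Rightarrow> int list \<Rightarrow> perm \<Rightarrow> perm \<Rightarrow> mfrac" where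
  "Psi N as v = (\<lambda>x. strip_sum N as (\<lambda>u. A_fun u x) v)"

lemma Psi_Nil [simp]: "Psi N [] v = A_fun v" by (simp add: Psi_def)

lemma Psi_nonpos: "inv v a \<le> 0 \<Longrightarrow> Psi N (a # as) v = (\<lambda>x. xf N a * Psi N as v x)"
  by (simp add: Psi_def)

lemma Psi_pos: "0 < inv v a \<Longrightarrow>
    Psi N (a # as) v = (\<lambda>x. Psi N as v x + xf N a * (\<Sum>y\<in>marked_covers a v. Psi N as y x))"
  by (simp add: Psi_def)

lemma F_valued_Psi: "F_valued (Psi N as v)"
proof (induction as arbitrary: v)
  case (Cons a as)
  then show ?case
    by (cases "inv v a \<le> 0")
      (simp_all add: Psi_nonpos Psi_pos F_valued_def F_mult F_add F_sum)
qed (simp add: F_valued_A_fun)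

text \<open>The recursion of \<open>A_op_A_fun\<close>. Together with the value at the identity it
  determines the whole family along reduced words.\<close>

definition intertwines :: "int \<Rightarrow> int \<Rightarrow> int list \<Rightarrow> bool" where
  "intertwines N k as \<longleftrightarrow> (\<forall>v\<in>W. A_op k (Psi N as v) = (if up k v then Psi N as (s k \<circ> v) else (\<lambda>x. 0)))"

text \<open>At a descent the function is itself in the image of A_k, so A_k kills it because its
  square is zero.\<close>

lemma intertwinesI:
  assumes "\<And>v. v \<in> W \<Longrightarrow> up k v \<Longrightarrow> A_op k (Psi N as v) = Psi N as (s k \<circ> v)"
  shows "intertwines N k as"
  unfolding intertwines_def
proof
  fix v assume v: "v \<in> W"
  show "A_op k (Psi N as v) = (if up k v then Psi N as (s k \<circ> v) else (\<lambda>x. 0))"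
  proof (cases "up k v")
    case False
    then have "A_op k (Psi N as (s k \<circ> v)) = Psi N as v"
      using assms[of "s k \<circ> v"] v up_s[OF v] by simp
    then have "A_op k (Psi N as v) = (\<lambda>x. 0)" using A_op_A_op[OF F_valued_Psi] by metis
    then show ?thesis using False by simp
  qed (use assms v in simp)
qed

lemma intertwinesD:
  "intertwines N k as \<Longrightarrow> v \<in> W \<Longrightarrow> up k v \<Longrightarrow> A_op k (Psi N as v) = Psi N as (s k \<circ> v)"
  "intertwines N k as \<Longrightarrow> v \<in> W \<Longrightarrow> A_op k (Psi N as v) x = (if up k v then Psi N as (s k \<circ> v) x else 0)"
  by (simp_all add: intertwines_def)

lemma intertwines_cong: "int n dvd k - l \<Longrightarrow> intertwines N k as \<longleftrightarrow> intertwines N l as"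
  by (simp add: intertwines_def A_op_cong[of k l] s_cong[of k l] up_cong[of _ k l])

lemma sum_marked_covers_s:
  fixes f :: "perm \<Rightarrow> mfrac"
  assumes v: "v \<in> W" "up k v"
  shows "(\<Sum>x\<in>marked_covers c (s k \<circ> v). f x) =
    (if int n dvd c - k \<and> inv v c \<le> 0 \<and> 0 < inv v (c + 1) then f v else 0) +
    (\<Sum>y\<in>marked_covers (s k c) v. if up k y then f (s k \<circ> y) else 0)"
proof -
  let ?Y = "{y \<in> marked_covers (s k c) v. up k y}"
  have inj: "inj_on (\<lambda>y. s k \<circ> y) ?Y"
    by (rule inj_on_inverseI[of _ "\<lambda>y. s k \<circ> y"]) simp
  have nv: "v \<notin> (\<lambda>y. s k \<circ> y) ` ?Y"
    using up_s v(2) marked_covers_W by auto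
  have "(\<Sum>x\<in>(\<lambda>y. s k \<circ> y) ` ?Y. f x) = (\<Sum>y\<in>?Y. f (s k \<circ> y))"
    by (subst sum.reindex[OF inj], intro sum.cong refl) (simp only: o_apply)
  also have "\<dots> = (\<Sum>y\<in>marked_covers (s k c) v. if up k y then f (s k \<circ> y) else 0)"
    by (simp add: sum.inter_filter)
  finally show ?thesis
    unfolding marked_covers_s[OF v] using nv by simp
qed

text \<open>s_k fixes c, so neither the factor nor the position of c changes. Covers of v that have
  a descent at k are killed by A_k; the others correspond to the covers of s_k v by the diamond
  property.\<close>

lemma intertwines_other:
  assumes as: "intertwines N k as" and c: "\<not> int n dvd c - k" "\<not> int n dvd c - (k + 1)"
  shows "intertwines N k (c # as)"
proof (rule intertwinesI)
  fix v assume v: "v \<in> W" "up k v"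
  have sc: "s k c = c" using t_other[OF c] by (simp add: s_eq_t)
  have inv: "inv (s k \<circ> v) c = inv v c" using inv_s_comp[OF v(1)] sc by simp
  note I = intertwinesD[OF as]
  show "A_op k (Psi N (c # as) v) = Psi N (c # as) (s k \<circ> v)"
  proof (cases "inv v c \<le> 0")
    case True
    then show ?thesis using inv I(1)[OF v] by (simp add: Psi_nonpos A_op_xf_other F_valued_Psi sc)
  next
    case False
    have FS: "F_valued (\<lambda>x. \<Sum>y\<in>marked_covers c v. Psi N as y x)"
      by (intro F_valued_sum F_valued_Psi)
    have "A_op k (Psi N (c # as) v) = (\<lambda>x. A_op k (Psi N as v) x +
        xf N c * (\<Sum>y\<in>marked_covers c v. A_op k (Psi N as y) x))"
      using False by (simp add: Psi_pos A_op_add F_valued_Psi F_valued_scale FS A_op_xf_other sc A_op_sum)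
    also have "\<dots> = (\<lambda>x. Psi N as (s k \<circ> v) x +
        xf N c * (\<Sum>y\<in>marked_covers c v. if up k y then Psi N as (s k \<circ> y) x else 0))"
      by (intro ext arg_cong2[where f = plus] arg_cong2[where f = times] sum.cong refl)
        (use I v marked_covers_W in auto)
    also have "\<dots> = Psi N (c # as) (s k \<circ> v)"
      using False inv c(1) by (simp add: Psi_pos sum_marked_covers_s[OF v] sc)
    finally show ?thesis .
  qed
qed

text \<open>Neither step commutes with A_a by itself, because s_a exchanges the two factors and the
  two positions. Below, f is the sum over the remaining values and g includes the step for
  a.\<close>

lemma intertwines_pair:
  assumes as: "intertwines N a as"
  shows "intertwines N a ((a + 1) # a # as)"
proof (rule intertwinesI)
  let ?b = "a + 1"
  define xa xb where "xa = xf N a" and "xb = xf N ?b"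
  have xF: "xa \<in> F" "xb \<in> F" "xa * xb \<in> F" by (simp_all add: xa_def xb_def F_mult)
  define f where "f = Psi N as"
  define g where "g = Psi N (a # as)"
  note I = intertwinesD[OF as, folded f_def]
  have Ff: "F_valued (f y)" and Fg: "F_valued (g y)" for y
    by (simp_all add: f_def g_def F_valued_Psi)
  note ops = A_op_xf_left[of _ a N, folded xa_def xb_def] A_op_xf_right[of _ a N, folded xa_def xb_def]
    A_op_xf_both[of _ a N, folded xa_def xb_def]
  have g_nonpos: "g y = (\<lambda>x. xa * f y x)" if "inv y a \<le> 0" for y
    using that by (simp add: g_def f_def xa_def Psi_nonpos)
  have g_pos: "g y = (\<lambda>x. f y x + xa * (\<Sum>z\<in>marked_covers a y. f z x))" if "0 < inv y a" for y
    using that by (simp add: g_def f_def xa_def Psi_pos)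
  have s_a: "s a a = ?b" "s a ?b = a" by simp_all
  have sinv: "inv (s a \<circ> y) a = inv y ?b" "inv (s a \<circ> y) ?b = inv y a" if "y \<in> W" for y
    using inv_s_comp[OF that] by simp_all
  \<comment> \<open>With a + 1 already at a nonpositive position, both steps together behave like
    multiplication by the invariant product \<open>xa * xb\<close>, at least after applying
    A_a.\<close>
  have C: "A_op a (\<lambda>x. xb * g y x) = (\<lambda>x. if up a y then xa * xb * f (s a \<circ> y) x else 0)"
    if y: "y \<in> W" "inv y ?b \<le> 0" for y
  proof (cases "inv y a \<le> 0")
    case True
    have eq: "(\<lambda>x. xb * g y x) = (\<lambda>x. xa * xb * f y x)" by (simp add: g_nonpos[OF True] mult_ac)
    show ?thesis unfolding eq ops(3)[OF Ff] using I(2)[OF y(1)] by (simp add: fun_eq_iff)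
  next
    case False
    then have pos: "0 < inv y a" by simp
    then have nup: "\<not> up a y" using y(2) by (simp add: up_def)
    let ?v = "s a \<circ> y"
    have v: "?v \<in> W" "up a ?v" using y nup up_s by simp_all
    have eq: "(\<lambda>x. xb * g y x) = (\<lambda>x. xb * f y x + xa * xb * (\<Sum>z\<in>marked_covers a y. f z x))"
      by (simp add: g_pos[OF pos] distrib_left mult_ac)
    have FS: "F_valued (\<lambda>x. \<Sum>z\<in>marked_covers a y. f z x)" by (intro F_valued_sum Ff)
    \<comment> \<open>Among the covers of y marked a, only \<open>?v\<close> has an ascent at a, and
      A_a sends its term to f y. This cancels the term \<open>- (xa * xb) * f y\<close> from the
      divided difference of xb.\<close>
    have S: "(\<Sum>z\<in>marked_covers a y. A_op a (f z) x) = f y x" for x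
    proof -
      have "(\<Sum>z\<in>marked_covers a y. A_op a (f z) x) =
          (\<Sum>z\<in>marked_covers a (s a \<circ> ?v). if up a z then f (s a \<circ> z) x else 0)"
        by (intro sum.cong) (use I(2) marked_covers_W in auto)
      also have "\<dots> = f y x"
      proof -
        have "(\<Sum>z\<in>marked_covers ?b ?v. if up a z then if up a (s a \<circ> z) then f (s a \<circ> (s a \<circ> z)) x else 0 else 0) = 0"
          by (intro sum.neutral) (use up_s marked_covers_W in auto)
        then show ?thesis
          using sum_marked_covers_s[OF v, of "\<lambda>z. if up a z then f (s a \<circ> z) x else 0" a]
            v(2) sinv[OF y(1)] y(2) pos by simp
      qed
      finally show ?thesis .
    qed
    have "A_op a (\<lambda>x. xb * g y x) = (\<lambda>x. A_op a (\<lambda>x. xb * f y x) x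
        + A_op a (\<lambda>x. xa * xb * (\<Sum>z\<in>marked_covers a y. f z x)) x)"
      unfolding eq using Ff FS xF by (intro A_op_add F_valued_scale)
    also have "\<dots> = (\<lambda>x. 0)"
      unfolding ops(2)[OF Ff] ops(3)[OF FS] A_op_sum[OF Ff] S
      using I(2)[OF y(1)] nup by simp
    finally show ?thesis using nup by simp
  qed
  fix v assume v: "v \<in> W" "up a v"
  let ?w = "s a \<circ> v"
  let ?p = "inv v a" and ?q = "inv v ?b"
  have w: "?w \<in> W" using v by simp
  have pq: "?p < ?q" using v(2) by (simp add: up_def)
  have Av: "A_op a (f v) = f ?w" using I(1)[OF v] .
  have top_nonpos: "Psi N (?b # a # as) y = (\<lambda>x. xb * g y x)" if "inv y ?b \<le> 0" for y
    using that by (simp add: Psi_nonpos g_def xb_def)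
  have top_pos: "Psi N (?b # a # as) y = (\<lambda>x. g y x + (\<Sum>z\<in>marked_covers ?b y. xb * g z x))"
    if "0 < inv y ?b" for y
    using that by (simp add: Psi_pos g_def xb_def sum_distrib_left)
  have FS: "F_valued (\<lambda>x. \<Sum>z\<in>marked_covers c y. f z x)" for c y by (intro F_valued_sum Ff)
  have FSg: "F_valued (\<lambda>x. \<Sum>z\<in>marked_covers c y. xb * g z x)" for c y
    by (intro F_valued_sum F_valued_scale Fg xF)
  have tail: "A_op a (\<lambda>x. \<Sum>z\<in>marked_covers ?b v. xb * g z x) =
      (\<lambda>x. xa * xb * (\<Sum>z\<in>marked_covers ?b v. if up a z then f (s a \<circ> z) x else 0))"
  proof -
    have "A_op a (\<lambda>x. \<Sum>z\<in>marked_covers ?b v. xb * g z x) =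
        (\<lambda>x. \<Sum>z\<in>marked_covers ?b v. A_op a (\<lambda>x. xb * g z x) x)"
      by (intro A_op_sum F_valued_scale Fg xF)
    also have "\<dots> = (\<lambda>x. \<Sum>z\<in>marked_covers ?b v. if up a z then xa * xb * f (s a \<circ> z) x else 0)"
      by (intro ext sum.cong refl) (use C marked_covers_W marked_covers_nonpos in simp)
    finally show ?thesis by (simp add: sum_distrib_left if_distrib[of "\<lambda>y. xa * xb * y"] cong: if_cong)
  qed
  \<comment> \<open>Here p < q are the positions of a and a + 1. In the middle case the divided
    difference of xa supplies the term for the new cover from \<open>?w\<close> to v. In the last
    case it supplies the strips that start at \<open>?w\<close> with markings a + 1, a and end the
    pair at a cover of v.\<close>
  consider "?q \<le> 0" | "?p \<le> 0" "0 < ?q" | "0 < ?p" by linarith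
  then show "A_op a (Psi N (?b # a # as) v) = Psi N (?b # a # as) ?w"
  proof cases
    case 1
    then have "?p \<le> 0" using pq by simp
    then show ?thesis
      using top_nonpos[OF 1] top_nonpos[of ?w] C[OF v(1) 1] v(2) g_nonpos[of ?w] sinv[OF v(1)] 1
      by (simp add: mult_ac)
  next
    case 2
    have "A_op a (Psi N (?b # a # as) v) = (\<lambda>x. A_op a (\<lambda>x. xa * f v x) x
        + A_op a (\<lambda>x. \<Sum>z\<in>marked_covers ?b v. xb * g z x) x)"
      unfolding top_pos[OF 2(2)] g_nonpos[OF 2(1)] by (intro A_op_add F_valued_scale xF Ff FSg)
    also have "\<dots> = (\<lambda>x. xb * (f ?w x + xa * (f v x
        + (\<Sum>z\<in>marked_covers ?b v. if up a z then f (s a \<circ> z) x else 0))))"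
      unfolding tail ops(1)[OF Ff] Av by (simp add: algebra_simps)
    also have "\<dots> = (\<lambda>x. xb * g ?w x)"
      using g_pos[of ?w] sinv[OF v(1)] 2 sum_marked_covers_s[OF v, of "\<lambda>z. f z x" a for x] s_a by simp
    also have "\<dots> = Psi N (?b # a # as) ?w" using top_nonpos[of ?w] sinv[OF v(1)] 2 by simp
    finally show ?thesis .
  next
    case 3
    then have q: "0 < ?q" using pq by simp
    \<comment> \<open>The cover moves a + 1 to a nonpositive position while a stays at a positive
      one.\<close>
    have nupb: "\<not> up a z" if "z \<in> marked_covers ?b v" for z
      using marked_covers_keep_pos[OF that 3] marked_covers_nonpos[OF that] 3 by (simp add: up_def)
    have tail0: "(\<Sum>z\<in>marked_covers ?b v. if up a z then h z else 0) = (0 :: mfrac)" for h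
      using nupb by (intro sum.neutral) auto
    have pos_a: "inv z a \<le> 0" "0 < inv z ?b" if "z \<in> marked_covers a v" for z
      using marked_covers_keep_pos[OF that q] marked_covers_nonpos[OF that] q by simp_all
    have upa: "up a z" if "z \<in> marked_covers a v" for z
      using pos_a[OF that] by (simp add: up_def)
    have "A_op a (Psi N (?b # a # as) v) = (\<lambda>x. A_op a (f v) x
        + A_op a (\<lambda>x. xa * (\<Sum>z\<in>marked_covers a v. f z x)) x
        + A_op a (\<lambda>x. \<Sum>z\<in>marked_covers ?b v. xb * g z x) x)"
    proof -
      have "F_valued (\<lambda>x. xa * (\<Sum>z\<in>marked_covers a v. f z x))" by (intro F_valued_scale xF FS)
      then have *: "A_op a (g v) = (\<lambda>x. A_op a (f v) x + A_op a (\<lambda>x. xa * (\<Sum>z\<in>marked_covers a v. f z x)) x)"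
        unfolding g_pos[OF 3] by (intro A_op_add Ff)
      show ?thesis unfolding top_pos[OF q] A_op_add[OF Fg FSg] * ..
    qed
    also have "\<dots> = (\<lambda>x. f ?w x + xb * (\<Sum>z\<in>marked_covers a v. f (s a \<circ> z) x + xa * f z x))"
    proof -
      have "(\<Sum>z\<in>marked_covers a v. A_op a (f z) x) = (\<Sum>z\<in>marked_covers a v. f (s a \<circ> z) x)" for x
        by (intro sum.cong) (use I(2) marked_covers_W upa in auto)
      then show ?thesis
        unfolding tail tail0 ops(1)[OF FS] A_op_sum[OF Ff] Av
        by (simp add: sum.distrib sum_distrib_left algebra_simps)
    qed
    also have "\<dots> = (\<lambda>x. g ?w x + (\<Sum>z\<in>marked_covers ?b ?w. xb * g z x))"
    proof
      fix x
      have gw: "g ?w x = f ?w x"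
      proof -
        have "(\<Sum>z\<in>marked_covers a ?w. f z x) = 0"
          using sum_marked_covers_s[OF v, of "\<lambda>z. f z x" a] 3 tail0 s_a by simp
        then show ?thesis using g_pos[of ?w] sinv[OF v(1)] q by simp
      qed
      \<comment> \<open>The covers of s_a z marked a are z itself and images of covers of z marked a
        + 1 with an ascent at a. The latter do not exist by
        \<open>two_covers_not_up\<close>.\<close>
      have gs: "g (s a \<circ> z) x = f (s a \<circ> z) x + xa * f z x" if z: "z \<in> marked_covers a v" for z
      proof -
        have zW: "z \<in> W" using marked_covers_W[OF z] .
        have "(\<Sum>y\<in>marked_covers ?b z. if up a y then f (s a \<circ> y) x else 0) = 0"
          using two_covers_not_up[OF 3 pq z] by (intro sum.neutral) auto
        then have "(\<Sum>y\<in>marked_covers a (s a \<circ> z). f y x) = f z x"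
          using sum_marked_covers_s[OF zW upa[OF z], of "\<lambda>z. f z x" a] pos_a[OF z] s_a by simp
        then show ?thesis using g_pos[of "s a \<circ> z"] sinv[OF zW] pos_a[OF z] by simp
      qed
      have nd: "\<not> int n dvd ?b - a" by simp
      have "(\<Sum>z\<in>marked_covers ?b ?w. xb * g z x) =
          (\<Sum>z\<in>marked_covers a v. if up a z then xb * g (s a \<circ> z) x else 0)"
        using sum_marked_covers_s[OF v, of "\<lambda>z. xb * g z x" ?b] nd s_a by simp
      also have "\<dots> = (\<Sum>z\<in>marked_covers a v. xb * (f (s a \<circ> z) x + xa * f z x))"
        by (intro sum.cong refl) (simp add: upa gs)
      finally show "f ?w x + xb * (\<Sum>z\<in>marked_covers a v. f (s a \<circ> z) x + xa * f z x) =
          g ?w x + (\<Sum>z\<in>marked_covers ?b ?w. xb * g z x)"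
        using gw by (simp add: sum_distrib_left)
    qed
    also have "\<dots> = Psi N (?b # a # as) ?w" using top_pos[of ?w] sinv[OF v(1)] 3 by simp
    finally show ?thesis .
  qed
qed

lemma intertwines_Nil: "intertwines N k []"
  by (simp add: intertwines_def A_op_A_fun)

definition values_down :: "int \<Rightarrow> int \<Rightarrow> int list" where
  "values_down lo hi = rev [lo + 1..hi]"

lemma values_down_Nil [simp]: "hi \<le> lo \<Longrightarrow> values_down lo hi = []"
  by (simp add: values_down_def)

lemma values_down_Cons: "lo < hi \<Longrightarrow> values_down lo hi = hi # values_down lo (hi - 1)"
  by (simp add: values_down_def upto_rec2)

text \<open>Values congruent to k + 1 and k must be processed as neighbours. The two hypotheses say
  that no cut separates such a pair: a top value congruent to k would lack its upper partner, and
  \<open>lo\<close> congruent to k would leave \<open>lo + 1\<close> without its lower one.\<close>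

lemma intertwines_values_down:
  assumes "\<not> int n dvd lo - k" "\<not> int n dvd hi - k"
  shows "intertwines N k (values_down lo hi)"
  using assms(2)
proof (induction "nat (hi - lo)" arbitrary: hi rule: less_induct)
  case less
  show ?case
  proof (cases "hi \<le> lo")
    case True
    then show ?thesis by (simp add: intertwines_Nil)
  next
    case False
    then have eq: "values_down lo hi = hi # values_down lo (hi - 1)" by (simp add: values_down_Cons)
    show ?thesis
    proof (cases "int n dvd hi - (k + 1)")
      case False
      have "\<not> int n dvd hi - 1 - k" using False by (simp add: algebra_simps)
      then have "intertwines N k (values_down lo (hi - 1))"
        using less.hyps[of "hi - 1"] \<open>\<not> hi \<le> lo\<close> by simp
      then show ?thesis unfolding eq using False less.prems by (intro intertwines_other)
    next
      case True
      then have d: "int n dvd hi - 1 - k" by (simp add: algebra_simps)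
      then have "hi - 1 \<noteq> lo" using assms(1) by auto
      then have lt: "lo < hi - 1" using \<open>\<not> hi \<le> lo\<close> by simp
      have "\<not> int n dvd hi - 2 - k"
      proof
        assume "int n dvd hi - 2 - k"
        with d have "int n dvd (hi - 1 - k) - (hi - 2 - k)" by (rule dvd_diff)
        then show False by simp
      qed
      then have "intertwines N k (values_down lo (hi - 2))"
        using less.hyps[of "hi - 2"] lt by simp
      then have "intertwines N (hi - 1) (values_down lo (hi - 2))"
        using intertwines_cong[OF d] by simp
      from intertwines_pair[OF this] have "intertwines N k (hi # (hi - 1) # values_down lo (hi - 2))"
        using intertwines_cong[OF d] by simp
      moreover have "values_down lo hi = hi # (hi - 1) # values_down lo (hi - 2)"
        unfolding eq using lt by (simp add: values_down_Cons[of lo "hi - 1"])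
      ultimately show ?thesis by simp
    qed
  qed
qed

lemma act_prod:
  assumes "w \<in> W" "\<And>a. a \<in> A \<Longrightarrow> f a \<in> F"
  shows "act w (prod f A) = (\<Prod>a\<in>A. act w (f a))"
  using assms(2)
proof (induction A rule: infinite_finite_induct)
  case (insert x A)
  then show ?case using act_mult[OF assms(1), of "f x" "prod f A"] F_prod[of A f] by simp
qed (use assms(1) in simp_all)

lemma inv_bound: "w \<in> W \<Longrightarrow> \<bar>inv w y - y\<bar> \<le> int (len w)"
  using len_bound[of w "inv w y"] by (simp add: W_f_inv abs_minus_commute)

section \<open>The automorphism attached to the Pieri classes\<close>

definition low :: "int \<Rightarrow> perm \<Rightarrow> int set" where
  "low lo x = {y. lo < y \<and> inv x y \<le> 0}"

lemma finite_low: "x \<in> W \<Longrightarrow> finite (low lo x)"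
proof (rule finite_subset)
  assume x: "x \<in> W"
  show "low lo x \<subseteq> {lo..int (len x)}"
  proof
    fix y assume "y \<in> low lo x"
    then have "lo < y" "inv x y \<le> 0" by (simp_all add: low_def)
    then have "lo \<le> y" "y \<le> int (len x)" using inv_bound[OF x, of y] by linarith+
    then show "y \<in> {lo..int (len x)}" by simp
  qed
qed simp

lemma s_gt_iff:
  assumes "\<not> int n dvd m - k"
  shows "m < s k y \<longleftrightarrow> m < y"
proof (rule s_cases[of y k])
  fix l assume l: "y = k + int n * l" "s k y = k + 1 + int n * l"
  have "m \<noteq> y" using assms l by auto
  then show ?thesis using l by auto
next
  fix l assume l: "y = k + 1 + int n * l" "s k y = k + int n * l"
  have "m \<noteq> s k y" using assms l by auto
  then show ?thesis using l by auto
qed simp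

lemma s_le_iff:
  assumes "\<not> int n dvd m - k"
  shows "s k y \<le> m \<longleftrightarrow> y \<le> m"
  using s_gt_iff[OF assms, of y] by linarith

lemma low_s:
  assumes "x \<in> W" "\<not> int n dvd lo - k"
  shows "low lo (s k \<circ> x) = s k ` low lo x"
proof (intro equalityI subsetI)
  fix y assume "y \<in> low lo (s k \<circ> x)"
  then have "s k y \<in> low lo x" using s_gt_iff[OF assms(2), of y] by (simp add: low_def inv_s_comp[OF assms(1)])
  then show "y \<in> s k ` low lo x" by (metis image_eqI s_invol)
next
  fix y assume "y \<in> s k ` low lo x"
  then obtain z where "y = s k z" "z \<in> low lo x" by blast
  then show "y \<in> low lo (s k \<circ> x)" using s_gt_iff[OF assms(2), of z]
    by (simp add: low_def inv_s_comp[OF assms(1)])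
qed

lemma low_shift:
  assumes "x \<in> W" "lo \<le> - int (len x)"
  shows "low (lo - 1) x = insert lo (low lo x)"
  using inv_bound[OF assms(1), of lo] assms(2) by (auto simp: low_def)

definition Q :: "int \<Rightarrow> int \<Rightarrow> perm \<Rightarrow> mfrac" where
  "Q N lo x = (\<Prod>y\<in>low lo x. of_int N - e y)"

lemma Q_nonzero: "Q N lo x \<noteq> 0"
  by (cases "finite (low lo x)") (simp_all add: Q_def of_int_ne_e)

lemma Q_F: "Q N lo x \<in> F"
  unfolding Q_def by (intro F_prod F_diff F_of_int e_F)

lemma act_Q:
  assumes "x \<in> W" "\<not> int n dvd lo - k"
  shows "act (s k) (Q N lo x) = Q N lo (s k \<circ> x)"
proof -
  have "inj_on (s k) (low lo x)" using W_inj[OF s_W] by (rule inj_on_subset) simp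
  then show ?thesis
    unfolding Q_def low_s[OF assms]
    by (simp add: act_prod F_diff F_of_int act_diff act_of_int act_e prod.reindex)
qed

lemma Q_shift:
  assumes "x \<in> W" "lo \<le> - int (len x)"
  shows "Q N (lo - 1) x = (of_int N - e lo) * Q N lo x"
  unfolding Q_def low_shift[OF assms] using finite_low[OF assms(1)] by (subst prod.insert) (auto simp: low_def)

text \<open>By \<open>act_Q\<close>, s_k carries the factor at s_k x to the factor at x, so both
  terms of A_k acquire the same denominator.\<close>

lemma A_op_divide_Q:
  assumes f: "F_valued f" "\<And>x. f x \<noteq> 0 \<Longrightarrow> x \<in> W" and lo: "\<not> int n dvd lo - k"
  shows "A_op k (\<lambda>x. f x / Q N lo x) = (\<lambda>x. A_op k f x / Q N lo x)"
proof
  fix x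
  show "A_op k (\<lambda>x. f x / Q N lo x) x = A_op k f x / Q N lo x"
  proof (cases "x \<in> W")
    case True
    have "act (s k) (Q N lo (s k \<circ> x)) = Q N lo x"
      using act_Q[OF s_W_comp[OF True] lo] by simp
    then show ?thesis
      using f(1) Q_nonzero by (simp add: A_op_def s_op_def act_divide F_valuedD Q_F divide_simps)
  next
    case False
    then have "f x = 0" "f (s k \<circ> x) = 0" using f(2) s_comp_W_iff by blast+
    then show ?thesis by (simp add: A_op_def s_op_def)
  qed
qed

lemma F_valued_divide_Q: "F_valued f \<Longrightarrow> F_valued (\<lambda>x. f x / Q N lo x)"
  by (simp add: F_valued_def F_divide Q_F)

section \<open>Dependence of strip sums on the range of values\<close>

lemma marked_covers_id: "marked_covers a id = {}"
  by (auto elim!: marked_coversE)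

lemma strip_sum_id:
  assumes "lo \<le> 0" "lo \<le> hi"
  shows "strip_sum N (values_down lo hi) \<phi> id = (\<Prod>y\<in>{lo<..min hi 0}. xf N y) * \<phi> id"
  using assms(2)
proof (induction hi rule: int_ge_induct)
  case base
  then show ?case using assms(1) by simp
next
  case (step i)
  have eq: "values_down lo (i + 1) = (i + 1) # values_down lo i"
    using step.hyps by (subst values_down_Cons) simp_all
  show ?case
  proof (cases "i + 1 \<le> 0")
    case True
    then have "{lo<..min (i + 1) 0} = insert (i + 1) {lo<..min i 0}" using step.hyps by auto
    then show ?thesis using True step.IH by (simp add: eq mult.assoc)
  next
    case False
    then have m: "min (i + 1) 0 = min i 0" by simp
    have "\<not> inv id (i + 1) \<le> 0" using False by simp
    then show ?thesis
      unfolding eq strip_sum.simps marked_covers_id m by (simp only: step.IH if_False sum.empty mult_zero_right add_0_right)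
  qed
qed

text \<open>A marking needs a larger value at a nonpositive position, which is impossible beyond
  \<open>len w\<close>; the step for such a value changes nothing.\<close>

lemma strip_sum_top:
  assumes "w \<in> W" "int (len w) \<le> hi" "lo \<le> hi"
  shows "strip_sum N (values_down lo (hi + 1)) \<phi> w = strip_sum N (values_down lo hi) \<phi> w"
proof -
  have eq: "values_down lo (hi + 1) = (hi + 1) # values_down lo hi"
    using assms(3) by (subst values_down_Cons) simp_all
  have "0 < inv w (hi + 1)" using inv_bound[OF assms(1), of "hi + 1"] assms(2) by linarith
  moreover have "marked_covers (hi + 1) w = {}"
  proof (rule ccontr)
    assume "marked_covers (hi + 1) w \<noteq> {}"
    then obtain i where "i \<le> 0" "hi + 1 < w i" by (auto elim!: marked_coversE)
    then show False using len_bound[OF assms(1), of i] assms(2) by linarith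
  qed
  ultimately show ?thesis by (simp add: eq)
qed

lemma strip_sum_snoc:
  assumes "\<And>c. c \<le> lo \<Longrightarrow> inv w c \<le> 0"
  shows "strip_sum N (as @ [lo]) \<phi> w = xf N lo * strip_sum N as \<phi> w"
  using assms
proof (induction as arbitrary: w)
  case (Cons a as)
  have "strip_sum N (as @ [lo]) \<phi> y = xf N lo * strip_sum N as \<phi> y" if "y \<in> marked_covers a w" for y
    using Cons.IH[of y] marked_covers_low[OF that Cons.prems] by blast
  then show ?case using Cons.IH[OF Cons.prems] by (simp add: distrib_left sum_distrib_left mult_ac)
qed simp

lemma values_down_snoc: "lo \<le> hi \<Longrightarrow> values_down (lo - 1) hi = values_down lo hi @ [lo]"
  by (simp add: values_down_def upto_rec1)

text \<open>Values this low are at nonpositive positions and stay there along every strip, so the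
  last step only multiplies by its factor.\<close>

lemma strip_sum_bottom:
  assumes "w \<in> W" "lo \<le> - int (len w)" "lo \<le> hi"
  shows "strip_sum N (values_down (lo - 1) hi) \<phi> w = xf N lo * strip_sum N (values_down lo hi) \<phi> w"
  unfolding values_down_snoc[OF assms(3)]
proof (rule strip_sum_snoc)
  fix c assume "c \<le> lo"
  then show "inv w c \<le> 0" using inv_bound[OF assms(1), of c] assms(2) by linarith
qed

lemma A_fun_len: "w \<in> W \<Longrightarrow> A_fun w x \<noteq> 0 \<Longrightarrow> x \<in> W \<and> len x \<le> len w"
  using A_fun_support(1)[of w x] by auto

lemma A_fun_Q_shift:
  assumes "w \<in> W" "lo \<le> - int (len w)"
  shows "A_fun w x / Q N (lo - 1) x = xf N lo * (A_fun w x / Q N lo x)"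
proof (cases "A_fun w x = 0")
  case False
  then have "x \<in> W" "lo \<le> - int (len x)" using A_fun_len[OF assms(1) False] assms(2) by auto
  then show ?thesis by (simp add: Q_shift xf_def)
qed simp

text \<open>Of two consecutive cuts at least one is admissible for k. It is used for the lower cut
  and, with \<open>lo\<close> instantiated by \<open>hi + 1\<close>, for the upper one.\<close>

lemma avoid_residue:
  obtains "\<not> int n dvd lo - k" | "\<not> int n dvd lo - 1 - k"
proof -
  have "\<not> (int n dvd lo - k \<and> int n dvd lo - 1 - k)"
  proof
    assume "int n dvd lo - k \<and> int n dvd lo - 1 - k"
    then have "int n dvd (lo - k) - (lo - 1 - k)" by (blast intro: dvd_diff)
    then show False by simp
  qed
  then show thesis using that by blast
qed

text \<open>Both sides satisfy the recursion under A_k when the cuts avoid the class of k. If they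
  do not, raising the upper cut changes neither side, and lowering the lower cut multiplies both by
  the nonzero \<open>xf N lo\<close>.\<close>

lemma A_fun_divide_Q:
  assumes "w \<in> W" "lo \<le> - int (len w)" "int (len w) \<le> hi"
  shows "A_fun w x / Q N lo x = Psi N (values_down lo hi) w x"
  using assms
proof (induction "len w" arbitrary: w lo hi x rule: less_induct)
  case less
  note w = less.prems(1)
  show ?case
  proof (cases "w = id")
    case True
    have lo: "lo \<le> 0" "0 \<le> hi" using less.prems True by auto
    have "low lo id = {lo<..0}" by (auto simp: low_def)
    then have "1 / Q N lo id = (\<Prod>y\<in>{lo<..min hi 0}. xf N y)"
      using lo by (simp add: Q_def xf_def prod_dividef)
    moreover have "Psi N (values_down lo hi) id x = (\<Prod>y\<in>{lo<..min hi 0}. xf N y) * unit_fn x"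
      using strip_sum_id[of lo hi] lo by (simp add: Psi_def A_fun_id)
    ultimately show ?thesis using True by (auto simp: A_fun_id unit_fn_def)
  next
    case False
    then obtain k where k: "\<not> up k w" using descent_exists[OF w] by blast
    let ?v = "s k \<circ> w"
    have v: "?v \<in> W" "up k ?v" and lv: "len w = len ?v + 1"
      using w k up_s[OF w] down_len[OF w k] by simp_all
    have good: "A_fun w y / Q N lo' y = Psi N (values_down lo' hi') w y"
      if h: "lo' \<le> lo" "hi \<le> hi'" "\<not> int n dvd lo' - k" "\<not> int n dvd hi' - k" for lo' hi' y
    proof -
      have IH: "(\<lambda>x. A_fun ?v x / Q N lo' x) = Psi N (values_down lo' hi') ?v"
        by (rule ext, rule less.hyps) (use v lv h less.prems in simp_all)
      have "A_fun w = A_op k (A_fun ?v)" using A_op_A_fun[OF v(1), of k] v(2) by simp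
      then have "A_fun w y / Q N lo' y = A_op k (\<lambda>x. A_fun ?v x / Q N lo' x) y"
        using A_op_divide_Q[OF F_valued_A_fun _ h(3), of ?v N] A_fun_len[OF v(1)] by simp
      also have "\<dots> = Psi N (values_down lo' hi') w y"
        unfolding IH using intertwinesD(1)[OF intertwines_values_down[OF h(3,4)] v] by simp
      finally show ?thesis .
    qed
    have top: "A_fun w y / Q N lo' y = Psi N (values_down lo' hi) w y"
      if lo': "lo' \<le> lo" "\<not> int n dvd lo' - k" for lo' y
    proof (rule avoid_residue[of "hi + 1" k])
      assume "\<not> int n dvd hi + 1 - 1 - k"
      then show ?thesis using good[OF lo'(1) _ lo'(2), of hi] by simp
    next
      assume a: "\<not> int n dvd hi + 1 - k"
      have "lo' \<le> hi" using less.prems lo' by linarith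
      then show ?thesis using good[OF lo'(1) _ lo'(2) a, of y] strip_sum_top[OF w less.prems(3)]
        by (simp add: Psi_def)
    qed
    show ?thesis
    proof (rule avoid_residue[of lo k])
      assume "\<not> int n dvd lo - k"
      then show ?thesis using top by simp
    next
      assume a: "\<not> int n dvd lo - 1 - k"
      have "lo \<le> hi" using less.prems by linarith
      then have "xf N lo * (A_fun w x / Q N lo x) = xf N lo * Psi N (values_down lo hi) w x"
        using top[OF _ a, of x] strip_sum_bottom[OF w less.prems(2)] A_fun_Q_shift[OF w less.prems(2)]
        by (simp add: Psi_def)
      then show ?thesis by (simp only: mult_left_cancel[OF xf_nonzero])
    qed
  qed
qed

text \<open>A finite index set that contains the supports of all A_w with
  \<open>len w \<le> l\<close>, used instead of Bruhat intervals.\<close>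

definition len_ball :: "nat \<Rightarrow> perm set" where
  "len_ball l = {x \<in> W. len x \<le> l}"

lemma finite_len_ball [simp]: "finite (len_ball l)"
  unfolding len_ball_def by (rule finite_len_le)

text \<open>Strip sums are linear in the final weight, so inserting the indicator of u extracts the
  coefficient of A_u.\<close>

lemma strip_sum_expand:
  assumes "w \<in> W" "len w \<le> l"
  shows "strip_sum N as \<phi> w = (\<Sum>u\<in>len_ball l. strip_sum N as (\<lambda>v. of_bool (v = u)) w * \<phi> u)"
  using assms
proof (induction as arbitrary: w)
  case Nil
  then have "w \<in> len_ball l" by (simp add: len_ball_def)
  have "(\<Sum>u\<in>len_ball l. of_bool (w = u) * \<phi> u) = (\<Sum>u\<in>{w}. of_bool (w = u) * \<phi> u)"
    using \<open>w \<in> len_ball l\<close> by (intro sum.mono_neutral_right) auto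
  then show ?case by simp
next
  case (Cons a as)
  have IH: "strip_sum N as \<phi> y = (\<Sum>u\<in>len_ball l. strip_sum N as (\<lambda>v. of_bool (v = u)) y * \<phi> u)"
    if "y \<in> marked_covers a w" for y
    using Cons.IH[of y] marked_covers_W[OF that] marked_covers_len[OF that] Cons.prems by simp
  have "(\<Sum>y\<in>marked_covers a w. strip_sum N as \<phi> y) =
      (\<Sum>u\<in>len_ball l. \<Sum>y\<in>marked_covers a w. strip_sum N as (\<lambda>v. of_bool (v = u)) y * \<phi> u)"
    by (subst sum.swap) (intro sum.cong refl IH)
  then show ?case using Cons.IH[OF Cons.prems]
    by (simp add: sum_distrib_left sum_distrib_right distrib_left distrib_right sum.distrib mult_ac)
qed

text \<open>The image of A_v under the left F-linear functional with value 1 at every group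
  element.\<close>

definition total :: "int \<Rightarrow> int \<Rightarrow> perm \<Rightarrow> mfrac" where
  "total N lo v = (\<Sum>x\<in>len_ball (len v). A_fun v x / Q N lo x)"

lemma total_superset:
  assumes "v \<in> W" "finite X" "len_ball (len v) \<subseteq> X"
  shows "total N lo v = (\<Sum>x\<in>X. A_fun v x / Q N lo x)"
  unfolding total_def using assms A_fun_len[OF assms(1)]
  by (intro sum.mono_neutral_left) (auto simp: len_ball_def)

lemma total_shift:
  assumes "v \<in> W" "lo \<le> - int (len v)"
  shows "total N (lo - 1) v = xf N lo * total N lo v"
  unfolding total_def A_fun_Q_shift[OF assms] by (simp add: sum_distrib_left)

text \<open>The functional turns left multiplication by A_k into the divided difference operator on
  F.\<close>

lemma total_s:
  assumes v: "v \<in> W" "up k v" and lo: "\<not> int n dvd lo - k"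
  shows "total N lo (s k \<circ> v) = (total N lo v - act (s k) (total N lo v)) / root k"
proof -
  define B where "B = len_ball (len v + 1)"
  define L :: "perm \<Rightarrow> perm" where "L = (\<lambda>x. s k \<circ> x)"
  have LL: "L (L x) = x" for x unfolding L_def by (rule s_s_comp)
  \<comment> \<open>A finite set stable under left multiplication by s_k, so that the sum of the
    s_k-translate can be reindexed.\<close>
  define X where "X = B \<union> L ` B"
  let ?g = "\<lambda>x. A_fun v x / Q N lo x"
  have fB: "finite B" unfolding B_def by (rule finite_len_ball)
  have lB: "len_ball (len v) \<subseteq> B" "len_ball (len (s k \<circ> v)) \<subseteq> B"
    using up_len[OF v] by (auto simp: B_def len_ball_def)
  have X: "finite X" "len_ball (len v) \<subseteq> X" "len_ball (len (s k \<circ> v)) \<subseteq> X"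
    unfolding X_def using fB lB by (blast intro: finite_imageI)+
  have LX: "L ` X = X"
    unfolding X_def image_Un image_image LL by auto
  have inj: "inj_on L X" by (rule inj_on_inverseI[of _ L]) (rule LL)
  have g: "?g x \<in> F" for x by (rule F_valuedD[OF F_valued_divide_Q[OF F_valued_A_fun]])
  have "(\<Sum>x\<in>X. s_op k ?g x) = (\<Sum>x\<in>X. act (s k) (?g (L x)))"
    by (simp only: s_op_def L_def)
  also have "\<dots> = (\<Sum>x\<in>L ` X. act (s k) (?g x))"
    by (simp only: sum.reindex[OF inj] o_def)
  also have "\<dots> = act (s k) (total N lo v)"
    unfolding LX total_superset[OF v(1) X(1,2)] using g by (intro act_sum[symmetric] s_W)
  finally have sum2: "(\<Sum>x\<in>X. s_op k ?g x) = act (s k) (total N lo v)" .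
  have "A_fun (s k \<circ> v) = A_op k (A_fun v)" using A_op_A_fun[OF v(1)] v(2) by simp
  then have "(\<lambda>x. A_fun (s k \<circ> v) x / Q N lo x) = A_op k ?g"
    using A_op_divide_Q[OF F_valued_A_fun _ lo, of v N] A_fun_len[OF v(1)] by simp
  then have "total N lo (s k \<circ> v) = (\<Sum>x\<in>X. A_op k ?g x)"
    using total_superset[OF s_W_comp[OF v(1)] X(1,3)] by metis
  also have "\<dots> = ((\<Sum>x\<in>X. ?g x) - (\<Sum>x\<in>X. s_op k ?g x)) / root k"
    by (simp add: A_op_def sum_subtractf flip: sum_divide_distrib)
  finally show ?thesis unfolding sum2 total_superset[OF v(1) X(1,2)] .
qed

definition xprod :: "int \<Rightarrow> int \<Rightarrow> int \<Rightarrow> mfrac" where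
  "xprod N lo m = (\<Prod>y\<in>{lo<..m}. xf N y)"

lemma xprod_F: "xprod N lo m \<in> F" unfolding xprod_def by (intro F_prod xf_F)

lemma xprod_Suc: "lo \<le> m \<Longrightarrow> xprod N lo (m + 1) = xf N (m + 1) * xprod N lo m"
proof -
  assume "lo \<le> m"
  then have "{lo<..m + 1} = insert (m + 1) {lo<..m}" by auto
  then show ?thesis by (simp add: xprod_def)
qed

lemma xprod_low: "lo \<le> m \<Longrightarrow> xprod N (lo - 1) m = xf N lo * xprod N lo m"
proof -
  assume "lo \<le> m"
  then have "{lo - 1<..m} = insert lo {lo<..m}" by auto
  then show ?thesis by (simp add: xprod_def)
qed

lemma act_xprod:
  assumes "\<not> int n dvd lo - k" "\<not> int n dvd m - k"
  shows "act (s k) (xprod N lo m) = xprod N lo m"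
proof -
  have "act (s k) (xprod N lo m) = (\<Prod>y\<in>{lo<..m}. xf N (s k y))"
    by (simp add: xprod_def act_prod act_xf)
  also have "\<dots> = xprod N lo m"
    unfolding xprod_def
    by (rule prod.reindex_bij_witness[of _ "s k" "s k"])
      (simp_all add: s_gt_iff[OF assms(1)] s_le_iff[OF assms(2)])
  finally show ?thesis .
qed

text \<open>s_m replaces the top factor m by m + 1 and permutes the others, so the divided
  difference lengthens the product by one factor.\<close>

lemma xprod_step:
  assumes "\<not> int n dvd lo - m" "lo \<le> m"
  shows "(xprod N lo m - act (s m) (xprod N lo m)) / root m = xprod N lo (m + 1)"
proof -
  have "lo \<noteq> m" using assms(1) by auto
  then have lt: "lo \<le> m - 1" using assms(2) by simp
  have eq: "xprod N lo m = xf N m * xprod N lo (m - 1)" using xprod_Suc[OF lt] by simp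
  have "\<not> int n dvd m - 1 - m" by simp
  then have "act (s m) (xprod N lo m) = xf N (m + 1) * xprod N lo (m - 1)"
    unfolding eq using act_xprod[OF assms(1)] by (simp add: act_mult xprod_F act_xf)
  then have "(xprod N lo m - act (s m) (xprod N lo m)) / root m
      = (xf N m - xf N (m + 1)) / root m * xprod N lo (m - 1)"
    unfolding eq by (simp add: left_diff_distrib)
  also have "\<dots> = xf N (m + 1) * xprod N lo m"
    unfolding xf_divided_difference eq by simp
  also have "\<dots> = xprod N lo (m + 1)" using xprod_Suc[OF assms(2)] by simp
  finally show ?thesis .
qed

lemma pieri_0: "pieri n 0 = id" by (simp add: pieri_def)

lemma pieri_Suc: "pieri n (Suc h) = s (int h) \<circ> pieri n h"
  using s_cong[OF mod_letter(2)[of "int h"]] by (simp add: pieri_def)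

lemma pieri_W: "pieri n h \<in> W" by (simp add: pieri_def)

lemma inv_pieri_Suc: "inv (pieri n (Suc h)) y = inv (pieri n h) (s (int h) y)"
  unfolding pieri_Suc inv_s_comp[OF pieri_W] by simp

lemma pieri_inv: "int h < y \<Longrightarrow> 0 < inv (pieri n h) y"
proof (induction h arbitrary: y)
  case 0
  then show ?case by (simp add: pieri_0)
next
  case (Suc h)
  have "int h < s (int h) y"
  proof (rule s_cases[of y "int h"])
    fix m assume "y = int h + int n * m" "s (int h) y = int h + 1 + int n * m"
    then show ?thesis using Suc.prems by simp
  next
    fix m assume m: "y = int h + 1 + int n * m" "s (int h) y = int h + int n * m"
    then show ?thesis using Suc.prems by simp
  qed (use Suc.prems in simp)
  then show ?case using Suc.IH by (simp add: inv_pieri_Suc)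
qed

lemma pieri_inv_self: "inv (pieri n h) (int h) = 0"
proof (induction h)
  case (Suc h)
  have "s (int h) (1 + int h) = int h" using s_right[of "int h"] by (simp add: add.commute)
  then show ?case using Suc by (simp add: inv_pieri_Suc)
qed (simp add: pieri_0)

lemma up_pieri: "up (int h) (pieri n h)"
  using pieri_inv[of h "int h + 1"] by (simp add: up_def pieri_inv_self)

lemma len_pieri: "len (pieri n h) = h"
proof (induction h)
  case (Suc h)
  then show ?case using up_len[OF pieri_W up_pieri, of h] unfolding pieri_Suc by linarith
qed (simp only: pieri_0 len_id)

text \<open>At the identity the value is \<open>xprod N lo 0\<close>. On the product up to h a
  divided difference vanishes unless its index is congruent to h, in which case the product grows to
  h + 1; the only words that survive are those of the Pieri elements.\<close>

lemma total_pieri: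
  assumes "v \<in> W" "lo \<le> - int (len v)"
  shows "total N lo v = (if v = pieri n (len v) then xprod N lo (int (len v)) else 0)"
  using assms
proof (induction "len v" arbitrary: v lo rule: less_induct)
  case less
  note v = less.prems(1)
  show ?case
  proof (cases "v = id")
    case True
    have "len_ball 0 = {id}" using len_eq_0 by (auto simp: len_ball_def)
    moreover have "low lo id = {lo<..0}" by (auto simp: low_def)
    ultimately show ?thesis using True
      by (simp add: total_def pieri_0 xprod_def A_fun_id unit_fn_def Q_def xf_def prod_dividef)
  next
    case False
    then have l0: "len v > 0" using len_eq_0[OF v] by simp
    have goodlo: ?thesis if "\<And>lo'. lo' \<le> lo \<Longrightarrow> \<not> int n dvd lo' - k \<Longrightarrow>
      total N lo' v = (if v = pieri n (len v) then xprod N lo' (int (len v)) else 0)" for k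
    proof (rule avoid_residue[of lo k])
      assume "\<not> int n dvd lo - k" then show ?thesis using that by simp
    next
      assume a: "\<not> int n dvd lo - 1 - k"
      have "xf N lo * total N lo v = xf N lo * (if v = pieri n (len v) then xprod N lo (int (len v)) else 0)"
        using that[OF _ a] total_shift[OF v less.prems(2)] xprod_low[of lo "int (len v)" N] less.prems(2)
        by simp
      then show ?thesis by (simp only: mult_left_cancel[OF xf_nonzero])
    qed
    show ?thesis
    proof (cases "v = pieri n (len v)")
      case True
      define h where "h = len v - 1"
      have lv: "len v = Suc h" using l0 by (simp add: h_def)
      then have vs: "v = s (int h) \<circ> pieri n h" using True pieri_Suc by simp
      show ?thesis
      proof (rule goodlo[of "int h"])
        fix lo' assume lo': "lo' \<le> lo" "\<not> int n dvd lo' - int h"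
        have le: "lo' \<le> - int h" "lo' \<le> int h" using lo' less.prems(2) lv by simp_all
        have "total N lo' (pieri n h) = xprod N lo' (int h)"
          using less.hyps[of "pieri n h" lo'] pieri_W len_pieri lv le by simp
        then have "total N lo' v = xprod N lo' (int h + 1)"
          unfolding vs using total_s[OF pieri_W up_pieri lo'(2)] xprod_step[OF lo'(2) le(2)] by simp
        then show "total N lo' v = (if v = pieri n (len v) then xprod N lo' (int (len v)) else 0)"
          using True lv by (simp add: add.commute)
      qed
    next
      case notp: False
      obtain k where k: "\<not> up k v" using descent_exists[OF v False] by blast
      let ?v = "s k \<circ> v"
      have sv: "?v \<in> W" "up k ?v" "len v = len ?v + 1" using v k up_s[OF v] down_len[OF v k] by simp_all
      show ?thesis
      proof (rule goodlo[of k])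
        fix lo' assume lo': "lo' \<le> lo" "\<not> int n dvd lo' - k"
        have le: "lo' \<le> - int (len ?v)" using lo' less.prems(2) sv(3) by simp
        have IH: "total N lo' ?v = (if ?v = pieri n (len ?v) then xprod N lo' (int (len ?v)) else 0)"
          using less.hyps[OF _ sv(1) le] sv(3) by simp
        have tv: "total N lo' v = (total N lo' ?v - act (s k) (total N lo' ?v)) / root k"
          using total_s[OF sv(1,2) lo'(2), of N] by simp
        have "total N lo' v = 0"
        proof (cases "?v = pieri n (len ?v)")
          case True
          \<comment> \<open>Otherwise v would be the next Pieri element. So the product is invariant
            under s_k and its divided difference is zero.\<close>
          have "\<not> int n dvd int (len ?v) - k"
          proof
            assume "int n dvd int (len ?v) - k"
            then have "s (int (len ?v)) = s k" by (rule s_cong)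
            then have "pieri n (len v) = s k \<circ> ?v" using True pieri_Suc[of "len ?v"] sv(3) by simp
            then show False using notp by simp
          qed
          then show ?thesis using tv IH True act_xprod[OF lo'(2)] by simp
        next
          case False
          then show ?thesis using tv IH by simp
        qed
        then show "total N lo' v = (if v = pieri n (len v) then xprod N lo' (int (len v)) else 0)"
          using notp by simp
      qed
    qed
  qed
qed

text \<open>Left multiplication by s_k permutes values without crossing an admissible cut, so the
  count is that of the identity. It makes the order in N of a strip sum independent of w apart from
  the number of steps.\<close>

lemma card_low:
  assumes "w \<in> W" "lo \<le> - int (len w)"
  shows "int (card (low lo w)) = - lo"
  using assms
proof (induction "len w" arbitrary: w lo rule: less_induct)
  case less
  note w = less.prems(1)
  show ?case
  proof (cases "w = id")
    case True
    have "low lo id = {lo<..0}" by (auto simp: low_def)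
    then show ?thesis using True less.prems by simp
  next
    case False
    then obtain k where k: "\<not> up k w" using descent_exists[OF w] by blast
    let ?v = "s k \<circ> w"
    have v: "?v \<in> W" "len w = len ?v + 1" using w down_len[OF w k] by simp_all
    have good: "int (card (low lo' w)) = - lo'" if h: "lo' \<le> lo" "\<not> int n dvd lo' - k" for lo'
    proof -
      have inj: "inj_on (s k) (low lo' ?v)" using W_inj[OF s_W] by (rule inj_on_subset) simp
      have "low lo' w = s k ` low lo' ?v" using low_s[OF v(1) h(2)] by simp
      then have "card (low lo' w) = card (low lo' ?v)" using card_image[OF inj] by simp
      then show ?thesis using less.hyps[OF _ v(1), of lo'] v(2) h less.prems by simp
    qed
    show ?thesis
    proof (rule avoid_residue[of lo k])
      assume "\<not> int n dvd lo - k" then show ?thesis using good by simp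
    next
      assume "\<not> int n dvd lo - 1 - k"
      then have "int (card (low (lo - 1) w)) = 1 - lo" using good[of "lo - 1"] by simp
      moreover have "card (low (lo - 1) w) = Suc (card (low lo w))"
        unfolding low_shift[OF less.prems] using finite_low[OF w]
        by (subst card_insert_disjoint) (auto simp: low_def)
      ultimately show ?thesis by simp
    qed
  qed
qed

section \<open>Leading terms in the parameter\<close>

text \<open>\<open>r\<close> is a rational function of \<open>N\<close> with expansion \<open>r N = c * N\<^sup>-\<^sup>d + O(N\<^sup>-\<^sup>d\<^sup>-\<^sup>1)\<close>.\<close>

definition lead :: "nat \<Rightarrow> mfrac \<Rightarrow> (int \<Rightarrow> mfrac) \<Rightarrow> bool" where
  "lead d c r \<longleftrightarrow> (\<exists>A B. lead_coeff B = 1 \<and> degree A + d \<le> degree B \<and> coeff A (degree B - d) = c \<and>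
     (\<forall>N. poly B (of_int N) \<noteq> 0 \<and> r N = poly A (of_int N) / poly B (of_int N)))"

lemma leadE:
  assumes "lead d c r"
  obtains A B where "lead_coeff B = 1" "degree A + d \<le> degree B" "coeff A (degree B - d) = c"
    "\<And>N. poly B (of_int N) \<noteq> 0" "\<And>N. r N = poly A (of_int N) / poly B (of_int N)"
  using assms unfolding lead_def by blast

lemma lead_monic_mult:
  fixes B B' :: "mfrac poly"
  assumes "lead_coeff B = 1" "lead_coeff B' = 1"
  shows "lead_coeff (B * B') = 1" "degree (B * B') = degree B + degree B'"
proof -
  show "lead_coeff (B * B') = 1" unfolding lead_coeff_mult using assms by simp
  have "B \<noteq> 0" "B' \<noteq> 0" using assms by auto
  then show "degree (B * B') = degree B + degree B'" by (rule degree_mult_eq)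
qed

lemma lead_add:
  assumes "lead d c r" "lead d c' r'"
  shows "lead d (c + c') (\<lambda>N. r N + r' N)"
proof -
  obtain A B where 1: "lead_coeff B = 1" "degree A + d \<le> degree B" "coeff A (degree B - d) = c"
    "\<And>N. poly B (of_int N) \<noteq> 0" "\<And>N. r N = poly A (of_int N) / poly B (of_int N)"
    by (rule leadE[OF assms(1)]) (rule that)
  obtain A' B' where 2: "lead_coeff B' = 1" "degree A' + d \<le> degree B'" "coeff A' (degree B' - d) = c'"
    "\<And>N. poly B' (of_int N) \<noteq> 0" "\<And>N. r' N = poly A' (of_int N) / poly B' (of_int N)"
    by (rule leadE[OF assms(2)]) (rule that)
  note B = lead_monic_mult[OF 1(1) 2(1)]
  have dg: "degree (A * B') + d \<le> degree (B * B')" "degree (A' * B) + d \<le> degree (B * B')"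
    using degree_mult_le[of A B'] degree_mult_le[of A' B] 1(2) 2(2) B(2) by linarith+
  have "degree (A * B' + A' * B) + d \<le> degree (B * B')"
    using degree_add_le_max[of "A * B'" "A' * B"] dg by linarith
  moreover have "coeff (A * B' + A' * B) (degree (B * B') - d) = c + c'"
  proof -
    have e: "degree (B * B') - d = (degree B - d) + degree B'" "degree (B * B') - d = (degree B' - d) + degree B"
      using B(2) 1(2) 2(2) by simp_all
    have "coeff (A * B') (degree (B * B') - d) = c"
      unfolding e(1) using 1 2 by (subst coeff_mult_bounds) simp_all
    moreover have "coeff (A' * B) (degree (B * B') - d) = c'"
      unfolding e(2) using 1 2 by (subst coeff_mult_bounds) simp_all
    ultimately show ?thesis by simp
  qed
  moreover have "poly (B * B') (of_int N) \<noteq> 0 \<and> r N + r' N = poly (A * B' + A' * B) (of_int N) / poly (B * B') (of_int N)" for N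
    using 1(4,5)[of N] 2(4,5)[of N] by (simp add: add_frac_eq)
  ultimately show ?thesis unfolding lead_def using B(1) by blast
qed

text \<open>The constants may be zero, so the degrees of the numerators are only bounded; the
  coefficient of the product is read off at the sum of the bounds.\<close>

lemma lead_mult:
  assumes "lead d c r" "lead d' c' r'"
  shows "lead (d + d') (c * c') (\<lambda>N. r N * r' N)"
proof -
  obtain A B where 1: "lead_coeff B = 1" "degree A + d \<le> degree B" "coeff A (degree B - d) = c"
    "\<And>N. poly B (of_int N) \<noteq> 0" "\<And>N. r N = poly A (of_int N) / poly B (of_int N)"
    by (rule leadE[OF assms(1)]) (rule that)
  obtain A' B' where 2: "lead_coeff B' = 1" "degree A' + d' \<le> degree B'" "coeff A' (degree B' - d') = c'"
    "\<And>N. poly B' (of_int N) \<noteq> 0" "\<And>N. r' N = poly A' (of_int N) / poly B' (of_int N)"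
    by (rule leadE[OF assms(2)]) (rule that)
  note B = lead_monic_mult[OF 1(1) 2(1)]
  have "degree (A * A') + (d + d') \<le> degree (B * B')"
    using degree_mult_le[of A A'] 1(2) 2(2) B(2) by linarith
  moreover have "coeff (A * A') (degree (B * B') - (d + d')) = c * c'"
  proof -
    have "degree (B * B') - (d + d') = (degree B - d) + (degree B' - d')" using B(2) 1(2) 2(2) by simp
    then show ?thesis using coeff_mult_bounds[of A "degree B - d" A' "degree B' - d'"] 1 2 by simp
  qed
  moreover have "poly (B * B') (of_int N) \<noteq> 0 \<and> r N * r' N = poly (A * A') (of_int N) / poly (B * B') (of_int N)" for N
    using 1(4,5)[of N] 2(4,5)[of N] by simp
  ultimately show ?thesis unfolding lead_def using B(1) by blast
qed

lemma lead_const: "lead 0 c (\<lambda>N. c)"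
  unfolding lead_def by (rule exI[of _ "[:c:]"], rule exI[of _ 1]) simp

lemma lead_xf: "lead 1 1 (\<lambda>N. xf N a)"
  unfolding lead_def
  by (rule exI[of _ 1], rule exI[of _ "[:- e a, 1:]"]) (simp add: xf_def of_int_ne_e)

lemma lead_weaken:
  assumes "lead d c r" "d' < d"
  shows "lead d' 0 r"
proof -
  obtain A B where 1: "lead_coeff B = 1" "degree A + d \<le> degree B" "coeff A (degree B - d) = c"
    "\<And>N. poly B (of_int N) \<noteq> 0" "\<And>N. r N = poly A (of_int N) / poly B (of_int N)"
    by (rule leadE[OF assms(1)]) (rule that)
  have "coeff A (degree B - d') = 0" using 1(2) assms(2) by (intro coeff_eq_0) simp
  moreover have "degree A + d' \<le> degree B" using 1(2) assms(2) by simp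
  ultimately show ?thesis unfolding lead_def using 1 by blast
qed

text \<open>Even the zero function needs a denominator of degree at least d to fit the definition,
  hence the factor \<open>xf N 0 ^ d\<close>.\<close>

lemma lead_zero: "lead d 0 (\<lambda>N. 0)"
proof -
  have "lead d 0 (\<lambda>N. xf N 0 ^ d * 0)"
  proof -
    have "lead d 1 (\<lambda>N. xf N 0 ^ d)"
    proof (induction d)
      case 0
      then show ?case using lead_const[of 1] by simp
    next
      case (Suc d)
      then show ?case using lead_mult[OF lead_xf Suc] by simp
    qed
    from lead_mult[OF this lead_const[of 0]] show ?thesis by simp
  qed
  then show ?thesis by simp
qed

lemma lead_sum: "(\<And>y. y \<in> Y \<Longrightarrow> lead d (c y) (r y)) \<Longrightarrow> lead d (\<Sum>y\<in>Y. c y) (\<lambda>N. \<Sum>y\<in>Y. r y N)"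
  by (induction Y rule: infinite_finite_induct) (simp_all add: lead_zero lead_add)

lemma infinite_range_of_int: "infinite (range (of_int :: int \<Rightarrow> mfrac))"
proof -
  have "inj (of_int :: int \<Rightarrow> mfrac)" by (rule injI) (simp add: of_int_mfrac_eq)
  then show ?thesis using finite_imageD[of "of_int :: int \<Rightarrow> mfrac" UNIV] infinite_UNIV_int by blast
qed

lemma lead_unique:
  assumes "lead d c r" "lead d c' r"
  shows "c = c'"
proof -
  obtain A B where 1: "lead_coeff B = 1" "degree A + d \<le> degree B" "coeff A (degree B - d) = c"
    "\<And>N. poly B (of_int N) \<noteq> 0" "\<And>N. r N = poly A (of_int N) / poly B (of_int N)"
    by (rule leadE[OF assms(1)]) (rule that)
  obtain A' B' where 2: "lead_coeff B' = 1" "degree A' + d \<le> degree B'" "coeff A' (degree B' - d) = c'"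
    "\<And>N. poly B' (of_int N) \<noteq> 0" "\<And>N. r N = poly A' (of_int N) / poly B' (of_int N)"
    by (rule leadE[OF assms(2)]) (rule that)
  have "poly (A * B' - A' * B) (of_int N) = 0" for N
    using 1(4,5)[of N] 2(4,5)[of N] by (simp add: frac_eq_eq)
  then have "range (of_int :: int \<Rightarrow> mfrac) \<subseteq> {x. poly (A * B' - A' * B) x = 0}" by auto
  then have "A * B' - A' * B = 0"
    using poly_roots_finite[of "A * B' - A' * B"] infinite_range_of_int finite_subset by blast
  then have "coeff (A * B') (degree B - d + degree B') = coeff (A' * B) (degree B' - d + degree B)"
    using 1(2) 2(2) by (simp add: add.commute)
  then show ?thesis
    using 1 2 coeff_mult_bounds[of A "degree B - d" B' "degree B'"]
      coeff_mult_bounds[of A' "degree B' - d" B "degree B"] by simp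
qed

text \<open>The X h vanish at infinity to strictly increasing orders, so the constants can be read
  off one after the other: those with h < i are zero because r vanishes to order m + i, and then
  only \<open>c i\<close> contributes at that order.\<close>

lemma lead_compare:
  assumes eq: "\<And>N. r N = (\<Sum>h\<le>l. c h * X h N)"
    and X: "\<And>h. lead (m + h) 1 (X h)" and r: "lead (m + i) k r" and "i \<le> l"
  shows "c i = k"
proof -
  have main: "lead (m + h) (c h) r" if z: "\<And>h'. h' < h \<Longrightarrow> c h' = 0" and h: "h \<le> l" for h
  proof -
    have "lead (m + h) (if h' = h then c h else 0) (\<lambda>N. c h' * X h' N)" for h'
    proof (cases h' h rule: linorder_cases)
      case less
      then show ?thesis using z lead_zero by simp
    next
      case equal
      then show ?thesis using lead_mult[OF lead_const[of "c h"] X[of h]] by simp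
    next
      case greater
      then show ?thesis using lead_weaken[OF lead_mult[OF lead_const[of "c h'"] X[of h']], of "m + h"] by simp
    qed
    then have "lead (m + h) (\<Sum>h'\<le>l. if h' = h then c h else 0) (\<lambda>N. \<Sum>h'\<le>l. c h' * X h' N)"
      by (rule lead_sum)
    then show ?thesis using h by (simp add: eq[abs_def])
  qed
  have "c h = 0" if "h < i" for h
    using that
  proof (induction h rule: less_induct)
    case (less h)
    have "lead (m + h) (c h) r" using less assms(4) by (intro main) simp_all
    moreover have "lead (m + h) 0 r" using lead_weaken[OF r] less.prems by simp
    ultimately show ?case by (rule lead_unique)
  qed
  then show ?thesis using lead_unique[OF main r] assms(4) by simp
qed

section \<open>Counting strips by leading terms\<close>

definition strips_in :: "int \<Rightarrow> int \<Rightarrow> perm \<Rightarrow> perm \<Rightarrow> (int \<times> perm) list set" where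
  "strips_in lo hi w u = {ps \<in> strong_strips n w u. fst ` set ps \<subseteq> {lo<..hi}}"

lemma strong_strips_Cons:
  "(a, y) # ps \<in> strong_strips n w u \<longleftrightarrow>
    y \<in> marked_covers a w \<and> ps \<in> strong_strips n y u \<and> (\<forall>b \<in> fst ` set ps. b < a)"
  by (auto simp: strong_strips_def marked_covers_def)

lemma strong_strips_Nil: "[] \<in> strong_strips n w u \<longleftrightarrow> w = u"
  by (simp add: strong_strips_def)

text \<open>Since the markings decrease strictly, \<open>hi + 1\<close> can only mark the first
  step. This is the recursion of \<open>strip_sum\<close> without weights.\<close>

lemma strips_in_step:
  "strips_in lo (hi + 1) w u =
    strips_in lo hi w u \<union> (\<Union>y\<in>marked_covers (hi + 1) w. (\<lambda>ps. (hi + 1, y) # ps) ` strips_in lo hi y u)"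
  (is "?L = ?A \<union> ?B") if "lo \<le> hi"
proof (intro equalityI subsetI)
  fix ps assume ps: "ps \<in> ?L"
  show "ps \<in> ?A \<union> ?B"
  proof (cases ps)
    case Nil
    then show ?thesis using ps by (simp add: strips_in_def)
  next
    case (Cons p qs)
    obtain b y where p: "p = (b, y)" by (cases p)
    have 1: "y \<in> marked_covers b w" "qs \<in> strong_strips n y u" "\<forall>c \<in> fst ` set qs. c < b"
      "(b, y) # qs \<in> strong_strips n w u"
      and 2: "fst ` set qs \<subseteq> {lo<..hi + 1}" "lo < b" "b \<le> hi + 1"
      using ps unfolding Cons p strips_in_def by (auto simp: strong_strips_Cons)
    show ?thesis
    proof (cases "b = hi + 1")
      case True
      then have "fst ` set qs \<subseteq> {lo<..hi}" using 1(3) 2(1) by fastforce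
      then have "qs \<in> strips_in lo hi y u" using 1(2) by (simp add: strips_in_def)
      then show ?thesis using 1(1) True Cons p by blast
    next
      case False
      then have "fst ` set ps \<subseteq> {lo<..hi}" using 1(3) 2 Cons p by fastforce
      then show ?thesis using 1(4) Cons p by (simp add: strips_in_def)
    qed
  qed
next
  fix ps assume "ps \<in> ?A \<union> ?B"
  then consider "ps \<in> ?A" | y qs where "y \<in> marked_covers (hi + 1) w" "qs \<in> strips_in lo hi y u" "ps = (hi + 1, y) # qs"
    by blast
  then show "ps \<in> ?L"
  proof cases
    case 1
    then show ?thesis by (fastforce simp: strips_in_def)
  next
    case (2 y qs)
    then have "fst ` set qs \<subseteq> {lo<..hi}" "qs \<in> strong_strips n y u" by (simp_all add: strips_in_def)
    moreover from this have "\<forall>b \<in> fst ` set qs. b < hi + 1" by fastforce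
    ultimately have "ps \<in> strong_strips n w u" "fst ` set ps \<subseteq> {lo<..hi + 1}"
      using 2 that by (auto simp: strong_strips_Cons)
    then show ?thesis unfolding strips_in_def by blast
  qed
qed

lemma card_strips_in_step:
  assumes "lo \<le> hi" "finite (strips_in lo hi w u)"
    and "\<And>y. y \<in> marked_covers (hi + 1) w \<Longrightarrow> finite (strips_in lo hi y u)"
  shows "finite (strips_in lo (hi + 1) w u)"
    and "card (strips_in lo (hi + 1) w u) =
      card (strips_in lo hi w u) + (\<Sum>y\<in>marked_covers (hi + 1) w. card (strips_in lo hi y u))"
proof -
  let ?C = "\<lambda>y. (\<lambda>ps. (hi + 1, y) # ps) ` strips_in lo hi y u"
  have fin: "finite (\<Union>y\<in>marked_covers (hi + 1) w. ?C y)" using assms(3) by simp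
  then show "finite (strips_in lo (hi + 1) w u)" using strips_in_step[OF assms(1)] assms(2) by simp
  have disj: "strips_in lo hi w u \<inter> (\<Union>y\<in>marked_covers (hi + 1) w. ?C y) = {}"
    by (auto simp: strips_in_def)
  have "card (\<Union>y\<in>marked_covers (hi + 1) w. ?C y) = (\<Sum>y\<in>marked_covers (hi + 1) w. card (?C y))"
    using assms(3) by (intro card_UN_disjoint) auto
  also have "\<dots> = (\<Sum>y\<in>marked_covers (hi + 1) w. card (strips_in lo hi y u))"
    by (intro sum.cong refl card_image) (simp add: inj_on_def)
  finally show "card (strips_in lo (hi + 1) w u) =
      card (strips_in lo hi w u) + (\<Sum>y\<in>marked_covers (hi + 1) w. card (strips_in lo hi y u))"
    unfolding strips_in_step[OF assms(1)] using card_Un_disjoint[OF assms(2) fin disj] by simp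
qed

lemma strong_strips_len: "ps \<in> strong_strips n w u \<Longrightarrow> len w = len u + length ps"
proof (induction ps arbitrary: w)
  case Nil
  then show ?case by (simp add: strong_strips_Nil)
next
  case (Cons p ps)
  then show ?case using marked_covers_len by (cases p) (fastforce simp: strong_strips_Cons)
qed

lemma strip_sum_short:
  "len w < len u \<Longrightarrow> strip_sum N as (\<lambda>v. of_bool (v = u)) w = 0"
proof (induction as arbitrary: w)
  case (Cons a as)
  then have "strip_sum N as (\<lambda>v. of_bool (v = u)) y = 0" if "y \<in> marked_covers a w" for y
    using marked_covers_len[OF that] by simp
  then show ?case using Cons by simp
qed auto

text \<open>Every factor \<open>xf N a\<close> is 1 / N to leading order, so a strip contributes 1
  to the leading constant once all strips carry equally many factors: one for each of the m covers
  and one for each value in the interval at a nonpositive position at the start.\<close>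

lemma lead_strip_sum:
  assumes "lo \<le> hi" "w \<in> W" "\<And>c. c \<le> lo \<Longrightarrow> inv w c \<le> 0" "len w = len u + m"
  shows "finite (strips_in lo hi w u) \<and>
    lead (card {c \<in> {lo<..hi}. inv w c \<le> 0} + m) (of_nat (card (strips_in lo hi w u)))
      (\<lambda>N. strip_sum N (values_down lo hi) (\<lambda>v. of_bool (v = u)) w)"
  using assms
proof (induction hi arbitrary: w m rule: int_ge_induct)
  case base
  have S: "strips_in lo lo w u = (if w = u then {[]} else {})"
    by (auto simp: strips_in_def strong_strips_Nil)
  show ?case
  proof (cases "w = u")
    case True
    then show ?thesis using base lead_const[of 1] S by simp
  next
    case False
    then show ?thesis using S lead_zero by simp
  qed
next
  case (step hi)
  let ?a = "hi + 1" and ?d = "\<lambda>v. of_bool (v = u)"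
  let ?K = "\<lambda>w. {c \<in> {lo<..hi}. inv w c \<le> 0}"
  have vd: "values_down lo ?a = ?a # values_down lo hi"
    using step.hyps by (subst values_down_Cons) simp_all
  have fK: "finite (?K w)" by (rule finite_subset[of _ "{lo<..hi}"]) auto
  have low: "inv y c \<le> 0" if "y \<in> marked_covers ?a w" "c \<le> lo" for y c
    using marked_covers_low[OF that(1) step.prems(2) that(2)] .
  note IHw = step.IH[OF step.prems]
  show ?case
  proof (cases "inv w ?a \<le> 0")
    case True
    have "strips_in lo ?a w u = strips_in lo hi w u"
      using strips_in_step[OF step.hyps, of w u] marked_covers_empty[OF True] by simp
    moreover have "{c \<in> {lo<..?a}. inv w c \<le> 0} = insert ?a (?K w)" using True step.hyps by auto
    then have "card {c \<in> {lo<..?a}. inv w c \<le> 0} = Suc (card (?K w))" using fK by simp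
    ultimately show ?thesis
      using IHw lead_mult[OF lead_xf[of ?a] conjunct2[OF IHw]] True by (simp add: vd)
  next
    case False
    have K: "{c \<in> {lo<..?a}. inv w c \<le> 0} = ?K w"
    proof -
      have "{lo<..?a} = insert ?a {lo<..hi}" using step.hyps by auto
      then show ?thesis using False by auto
    qed
    \<comment> \<open>The count below the marking survives the cover, so all branches of the
      recursion have the same order.\<close>
    have Ky: "card (?K y) = card (?K w)" if "y \<in> marked_covers ?a w" for y
    proof -
      have "{lo<..hi} = {lo<..<?a}" by auto
      then show ?thesis using marked_covers_card[OF that step.prems(2)] by simp
    qed
    have IHy: "finite (strips_in lo hi y u) \<and>
        lead (card (?K w) + m) (of_nat (card (strips_in lo hi y u)))
          (\<lambda>N. xf N ?a * strip_sum N (values_down lo hi) ?d y)"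
      if y: "y \<in> marked_covers ?a w" for y
    proof (cases m)
      \<comment> \<open>No steps are left, so a further cover falls below the length of u and both
        the set of strips and the sum are trivial.\<close>
      case 0
      then have lt: "len y < len u" using marked_covers_len[OF y] step.prems(3) by simp
      then have "strips_in lo hi y u = {}" using strong_strips_len by (fastforce simp: strips_in_def)
      then show ?thesis using strip_sum_short[OF lt] lead_zero by simp
    next
      case (Suc m')
      then have ly: "len y = len u + m'" using marked_covers_len[OF y] step.prems(3) by simp
      note IH = step.IH[OF marked_covers_W[OF y] low[OF y] ly]
      show ?thesis using IH lead_mult[OF lead_xf[of ?a] conjunct2[OF IH]] Ky[OF y] Suc by simp
    qed
    have fin: "finite (strips_in lo hi w u)" "\<And>y. y \<in> marked_covers ?a w \<Longrightarrow> finite (strips_in lo hi y u)"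
      using IHw IHy by blast+
    have "lead (card (?K w) + m)
        (of_nat (card (strips_in lo hi w u)) + (\<Sum>y\<in>marked_covers ?a w. of_nat (card (strips_in lo hi y u))))
        (\<lambda>N. strip_sum N (values_down lo hi) ?d w
          + (\<Sum>y\<in>marked_covers ?a w. xf N ?a * strip_sum N (values_down lo hi) ?d y))"
      using IHw IHy by (intro lead_add lead_sum) blast+
    then show ?thesis
      using card_strips_in_step[OF step.hyps fin] False K by (simp add: vd sum_distrib_left)
  qed
qed

text \<open>Markings start at positive positions, hence lie above \<open>lo\<close>, and the first
  and largest one is exceeded by a value at a nonpositive position.\<close>

lemma strong_strips_markings:
  assumes "ps \<in> strong_strips n w u" "\<And>c. c \<le> lo \<Longrightarrow> inv w c \<le> 0" "\<And>x. x \<le> 0 \<Longrightarrow> w x \<le> hi"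
  shows "fst ` set ps \<subseteq> {lo<..hi}"
proof -
  have low: "\<forall>a \<in> fst ` set ps. lo < a"
    using assms(1,2)
  proof (induction ps arbitrary: w)
    case (Cons p ps)
    obtain a y where p: "p = (a, y)" by (cases p)
    have y: "y \<in> marked_covers a w" "ps \<in> strong_strips n y u"
      using Cons.prems(1) by (simp_all add: p strong_strips_Cons)
    have "lo < a" using Cons.prems(2)[of a] marked_covers_pos[OF y(1)] by force
    moreover have "\<forall>a \<in> fst ` set ps. lo < a"
      by (rule Cons.IH[OF y(2)]) (rule marked_covers_low[OF y(1) Cons.prems(2)])
    ultimately show ?case by (simp add: p)
  qed simp
  show ?thesis
  proof (cases ps)
    case (Cons p qs)
    obtain a y where p: "p = (a, y)" by (cases p)
    have y: "y \<in> marked_covers a w" "\<forall>b \<in> fst ` set qs. b < a"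
      using assms(1) by (simp_all add: Cons p strong_strips_Cons)
    obtain i where "i \<le> 0" "a < w i" using y(1) by (auto elim: marked_coversE)
    then have "a < hi" using assms(3)[of i] by simp
    then show ?thesis using low y(2) Cons p by fastforce
  qed simp
qed

section \<open>Structure constants\<close>

lemma lookup_scale: "Poly_Mapping.lookup (scale c f) x = c * Poly_Mapping.lookup f x"
  by (simp add: scale_def Poly_Mapping.map.rep_eq when_def)

lemma lookup_tensor:
  "Poly_Mapping.lookup (tensor f g) (x, y) = Poly_Mapping.lookup f x * Poly_Mapping.lookup g y"
proof -
  have inner: "(\<Sum>w \<in> Poly_Mapping.keys g. (c * Poly_Mapping.lookup g w) when (v = x \<and> w = y))
      = (c * Poly_Mapping.lookup g y when v = x)" for c :: mfrac and v
  proof -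
    have "(\<Sum>w \<in> Poly_Mapping.keys g. (c * Poly_Mapping.lookup g w) when (v = x \<and> w = y))
        = (\<Sum>w \<in> Poly_Mapping.keys g. if w = y then (c * Poly_Mapping.lookup g y when v = x) else 0)"
      by (intro sum.cong) (auto simp: when_def)
    then show ?thesis by (simp add: in_keys_iff when_def)
  qed
  have "Poly_Mapping.lookup (tensor f g) (x, y) =
      (\<Sum>v \<in> Poly_Mapping.keys f. (Poly_Mapping.lookup f v * Poly_Mapping.lookup g y when v = x))"
    by (simp add: tensor_def lookup_sum lookup_single inner)
  also have "\<dots> = (\<Sum>v \<in> Poly_Mapping.keys f. if v = x then Poly_Mapping.lookup f x * Poly_Mapping.lookup g y else 0)"
    by (intro sum.cong) (auto simp: when_def)
  finally show ?thesis by (simp add: in_keys_iff)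
qed

lemma lookup_coprod:
  "Poly_Mapping.lookup (coprod f) (x, y) = (if x = y then Poly_Mapping.lookup f x else 0)"
proof -
  have "Poly_Mapping.lookup (coprod f) (x, y) =
      (\<Sum>v \<in> Poly_Mapping.keys f. if v = x then (if x = y then Poly_Mapping.lookup f x else 0) else 0)"
    unfolding coprod_def lookup_sum lookup_single by (intro sum.cong) (auto simp: when_def)
  then show ?thesis by (simp add: in_keys_iff)
qed

text \<open>The expansion read off at the basis vectors x \<otimes> y. The right side is grouped by
  the second index, so that linear independence and functionals can be applied to one factor at a
  time.\<close>

lemma is_coprod_expansion_iff:
  assumes B: "finite B" "B \<subseteq> W" "Poly_Mapping.keys p \<subseteq> B \<times> B"
  shows "is_coprod_expansion n w p \<longleftrightarrow> range (Poly_Mapping.lookup p) \<subseteq> F \<and>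
    (\<forall>x y. (if x = y then A_fun w x else 0) =
      (\<Sum>u2\<in>B. (\<Sum>u1\<in>B. Poly_Mapping.lookup p (u1, u2) * A_fun u1 x) * A_fun u2 y))"
proof -
  let ?T = "\<Sum>(u1, u2) \<in> Poly_Mapping.keys p. scale (Poly_Mapping.lookup p (u1, u2)) (tensor (A_elt n u1) (A_elt n u2))"
  have T: "Poly_Mapping.lookup ?T (x, y) =
      (\<Sum>u2\<in>B. (\<Sum>u1\<in>B. Poly_Mapping.lookup p (u1, u2) * A_fun u1 x) * A_fun u2 y)" for x y
  proof -
    have "Poly_Mapping.lookup ?T (x, y) =
        (\<Sum>(u1, u2) \<in> Poly_Mapping.keys p. Poly_Mapping.lookup p (u1, u2) * (A_fun u1 x * A_fun u2 y))"
      by (simp add: lookup_sum lookup_scale lookup_tensor A_fun_def case_prod_unfold)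
    also have "\<dots> = (\<Sum>(u1, u2) \<in> B \<times> B. Poly_Mapping.lookup p (u1, u2) * (A_fun u1 x * A_fun u2 y))"
      using B by (intro sum.mono_neutral_left) (auto simp: in_keys_iff)
    also have "\<dots> = (\<Sum>u1\<in>B. \<Sum>u2\<in>B. Poly_Mapping.lookup p (u1, u2) * (A_fun u1 x * A_fun u2 y))"
      by (simp add: sum.cartesian_product)
    also have "\<dots> = (\<Sum>u2\<in>B. (\<Sum>u1\<in>B. Poly_Mapping.lookup p (u1, u2) * A_fun u1 x) * A_fun u2 y)"
      by (subst sum.swap) (simp add: sum_distrib_right mult.assoc)
    finally show ?thesis .
  qed
  have C: "coprod (A_elt n w) = ?T \<longleftrightarrow> (\<forall>x y. (if x = y then A_fun w x else 0) = Poly_Mapping.lookup ?T (x, y))"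
    by (auto simp: poly_mapping_eq_iff fun_eq_iff lookup_coprod A_fun_def)
  have "Poly_Mapping.keys p \<subseteq> W \<times> W" using B(2,3) by (meson Sigma_mono subset_trans)
  then show ?thesis unfolding is_coprod_expansion_def C T by (simp only: simp_thms)
qed

lemma keys_bound:
  assumes "Poly_Mapping.keys p \<subseteq> W \<times> W"
  obtains l where "k \<le> l" "Poly_Mapping.keys p \<subseteq> len_ball l \<times> len_ball l"
proof -
  define l where "l = k + (\<Sum>q\<in>Poly_Mapping.keys p. len (fst q) + len (snd q))"
  have "len (fst q) + len (snd q) \<le> l" if "q \<in> Poly_Mapping.keys p" for q
    using member_le_sum[OF that, of "\<lambda>q. len (fst q) + len (snd q)"] by (simp add: l_def)
  then have "Poly_Mapping.keys p \<subseteq> len_ball l \<times> len_ball l"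
    using assms by (fastforce simp: len_ball_def)
  then show thesis using that[of l] by (simp add: l_def)
qed

lemma A_fun_ball: "w \<in> W \<Longrightarrow> len w \<le> l \<Longrightarrow> x \<notin> len_ball l \<Longrightarrow> A_fun w x = 0"
  using A_fun_len[of w x] by (fastforce simp: len_ball_def)

lemma len_ball_W: "len_ball l \<subseteq> W" by (auto simp: len_ball_def)
lemma len_ball_mono: "k \<le> l \<Longrightarrow> len_ball k \<subseteq> len_ball l" by (auto simp: len_ball_def)

text \<open>Linear independence is applied to the second factor and then to the first, inside a ball
  containing both supports.\<close>

lemma coprod_expansion_unique:
  assumes "is_coprod_expansion n w p" "is_coprod_expansion n w p'"
  shows "p = p'"
proof -
  have "Poly_Mapping.keys p \<subseteq> W \<times> W" "Poly_Mapping.keys p' \<subseteq> W \<times> W"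
    using assms by (simp_all add: is_coprod_expansion_def)
  then obtain k l where kl: "Poly_Mapping.keys p \<subseteq> len_ball k \<times> len_ball k" "k \<le> l"
    "Poly_Mapping.keys p' \<subseteq> len_ball l \<times> len_ball l"
    using keys_bound[of p 0] keys_bound[of p'] by metis
  define B where "B = len_ball l"
  have B: "finite B" "B \<subseteq> W" unfolding B_def by (rule finite_len_ball, rule len_ball_W)
  have keys: "Poly_Mapping.keys p \<subseteq> B \<times> B" "Poly_Mapping.keys p' \<subseteq> B \<times> B"
    using kl len_ball_mono[OF kl(2)] by (auto simp: B_def)
  define d where "d q = Poly_Mapping.lookup p q - Poly_Mapping.lookup p' q" for q
  have z: "(\<Sum>u2\<in>B. (\<Sum>u1\<in>B. d (u1, u2) * A_fun u1 x) * A_fun u2 y) = 0" for x y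
  proof -
    note 1 = assms(1)[unfolded is_coprod_expansion_iff[OF B keys(1)], THEN conjunct2, rule_format, of x y]
    note 2 = assms(2)[unfolded is_coprod_expansion_iff[OF B keys(2)], THEN conjunct2, rule_format, of x y]
    show ?thesis using 1 2 by (simp add: d_def left_diff_distrib sum_subtractf)
  qed
  have "(\<Sum>u1\<in>B. d (u1, u2) * A_fun u1 x) = 0" if "u2 \<in> B" for u2 x
    using A_fun_independent[OF B z that] .
  then have d0: "d (u1, u2) = 0" if "u1 \<in> B" "u2 \<in> B" for u1 u2
    using A_fun_independent[OF B _ that(1), of "\<lambda>u1. d (u1, u2)"] that(2) by blast
  show ?thesis
  proof (rule poly_mapping_eqI)
    fix q
    show "Poly_Mapping.lookup p q = Poly_Mapping.lookup p' q"
    proof (cases "q \<in> B \<times> B")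
      case True
      then show ?thesis using d0 by (cases q) (simp add: d_def)
    next
      case False
      then show ?thesis using keys by (metis in_keys_iff subsetD)
    qed
  qed
qed

text \<open>Inverts the triangular matrix of the A_w by induction on length. Vanishing outside the
  ball allows expansions of different x to be summed over one common ball.\<close>

lemma delta_expansion:
  "x \<in> W \<Longrightarrow> \<exists>d. (\<forall>u. d u \<in> F) \<and> (\<forall>u. u \<notin> len_ball (len x) \<longrightarrow> d u = 0) \<and>
    (\<forall>y. (if y = x then 1 else 0) = (\<Sum>u\<in>len_ball (len x). d u * A_fun u y))"
proof (induction "len x" arbitrary: x rule: less_induct)
  case less
  define Z where "Z = {z \<in> W. len z < len x}"
  have "Z \<subseteq> len_ball (len x)" unfolding Z_def len_ball_def by (rule Collect_mono) simp
  then have fZ: "finite Z" by (rule finite_subset[OF _ finite_len_ball])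
  have "\<forall>z\<in>Z. \<exists>d. (\<forall>u. d u \<in> F) \<and> (\<forall>u. u \<notin> len_ball (len z) \<longrightarrow> d u = 0) \<and>
    (\<forall>y. (if y = z then 1 else 0) = (\<Sum>u\<in>len_ball (len z). d u * A_fun u y))"
    using less.hyps by (simp add: Z_def)
  from bchoice[OF this] obtain D where D: "\<And>z u. z \<in> Z \<Longrightarrow> D z u \<in> F"
    "\<And>z u. z \<in> Z \<Longrightarrow> u \<notin> len_ball (len z) \<Longrightarrow> D z u = 0"
    "\<And>z y. z \<in> Z \<Longrightarrow> (if y = z then 1 else 0) = (\<Sum>u\<in>len_ball (len z). D z u * A_fun u y)"
    by blast
  have D3: "(\<Sum>u\<in>len_ball (len x). D z u * A_fun u y) = (if y = z then 1 else 0)" if z: "z \<in> Z" for z y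
  proof -
    have "len_ball (len z) \<subseteq> len_ball (len x)" using z len_ball_mono by (simp add: Z_def)
    then have "(\<Sum>u\<in>len_ball (len x). D z u * A_fun u y) = (\<Sum>u\<in>len_ball (len z). D z u * A_fun u y)"
      using D(2)[OF z] by (intro sum.mono_neutral_right) auto
    then show ?thesis using D(3)[OF z, of y] by simp
  qed
  have axx: "A_fun x x \<noteq> 0" by (rule A_fun_support(2)[OF less.prems])
  have AF: "A_fun x y \<in> F" for y by (rule F_valuedD[OF F_valued_A_fun])
  \<comment> \<open>Subtract from A_x its terms at shorter elements z, already expanded with
    coefficients \<open>D z\<close>, and divide by the diagonal entry.\<close>
  define d where "d u = ((if u = x then 1 else 0) - (\<Sum>z\<in>Z. A_fun x z * D z u)) / A_fun x x" for u
  have "d u \<in> F" for u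
    unfolding d_def using D(1) AF by (intro F_divide F_diff F_sum F_mult) auto
  moreover have "d u = 0" if "u \<notin> len_ball (len x)" for u
  proof -
    have "u \<noteq> x" using that less.prems by (auto simp: len_ball_def)
    moreover have "D z u = 0" if "z \<in> Z" for z
      using D(2)[OF that, of u] len_ball_mono[of "len z" "len x"] that \<open>u \<notin> len_ball (len x)\<close>
      by (auto simp: Z_def)
    ultimately show ?thesis by (simp add: d_def)
  qed
  moreover have "(if y = x then 1 else 0) = (\<Sum>u\<in>len_ball (len x). d u * A_fun u y)" for y
  proof -
    have xb: "x \<in> len_ball (len x)" using less.prems by (simp add: len_ball_def)
    have "A_fun x x * (\<Sum>u\<in>len_ball (len x). d u * A_fun u y) =
        (\<Sum>u\<in>len_ball (len x). ((if u = x then 1 else 0) - (\<Sum>z\<in>Z. A_fun x z * D z u)) * A_fun u y)"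
      using axx by (simp add: d_def sum_distrib_left)
    also have "\<dots> = (\<Sum>u\<in>len_ball (len x). if u = x then A_fun x y else 0)
        - (\<Sum>u\<in>len_ball (len x). \<Sum>z\<in>Z. A_fun x z * (D z u * A_fun u y))"
    proof -
      have "(\<Sum>u\<in>len_ball (len x). (if u = x then 1 else 0) * A_fun u y) =
          (\<Sum>u\<in>len_ball (len x). if u = x then A_fun x y else 0)"
        by (rule sum.cong[OF refl]) simp
      then show ?thesis by (simp only: left_diff_distrib sum_subtractf sum_distrib_right mult.assoc)
    qed
    also have "\<dots> = A_fun x y - (\<Sum>z\<in>Z. A_fun x z * (\<Sum>u\<in>len_ball (len x). D z u * A_fun u y))"
      using xb by (subst sum.swap) (simp add: sum_distrib_left)
    also have "\<dots> = A_fun x y - (\<Sum>z\<in>Z. if z = y then A_fun x y else 0)"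
      by (intro arg_cong2[where f = minus] sum.cong refl) (auto simp: D3)
    also have "\<dots> = A_fun x x * (if y = x then 1 else 0)"
      using fZ A_fun_support(1)[OF less.prems, of y] by (auto simp: Z_def)
    finally show ?thesis using axx by simp
  qed
  ultimately show ?case by blast
qed

lemma coprod_expansion_exists:
  assumes w: "w \<in> W"
  shows "\<exists>p. is_coprod_expansion n w p"
proof -
  define B where "B = len_ball (len w)"
  have B: "finite B" "B \<subseteq> W" unfolding B_def by (rule finite_len_ball, rule len_ball_W)
  have "\<forall>x\<in>B. \<exists>d. (\<forall>u. d u \<in> F) \<and> (\<forall>u. u \<notin> len_ball (len x) \<longrightarrow> d u = 0) \<and>
    (\<forall>y. (if y = x then 1 else 0) = (\<Sum>u\<in>len_ball (len x). d u * A_fun u y))"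
    using delta_expansion B by blast
  from bchoice[OF this] obtain D where D: "\<And>x u. x \<in> B \<Longrightarrow> D x u \<in> F"
    "\<And>x u. x \<in> B \<Longrightarrow> u \<notin> len_ball (len x) \<Longrightarrow> D x u = 0"
    "\<And>x y. x \<in> B \<Longrightarrow> (if y = x then 1 else 0) = (\<Sum>u\<in>len_ball (len x). D x u * A_fun u y)"
    by blast
  have sub: "len_ball (len x) \<subseteq> B" if "x \<in> B" for x
    using that len_ball_mono unfolding B_def by (simp add: len_ball_def)
  have DB: "(\<Sum>u\<in>B. D x u * A_fun u y) = (if y = x then 1 else 0)" if x: "x \<in> B" for x y
  proof -
    have "(\<Sum>u\<in>B. D x u * A_fun u y) = (\<Sum>u\<in>len_ball (len x). D x u * A_fun u y)"
      using sub[OF x] D(2)[OF x] B by (intro sum.mono_neutral_right) auto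
    then show ?thesis using D(3)[OF x, of y] by simp
  qed
  \<comment> \<open>Expand x in both factors of the sum of \<open>A_fun w x\<close> times x
    \<otimes> x.\<close>
  define f where "f q = (\<Sum>x\<in>B. A_fun w x * (D x (fst q) * D x (snd q)))" for q
  have f0: "f q = 0" if "q \<notin> B \<times> B" for q
  proof -
    have "D x (fst q) * D x (snd q) = 0" if "x \<in> B" for x
      using D(2)[OF that] sub[OF that] \<open>q \<notin> B \<times> B\<close> by (cases q) auto
    then show ?thesis unfolding f_def by (intro sum.neutral) simp
  qed
  define p where "p = Abs_poly_mapping f"
  have "finite {q. f q \<noteq> 0}" by (rule finite_subset[of _ "B \<times> B"]) (use f0 B in auto)
  then have lp: "Poly_Mapping.lookup p = f" by (simp add: p_def)
  have keys: "Poly_Mapping.keys p \<subseteq> B \<times> B"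
  proof
    fix q assume "q \<in> Poly_Mapping.keys p"
    then have "f q \<noteq> 0" by (simp add: in_keys_iff lp)
    then show "q \<in> B \<times> B" using f0 by blast
  qed
  have "f q \<in> F" for q
    unfolding f_def using D(1) F_valuedD[OF F_valued_A_fun] by (intro F_sum F_mult)
  moreover have "(if x = y then A_fun w x else 0) = (\<Sum>u2\<in>B. (\<Sum>u1\<in>B. f (u1, u2) * A_fun u1 x) * A_fun u2 y)" for x y
  proof -
    have "(\<Sum>u2\<in>B. (\<Sum>u1\<in>B. f (u1, u2) * A_fun u1 x) * A_fun u2 y)
        = (\<Sum>u2\<in>B. \<Sum>u1\<in>B. \<Sum>z\<in>B. A_fun w z * (D z u1 * A_fun u1 x) * (D z u2 * A_fun u2 y))"
      by (simp add: f_def sum_distrib_right sum_distrib_left mult_ac)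
    also have "\<dots> = (\<Sum>u2\<in>B. \<Sum>z\<in>B. \<Sum>u1\<in>B. A_fun w z * (D z u1 * A_fun u1 x) * (D z u2 * A_fun u2 y))"
      by (rule sum.cong[OF refl]) (rule sum.swap)
    also have "\<dots> = (\<Sum>z\<in>B. \<Sum>u2\<in>B. \<Sum>u1\<in>B. A_fun w z * (D z u1 * A_fun u1 x) * (D z u2 * A_fun u2 y))"
      by (rule sum.swap)
    also have "\<dots> = (\<Sum>z\<in>B. A_fun w z * (\<Sum>u1\<in>B. D z u1 * A_fun u1 x) * (\<Sum>u2\<in>B. D z u2 * A_fun u2 y))"
      by (simp add: sum_distrib_left sum_distrib_right)
    also have "\<dots> = (\<Sum>z\<in>B. if z = x then (if x = y then A_fun w x else 0) else 0)"
      by (intro sum.cong refl) (auto simp: DB)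
    also have "\<dots> = (if x = y then A_fun w x else 0)"
      using B A_fun_ball[OF w order_refl, of y] by (simp add: B_def)
    finally show ?thesis ..
  qed
  ultimately have "is_coprod_expansion n w p"
    unfolding is_coprod_expansion_iff[OF B keys] lp by auto
  then show ?thesis by blast
qed

lemma struct_const_eq:
  assumes "w \<in> W" "is_coprod_expansion n w p"
  shows "struct_const n w u1 u2 = Poly_Mapping.lookup p (u1, u2)"
  unfolding struct_const_def using the_equality[of "is_coprod_expansion n w", OF assms(2)]
    coprod_expansion_unique[OF _ assms(2)] by simp

text \<open>Dividing by Q and summing over the first factor of the coproduct is computed in two
  ways: on the diagonal elements it reproduces the image of A_w, and on the expansion only the Pieri
  elements survive by \<open>total_pieri\<close>.\<close>

lemma strip_sum_struct_const:
  assumes w: "w \<in> W" and u: "u \<in> W" "len u \<le> len w" and p: "is_coprod_expansion n w p"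
    and l: "len w \<le> l" "Poly_Mapping.keys p \<subseteq> len_ball l \<times> len_ball l"
  shows "strip_sum N (values_down (- int l) (int l)) (\<lambda>v. of_bool (v = u)) w =
    (\<Sum>h\<le>l. Poly_Mapping.lookup p (pieri n h, u) * xprod N (- int l) (int h))"
proof -
  define B where "B = len_ball l"
  have B: "finite B" "B \<subseteq> W" unfolding B_def by (rule finite_len_ball, rule len_ball_W)
  have keys: "Poly_Mapping.keys p \<subseteq> B \<times> B" using l(2) by (simp add: B_def)
  let ?lo = "- int l" and ?hi = "int l"
  let ?g = "\<lambda>u. strip_sum N (values_down ?lo ?hi) (\<lambda>v. of_bool (v = u)) w"
  let ?c = "\<lambda>u2. \<Sum>u1\<in>B. Poly_Mapping.lookup p (u1, u2) * total N ?lo u1"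
  have lenB: "len v \<le> l" if "v \<in> B" for v using that by (simp add: B_def len_ball_def)
  have tot: "total N ?lo v = (\<Sum>x\<in>B. A_fun v x / Q N ?lo x)" if "v \<in> B" for v
    using that B lenB[OF that] len_ball_mono[of "len v" l] by (intro total_superset) (auto simp: B_def)
  have "(\<Sum>u2\<in>B. ?c u2 * A_fun u2 y) = (\<Sum>u2\<in>B. ?g u2 * A_fun u2 y)" for y
  proof -
    note ex = p[unfolded is_coprod_expansion_iff[OF B keys], THEN conjunct2, rule_format]
    have "(\<Sum>u2\<in>B. ?c u2 * A_fun u2 y) =
        (\<Sum>u2\<in>B. (\<Sum>u1\<in>B. \<Sum>x\<in>B. Poly_Mapping.lookup p (u1, u2) * A_fun u1 x / Q N ?lo x) * A_fun u2 y)"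
      by (simp add: tot sum_distrib_left)
    also have "\<dots> = (\<Sum>u2\<in>B. (\<Sum>x\<in>B. \<Sum>u1\<in>B. Poly_Mapping.lookup p (u1, u2) * A_fun u1 x / Q N ?lo x) * A_fun u2 y)"
      by (rule sum.cong[OF refl]) (rule arg_cong2[where f = times, OF sum.swap refl])
    also have "\<dots> = (\<Sum>u2\<in>B. \<Sum>x\<in>B. (\<Sum>u1\<in>B. Poly_Mapping.lookup p (u1, u2) * A_fun u1 x) * A_fun u2 y / Q N ?lo x)"
      by (simp add: sum_distrib_right sum_divide_distrib)
    also have "\<dots> = (\<Sum>x\<in>B. (\<Sum>u2\<in>B. (\<Sum>u1\<in>B. Poly_Mapping.lookup p (u1, u2) * A_fun u1 x) * A_fun u2 y) / Q N ?lo x)"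
      by (subst sum.swap) (simp add: sum_divide_distrib)
    \<comment> \<open>The coproduct is supported on the diagonal, so the weight attached to the
      first factor may be moved to the second.\<close>
    also have "\<dots> = (\<Sum>x\<in>B. if x = y then A_fun w y / Q N ?lo y else 0)"
      unfolding ex[symmetric] by (intro sum.cong) auto
    also have "\<dots> = A_fun w y / Q N ?lo y"
      using B A_fun_ball[OF w l(1), of y] by (simp add: B_def)
    also have "\<dots> = Psi N (values_down ?lo ?hi) w y"
      by (rule A_fun_divide_Q[OF w]) (use l(1) in simp_all)
    also have "\<dots> = (\<Sum>u2\<in>B. ?g u2 * A_fun u2 y)"
      unfolding Psi_def B_def by (rule strip_sum_expand[OF w l(1)])
    finally show ?thesis .
  qed
  then have z: "(\<Sum>u2\<in>B. (?c u2 - ?g u2) * A_fun u2 y) = 0" for y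
    by (simp add: left_diff_distrib sum_subtractf)
  have uB: "u \<in> B" using u l(1) by (simp add: B_def len_ball_def)
  have "?c u - ?g u = 0" using A_fun_independent[OF B z uB] .
  then have "?g u = ?c u" by simp
  also have "\<dots> = (\<Sum>v\<in>pieri n ` {..l}. Poly_Mapping.lookup p (v, u) * total N ?lo v)"
  proof (rule sum.mono_neutral_right[OF B(1)])
    show "pieri n ` {..l} \<subseteq> B" using pieri_W len_pieri by (auto simp: B_def len_ball_def)
    show "\<forall>v\<in>B - pieri n ` {..l}. Poly_Mapping.lookup p (v, u) * total N ?lo v = 0"
    proof
      fix v assume v: "v \<in> B - pieri n ` {..l}"
      then have "v \<noteq> pieri n (len v)" using lenB[of v] by auto
      then have "total N ?lo v = 0" using total_pieri[of v ?lo N] v B lenB[of v] by auto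
      then show "Poly_Mapping.lookup p (v, u) * total N ?lo v = 0" by simp
    qed
  qed
  also have "\<dots> = (\<Sum>h\<le>l. Poly_Mapping.lookup p (pieri n h, u) * total N ?lo (pieri n h))"
  proof -
    have "inj_on (pieri n) {..l}" by (rule inj_on_inverseI[of _ len]) (rule len_pieri)
    then show ?thesis by (simp only: sum.reindex o_def)
  qed
  also have "\<dots> = (\<Sum>h\<le>l. Poly_Mapping.lookup p (pieri n h, u) * xprod N ?lo (int h))"
    using total_pieri[OF pieri_W, of ?lo] by (intro sum.cong refl) (simp add: len_pieri)
  finally show ?thesis .
qed

lemma lead_xprod: "lead (l + h) 1 (\<lambda>N. xprod N (- int l) (int h))"
proof -
  have gen: "lead (card Y) 1 (\<lambda>N. \<Prod>y\<in>Y. xf N y)" for Y :: "int set"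
  proof (induction Y rule: infinite_finite_induct)
    case (insert y Y)
    then show ?case using lead_mult[OF lead_xf insert.IH] by simp
  qed (use lead_const[of 1] in simp_all)
  have "card {- int l<..int h} = l + h" by simp
  then show ?thesis using gen[of "{- int l<..int h}"] by (simp add: xprod_def)
qed

lemma struct_const_strips:
  assumes w: "w \<in> W" and u: "u \<in> W" and len: "len w = len u + i"
  shows "finite (strong_strips n w u)"
    and "struct_const n w (pieri n i) u = of_nat (card (strong_strips n w u))"
proof -
  obtain p where p: "is_coprod_expansion n w p" using coprod_expansion_exists[OF w] by blast
  then have "Poly_Mapping.keys p \<subseteq> W \<times> W" by (simp add: is_coprod_expansion_def)
  then obtain l where l: "len w \<le> l" "Poly_Mapping.keys p \<subseteq> len_ball l \<times> len_ball l"
    by (rule keys_bound)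
  have low: "inv w c \<le> 0" if "c \<le> - int l" for c using inv_bound[OF w, of c] that l(1) by linarith
  have high: "w x \<le> int l" if "x \<le> 0" for x using len_bound[OF w, of x] that l(1) by linarith
  have S: "strips_in (- int l) (int l) w u = strong_strips n w u"
  proof -
    have "fst ` set ps \<subseteq> {- int l<..int l}" if "ps \<in> strong_strips n w u" for ps
      by (rule strong_strips_markings[OF that low high])
    then show ?thesis unfolding strips_in_def by blast
  qed
  have "{c \<in> {- int l<..int l}. inv w c \<le> 0} = low (- int l) w"
  proof -
    have "c \<le> int l" if "inv w c \<le> 0" for c using inv_bound[OF w, of c] that l(1) by linarith
    then show ?thesis by (auto simp: low_def)
  qed
  \<comment> \<open>With the cut at -l the initial number of factors is l, so the strip sum has
    order l + i, the order of \<open>xprod\<close> at h = i.\<close>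
  then have card: "card {c \<in> {- int l<..int l}. inv w c \<le> 0} = l"
    using card_low[OF w, of "- int l"] l(1) by simp
  have "- int l \<le> int l" by simp
  from lead_strip_sum[OF this w low len] have fin: "finite (strong_strips n w u)"
    and lead: "lead (l + i) (of_nat (card (strong_strips n w u)))
      (\<lambda>N. strip_sum N (values_down (- int l) (int l)) (\<lambda>v. of_bool (v = u)) w)"
    unfolding S card by blast+
  show "finite (strong_strips n w u)" by (rule fin)
  \<comment> \<open>The coefficients of p do not involve N, so they are the constants to which
    \<open>lead_compare\<close> applies.\<close>
  have "Poly_Mapping.lookup p (pieri n i, u) = of_nat (card (strong_strips n w u))"
    by (rule lead_compare[OF strip_sum_struct_const[OF w u _ p l] lead_xprod lead]) (use len l(1) in simp_all)
  then show "struct_const n w (pieri n i) u = of_nat (card (strong_strips n w u))"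
    using struct_const_eq[OF w p] by simp
qed

end

theorem theorem1p1:
  fixes n i :: nat and w u :: "int \<Rightarrow> int"
  assumes "n \<ge> 2"
    and "w \<in> aff_sym n" and "u \<in> aff_sym n"
    and "int i = int (aff_len n w) - int (aff_len n u)" and "i > 0"
  shows "finite (strong_strips n w u)
    \<and> struct_const n w (pieri n i) u = of_nat (card (strong_strips n w u))"
proof -
  interpret affine_symmetric n by unfold_locales (rule assms(1))
  have "aff_len n w = aff_len n u + i" using assms(4) by simp
  then show ?thesis using struct_const_strips[OF assms(2,3)] by blast
qed

end
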